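(* A quantum channel $\Phi:\mathcal{L}(\mathcal{H})\to\mathcal{L}(\mathcal{K})$ admits a dominating transmittable algebra if and only if the following conditions all hold: 1. $N_d(\Phi)\geq0$ for every $1\leq d\leq d_{\max}(\Phi)$, so that $\mathscr{A}_{\mathrm{cap}}(\Phi)$ is defined; 2. $\mathscr{A}_{\mathrm{cap}}(\Phi)$ is transmittable via $\Phi$; 3. no algebra in $\mathfrak{F}(\mathscr{A}_{\mathrm{cap}}(\Phi))$ is transmittable via $\Phi$. When these conditions hold, $\mathscr{A}_{\mathrm{dom}}(\Phi)\cong\mathscr{A}_{\mathrm{cap}}(\Phi)$.
   Context: All Hilbert spaces are finite-dimensional and complex; all $C^*$-algebras are finite-dimensional and nonzero. $\mathcal{L}(\mathcal{H})$ is the algebra of linear operators on $\mathcal{H}$. A quantum channel is a linear, completely positive, trace-preserving map $\Phi:\mathcal{L}(\mathcal{H})\to\mathcal{L}(\mathcal{K})$; its adjoint $\Phi^*$ is defined by $\mathrm{Tr}(Y\Phi(X))=\mathrm{Tr}(\Phi^*(Y)X)$. $\cong$ denotes $*$-isomorphism. Embedding: $\mathscr{A}\leq\mathscr{B}$ means there is an injective (not necessarily unital) $*$-homomorphism $\mathscr{A}\to\mathscr{B}$; $\mathscr{A}<\mathscr{B}$ means $\mathscr{A}\leq\mathscr{B}$ and $\mathscr{A}\not\cong\mathscr{B}$. Forbidden types: $\mathscr{B}\in\mathfrak{F}(\mathscr{A})$ iff $\mathscr{B}\not\leq\mathscr{A}$ but every $\mathscr{C}<\mathscr{B}$ satisfies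 $\mathscr{C}\leq\mathscr{A}$ (algebras nonzero, up to $*$-isomorphism). Correctability: a $*$-subalgebra $\mathscr{A}\subseteq\mathcal{L}(\mathcal{H})$ with unit projection $P$ (possibly $P\neq 1_{\mathcal{H}}$) is correctable for $\Phi$ if, with $C=P\mathcal{H}$, $V:C\to\mathcal{H}$ the inclusion and $\Phi|_C(Y)=\Phi(VYV^* )$, there is a channel $\mathcal{D}:\mathcal{L}(\mathcal{K})\to\mathcal{L}(C)$ with $(\mathcal{D}\circ\Phi|_C)^*(X)=X$ for all $X\in V^*\mathscr{A}V$. $\mathscr{A}$ is transmittable via $\Phi$ if there is an injective $*$-homomorphism $\pi:\mathscr{A}\to\mathcal{L}(\mathcal{H})$ whose image is correctable for $\Phi$; $\mathscr{T}(\Phi)$ is the set of transmittable algebras up to $*$-isomorphism. A dominating transmittable algebra $\mathscr{A}_{\mathrm{dom}}(\Phi)$ is an element of $\mathscr{T}(\Phi)$ into which every element of $\mathscr{T}(\Phi)$ embeds. Hybrid capacities: $d_{\max}(\Phi)=\max\{d\in\mathbb{N}:\mathbb{M}_d(\mathbb{C})\in\mathscr{T}(\Phi)\}$, and for $1\le d\le d_{\max}(\Phi)$, $c_d(\Phi)=\max\{c\in\mathbb{N}:\mathbb{M}_d(\mathbb{C})^{\oplus c}\in\mathscr{T}(\Phi)\}$. Define integers recursively (descending in $d$) by $N_{d_{\max}(\Phi)}(\Phi)=c_{d_{\max}(\Phi)}(\Phi)$ and $$N_d(\Phi)=c_d(\Phi)-\sum_{m=d+1}^{d_{\max}(\Phi)}N_m(\Phi)\left\lfloor\frac{m}{d}\right\rfloor,\qquad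 1\leq d<d_{\max}(\Phi).$$ When all $N_d(\Phi)\ge0$, the capacity algebra is $\mathscr{A}_{\mathrm{cap}}(\Phi)=\bigoplus_{d=1}^{d_{\max}(\Phi)}\mathbb{M}_d(\mathbb{C})^{\oplus N_d(\Phi)}$, with summands of zero multiplicity omitted. *)

theory Defs
  imports "Jordan_Normal_Form.VS_Connect" "Jordan_Normal_Form.Schur_Decomposition"
begin

section \<open>Finite-dimensional C*-algebras\<close>

record 'a star_algebra = "(complex, 'a) module" +
  star :: "'a \<Rightarrow> 'a"

definition is_cstar_norm :: "'a star_algebra \<Rightarrow> ('a \<Rightarrow> real) \<Rightarrow> bool" where
  "is_cstar_norm A nrm \<longleftrightarrow>
     (\<forall>x\<in>carrier A. 0 \<le> nrm x \<and> (nrm x = 0 \<longleftrightarrow> x = \<zero>\<^bsub>A\<^esub>)) \<and>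
     (\<forall>x\<in>carrier A. \<forall>y\<in>carrier A. nrm (x \<oplus>\<^bsub>A\<^esub> y) \<le> nrm x + nrm y) \<and>
     (\<forall>c. \<forall>x\<in>carrier A. nrm (c \<odot>\<^bsub>A\<^esub> x) = cmod c * nrm x) \<and>
     (\<forall>x\<in>carrier A. \<forall>y\<in>carrier A. nrm (x \<otimes>\<^bsub>A\<^esub> y) \<le> nrm x * nrm y) \<and>
     (\<forall>x\<in>carrier A. nrm (star A x \<otimes>\<^bsub>A\<^esub> x) = (nrm x)\<^sup>2)"

text \<open>
  Nonzero finite-dimensional C*-algebras. The C*-norm of such an algebra is determined by the
  *-algebra structure, so it is not a component of the record, and completeness is automatic in
  finite dimension. A finite-dimensional C*-algebra always has a unit, which is recorded in
  the one-field; morphisms and subalgebras below need not respect it.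
\<close>

definition fd_cstar_algebra :: "'a star_algebra \<Rightarrow> bool" where
  "fd_cstar_algebra A \<longleftrightarrow>
     ring A \<and>
     vectorspace class_ring A \<and> vectorspace.fin_dim class_ring A \<and>
     (\<forall>c. \<forall>x\<in>carrier A. \<forall>y\<in>carrier A.
        (c \<odot>\<^bsub>A\<^esub> x) \<otimes>\<^bsub>A\<^esub> y = c \<odot>\<^bsub>A\<^esub> (x \<otimes>\<^bsub>A\<^esub> y) \<and>
        x \<otimes>\<^bsub>A\<^esub> (c \<odot>\<^bsub>A\<^esub> y) = c \<odot>\<^bsub>A\<^esub> (x \<otimes>\<^bsub>A\<^esub> y)) \<and>
     (\<forall>x\<in>carrier A. star A x \<in> carrier A \<and> star A (star A x) = x) \<and>
     (\<forall>x\<in>carrier A. \<forall>y\<in>carrier A.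
        star A (x \<oplus>\<^bsub>A\<^esub> y) = star A x \<oplus>\<^bsub>A\<^esub> star A y \<and>
        star A (x \<otimes>\<^bsub>A\<^esub> y) = star A y \<otimes>\<^bsub>A\<^esub> star A x) \<and>
     (\<forall>c. \<forall>x\<in>carrier A. star A (c \<odot>\<^bsub>A\<^esub> x) = cnj c \<odot>\<^bsub>A\<^esub> star A x) \<and>
     carrier A \<noteq> {\<zero>\<^bsub>A\<^esub>} \<and>
     (\<exists>nrm. is_cstar_norm A nrm)"

definition star_hom :: "'a star_algebra \<Rightarrow> 'b star_algebra \<Rightarrow> ('a \<Rightarrow> 'b) set" where
  "star_hom A B = {f \<in> LinearCombinations.module_hom class_ring A B \<inter> hom A B.
     \<forall>x\<in>carrier A. f (star A x) = star B (f x)}"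

definition star_isomorphic :: "'a star_algebra \<Rightarrow> 'b star_algebra \<Rightarrow> bool" where
  "star_isomorphic A B \<longleftrightarrow> (\<exists>f \<in> star_hom A B. bij_betw f (carrier A) (carrier B))"

definition embeds :: "'a star_algebra \<Rightarrow> 'b star_algebra \<Rightarrow> bool" where
  "embeds A B \<longleftrightarrow> (\<exists>f \<in> star_hom A B. inj_on f (carrier A))"

definition strictly_embeds :: "'a star_algebra \<Rightarrow> 'b star_algebra \<Rightarrow> bool" where
  "strictly_embeds A B \<longleftrightarrow> embeds A B \<and> \<not> star_isomorphic A B"

text \<open>
  HOL cannot quantify over carrier types. Where all finite-dimensional C*-algebras up to
  *-isomorphism are meant, we let the algebra range over all abstract C*-algebras whose carrier
  is some set of complex matrices. Every isomorphism class occurs: the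
  underlying vector space has a linear bijection onto a space of row vectors, along which the
  structure can be transported.
\<close>

type_synonym algebra = "complex mat star_algebra"

definition forbidden :: "'a star_algebra \<Rightarrow> algebra set" where
  "forbidden A = {B. fd_cstar_algebra B \<and> \<not> embeds B A \<and>
     (\<forall>C::algebra. fd_cstar_algebra C \<and> strictly_embeds C B \<longrightarrow> embeds C A)}"

text \<open>The full matrix algebra; also \<open>\<L>(\<H>)\<close> for the Hilbert space of dimension \<open>d\<close>.\<close>

definition matrix_algebra :: "nat \<Rightarrow> complex mat star_algebra" where
  "matrix_algebra d =
     \<lparr>carrier = carrier_mat d d, monoid.mult = (*), one = 1\<^sub>m d, zero = 0\<^sub>m d d, add = (+),
      module.smult = (\<cdot>\<^sub>m), star = mat_adjoint\<rparr>"

definition direct_sum :: "'i set \<Rightarrow> ('i \<Rightarrow> 'a star_algebra) \<Rightarrow> ('i \<Rightarrow> 'a) star_algebra" where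
  "direct_sum I A =
     \<lparr>carrier = (\<Pi>\<^sub>E i\<in>I. carrier (A i)),
      monoid.mult = (\<lambda>x y. \<lambda>i\<in>I. x i \<otimes>\<^bsub>A i\<^esub> y i),
      one = (\<lambda>i\<in>I. \<one>\<^bsub>A i\<^esub>),
      zero = (\<lambda>i\<in>I. \<zero>\<^bsub>A i\<^esub>),
      add = (\<lambda>x y. \<lambda>i\<in>I. x i \<oplus>\<^bsub>A i\<^esub> y i),
      module.smult = (\<lambda>c x. \<lambda>i\<in>I. c \<odot>\<^bsub>A i\<^esub> x i),
      star = (\<lambda>x. \<lambda>i\<in>I. star (A i) (x i))\<rparr>"

section \<open>Quantum channels\<close>

text \<open>
  Hilbert spaces are \<open>\<complex>\<^sup>n\<close>, and a linear map between the operator algebras of \<open>\<complex>\<^sup>n\<close> and \<open>\<complex>\<^sup>m\<close> is a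
  function on complex matrices of which only the values on \<open>carrier_mat n n\<close> matter.
\<close>

definition mat_trace :: "complex mat \<Rightarrow> complex" where
  "mat_trace A = (\<Sum>i<dim_row A. A $$ (i, i))"

text \<open>\<open>0 \<le> z\<close> for complex \<open>z\<close> means that \<open>z\<close> is real and nonnegative.\<close>

definition positive_semidefinite :: "nat \<Rightarrow> complex mat \<Rightarrow> bool" where
  "positive_semidefinite n A \<longleftrightarrow>
     A \<in> carrier_mat n n \<and> (\<forall>v\<in>carrier_vec n. 0 \<le> (A *\<^sub>v v) \<bullet>c v)"

text \<open>
  An operator on \<open>\<complex>\<^sup>k \<otimes> \<complex>\<^sup>n\<close> is a \<open>k \<times> k\<close> matrix of \<open>n \<times> n\<close> blocks; \<open>amplify k n m \<Phi>\<close> is the map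
  \<open>id \<otimes> \<Phi>\<close>, which applies \<open>\<Phi>\<close> to every block.
\<close>

definition mat_block :: "nat \<Rightarrow> complex mat \<Rightarrow> nat \<Rightarrow> nat \<Rightarrow> complex mat" where
  "mat_block n A a b = mat n n (\<lambda>(i, j). A $$ (a * n + i, b * n + j))"

definition amplify ::
    "nat \<Rightarrow> nat \<Rightarrow> nat \<Rightarrow> (complex mat \<Rightarrow> complex mat) \<Rightarrow> complex mat \<Rightarrow> complex mat" where
  "amplify k n m \<Phi> A = mat (k * m) (k * m)
     (\<lambda>(r, s). \<Phi> (mat_block n A (r div m) (s div m)) $$ (r mod m, s mod m))"

definition completely_positive ::
    "nat \<Rightarrow> nat \<Rightarrow> (complex mat \<Rightarrow> complex mat) \<Rightarrow> bool" where
  "completely_positive n m \<Phi> \<longleftrightarrow>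
     (\<forall>k A. positive_semidefinite (k * n) A \<longrightarrow> positive_semidefinite (k * m) (amplify k n m \<Phi> A))"

definition quantum_channel :: "nat \<Rightarrow> nat \<Rightarrow> (complex mat \<Rightarrow> complex mat) \<Rightarrow> bool" where
  "quantum_channel n m \<Phi> \<longleftrightarrow>
     \<Phi> \<in> LinearCombinations.module_hom class_ring (matrix_algebra n) (matrix_algebra m) \<and>
     completely_positive n m \<Phi> \<and>
     (\<forall>X\<in>carrier_mat n n. mat_trace (\<Phi> X) = mat_trace X)"

definition adjoint_map ::
    "nat \<Rightarrow> nat \<Rightarrow> (complex mat \<Rightarrow> complex mat) \<Rightarrow> complex mat \<Rightarrow> complex mat" where
  "adjoint_map n m \<Phi> Y = (THE Z. Z \<in> carrier_mat n n \<and>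
     (\<forall>X\<in>carrier_mat n n. mat_trace (Y * \<Phi> X) = mat_trace (Z * X)))"

section \<open>Correctable and transmittable algebras\<close>

definition star_subalgebra :: "nat \<Rightarrow> complex mat set \<Rightarrow> bool" where
  "star_subalgebra n S \<longleftrightarrow> S \<subseteq> carrier_mat n n \<and> 0\<^sub>m n n \<in> S \<and>
     (\<forall>X\<in>S. \<forall>Y\<in>S. X + Y \<in> S \<and> X * Y \<in> S) \<and>
     (\<forall>c. \<forall>X\<in>S. c \<cdot>\<^sub>m X \<in> S) \<and> (\<forall>X\<in>S. mat_adjoint X \<in> S)"

definition is_unit_of :: "complex mat \<Rightarrow> complex mat set \<Rightarrow> bool" where
  "is_unit_of P S \<longleftrightarrow> P \<in> S \<and> (\<forall>X\<in>S. P * X = X \<and> X * P = X)"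

text \<open>
  The subspace \<open>C = P\<H>\<close> is identified with \<open>\<complex>\<^sup>k\<close>, \<open>k = dim C\<close>, by choosing an orthonormal basis of
  \<open>C\<close>; the inclusion then becomes an \<open>n \<times> k\<close> matrix \<open>V\<close> with \<open>V\<^sup>* V = 1\<close> and \<open>V V\<^sup>* = P\<close>. Different
  choices of \<open>V\<close> differ by a unitary of \<open>\<complex>\<^sup>k\<close>, which can be absorbed into the decoder \<open>\<D>\<close>.
\<close>

definition correctable ::
    "nat \<Rightarrow> nat \<Rightarrow> (complex mat \<Rightarrow> complex mat) \<Rightarrow> complex mat set \<Rightarrow> bool" where
  "correctable n m \<Phi> S \<longleftrightarrow> star_subalgebra n S \<and>
     (\<exists>P k V \<D>. is_unit_of P S \<and>
        V \<in> carrier_mat n k \<and> mat_adjoint V * V = 1\<^sub>m k \<and> V * mat_adjoint V = P \<and>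
        quantum_channel m k \<D> \<and>
        (\<forall>X\<in>S. adjoint_map k k (\<D> \<circ> (\<lambda>Y. \<Phi> (V * Y * mat_adjoint V))) (mat_adjoint V * X * V) =
               mat_adjoint V * X * V))"

definition transmittable ::
    "nat \<Rightarrow> nat \<Rightarrow> (complex mat \<Rightarrow> complex mat) \<Rightarrow> 'a star_algebra \<Rightarrow> bool" where
  "transmittable n m \<Phi> A \<longleftrightarrow> fd_cstar_algebra A \<and>
     (\<exists>\<pi> \<in> star_hom A (matrix_algebra n). inj_on \<pi> (carrier A) \<and> correctable n m \<Phi> (\<pi> ` carrier A))"

definition dominating ::
    "nat \<Rightarrow> nat \<Rightarrow> (complex mat \<Rightarrow> complex mat) \<Rightarrow> algebra \<Rightarrow> bool" where
  "dominating n m \<Phi> A \<longleftrightarrow> transmittable n m \<Phi> A \<and>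
     (\<forall>B::algebra. transmittable n m \<Phi> B \<longrightarrow> embeds B A)"

section \<open>Hybrid capacities and the capacity algebra\<close>

definition d_max :: "nat \<Rightarrow> nat \<Rightarrow> (complex mat \<Rightarrow> complex mat) \<Rightarrow> nat" where
  "d_max n m \<Phi> = Max {d. transmittable n m \<Phi> (matrix_algebra d)}"

definition hybrid_capacity :: "nat \<Rightarrow> nat \<Rightarrow> (complex mat \<Rightarrow> complex mat) \<Rightarrow> nat \<Rightarrow> nat" where
  "hybrid_capacity n m \<Phi> d =
     Max {c. transmittable n m \<Phi> (direct_sum {..<c} (\<lambda>_. matrix_algebra d))}"

text \<open>For \<open>d = d_max\<close> the sum is empty.\<close>

function capacity_mult :: "nat \<Rightarrow> nat \<Rightarrow> (complex mat \<Rightarrow> complex mat) \<Rightarrow> nat \<Rightarrow> int" where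
  "capacity_mult n m \<Phi> d = int (hybrid_capacity n m \<Phi> d) -
     (\<Sum>e\<in>{d+1..d_max n m \<Phi>}. capacity_mult n m \<Phi> e * int (e div d))"
  by auto
termination
  by (relation "measure (\<lambda>(n, m, \<Phi>, d). d_max n m \<Phi> - d)") auto

declare capacity_mult.simps [simp del]

text \<open>Only meaningful when all multiplicities are nonnegative.\<close>

definition capacity_algebra ::
    "nat \<Rightarrow> nat \<Rightarrow> (complex mat \<Rightarrow> complex mat) \<Rightarrow> (nat \<times> nat \<Rightarrow> complex mat) star_algebra" where
  "capacity_algebra n m \<Phi> =
     direct_sum (SIGMA d:{1..d_max n m \<Phi>}. {..<nat (capacity_mult n m \<Phi> d)})
       (\<lambda>(d, _). matrix_algebra d)"

end

theory Submission
  imports Defs "Jordan_Normal_Form.Spectral_Radius"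
begin

text \<open>
  Transmittability passes to embedded algebras, so a dominating algebra \<open>A\<close> makes transmittability
  equivalent to embeddability into \<open>A\<close>.  As a *-subalgebra of \<open>\<L>(\<H>)\<close>, \<open>A\<close> is a direct sum of matrix
  algebras of sizes \<open>r\<^sub>1, \<dots>, r\<^sub>K\<close>, and \<open>c\<close> copies of the \<open>d \<times> d\<close> matrices embed in it if and only if
  \<open>c \<le> (\<Sum>i. r\<^sub>i div d)\<close>, because the diagonal matrix units go to orthogonal nonzero projections.  Hence the
  recursion for \<open>N\<^sub>d\<close> computes the number of summands of size \<open>d\<close>, and \<open>A\<close> is the capacity algebra.
  Conversely, a transmittable algebra that does not embed in the capacity algebra would contain one
  of least dimension with this property, which is forbidden and transmittable.
  C*-norms are never constructed: they are pulled back along embeddings.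
\<close>

section \<open>Adjoints and isometries\<close>

text \<open>Ranks are handled through isometries: a matrix has rank \<open>k\<close> when the
  \<open>k\<close> columns of some \<open>V\<close> with \<open>V\<dagger> * V = 1\<close> form an
  orthonormal basis of its range, and ranks are compared by comparing the numbers of columns of
  isometries. The only spectral input is a single eigenvector with nonzero real eigenvalue of a
  nonzero self-adjoint matrix; minimality of the rank turns it into a minimal projection. A simple
  summand of a *-subalgebra may act on the space with some multiplicity; one copy of each
  irreducible block is kept, as only the isomorphism type is wanted.

  Two further points shape the statements. Domination and forbidden types compare with algebras of
  matrices only, whereas direct sums consist of functions, so transmittable algebras have to be
  replaced by their images under a representation.\<close>

notation mat_adjoint ("_\<dagger>" [1000] 999)

lemma dim_mat_adjoint [simp]:
  "dim_row (A\<dagger>) = dim_col A" "dim_col (A\<dagger>) = dim_row A"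
  by (simp_all add: mat_adjoint_def)

lemma mat_adjoint_carrier [simp]: "A \<in> carrier_mat n m \<Longrightarrow> A\<dagger> \<in> carrier_mat m n"
  unfolding carrier_mat_def by simp

lemma mat_adjoint_index [simp]:
  "i < dim_col A \<Longrightarrow> j < dim_row A \<Longrightarrow> A\<dagger> $$ (i, j) = conjugate (A $$ (j, i))"
  by (simp add: mat_adjoint_def mat_of_rows_index)

lemma mat_adjoint_adjoint [simp]: "(A\<dagger>)\<dagger> = A"
  by (rule eq_matI) auto

lemma mat_adjoint_mult:
  fixes A B :: "complex mat"
  shows "dim_col A = dim_row B \<Longrightarrow> (A * B)\<dagger> = B\<dagger> * A\<dagger>"
  by (rule eq_matI) (auto simp: scalar_prod_def mult.commute)

lemma mat_adjoint_add:
  fixes A B :: "complex mat"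
  shows "dim_row A = dim_row B \<Longrightarrow> dim_col A = dim_col B \<Longrightarrow> (A + B)\<dagger> = A\<dagger> + B\<dagger>"
  by (rule eq_matI) auto

lemma mat_adjoint_minus:
  fixes A B :: "complex mat"
  shows "dim_row A = dim_row B \<Longrightarrow> dim_col A = dim_col B \<Longrightarrow> (A - B)\<dagger> = A\<dagger> - B\<dagger>"
  by (rule eq_matI) auto

lemma mat_adjoint_smult: "(c \<cdot>\<^sub>m A)\<dagger> = cnj c \<cdot>\<^sub>m A\<dagger>"
  by (rule eq_matI) auto

lemma mat_adjoint_zero [simp]: "(0\<^sub>m n m :: complex mat)\<dagger> = 0\<^sub>m m n"
  by (rule eq_matI) auto

lemma mat_adjoint_one [simp]: "(1\<^sub>m n :: complex mat)\<dagger> = 1\<^sub>m n"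
  by (rule eq_matI) auto

lemma mat_assoc:
  fixes A B C :: "complex mat"
  shows "dim_col A = dim_row B \<Longrightarrow> dim_col B = dim_row C \<Longrightarrow> A * B * C = A * (B * C)"
  by (rule assoc_mult_mat[of A "dim_row A" "dim_col A" B "dim_col B" C "dim_col C"]) auto

text \<open>Products are kept nested to the right, which hides a known product \<open>A * B\<close>
  inside \<open>A * (B * X)\<close>; this is the form in which such an equation still
  rewrites.\<close>

lemma mat_mult_cong_assoc:
  fixes A B C X :: "complex mat"
  shows "A * B = C \<Longrightarrow> dim_col A = dim_row B \<Longrightarrow> dim_col B = dim_row X \<Longrightarrow> A * (B * X) = C * X"
  using mat_assoc[of A B X] by simp

lemma mat_add_mult:
  fixes A B C :: "complex mat"
  shows "dim_row A = dim_row B \<Longrightarrow> dim_col A = dim_col B \<Longrightarrow> dim_col B = dim_row C \<Longrightarrow>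
    (A + B) * C = A * C + B * C"
  by (rule add_mult_distrib_mat[of _ "dim_row A" "dim_col A" _ _ "dim_col C"]) auto

lemma mat_mult_add:
  fixes A B C :: "complex mat"
  shows "dim_row B = dim_row C \<Longrightarrow> dim_col B = dim_col C \<Longrightarrow> dim_col A = dim_row B \<Longrightarrow>
    A * (B + C) = A * B + A * C"
  by (rule mult_add_distrib_mat[of _ "dim_row A" "dim_col A" _ "dim_col C"]) auto

lemma mat_minus_mult:
  fixes A B C :: "complex mat"
  shows "dim_row A = dim_row B \<Longrightarrow> dim_col A = dim_col B \<Longrightarrow> dim_col B = dim_row C \<Longrightarrow>
    (A - B) * C = A * C - B * C"
  by (rule minus_mult_distrib_mat[of _ "dim_row A" "dim_col A" _ _ "dim_col C"]) auto

lemma mat_mult_minus: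
  fixes A B C :: "complex mat"
  shows "dim_row B = dim_row C \<Longrightarrow> dim_col B = dim_col C \<Longrightarrow> dim_col A = dim_row B \<Longrightarrow>
    A * (B - C) = A * B - A * C"
  by (rule mult_minus_distrib_mat[of _ "dim_row A" "dim_col A" _ "dim_col C"]) auto

lemma mat_smult_mult:
  fixes A B :: "complex mat"
  shows "dim_col A = dim_row B \<Longrightarrow> (c \<cdot>\<^sub>m A) * B = c \<cdot>\<^sub>m (A * B)"
  by (rule mult_smult_assoc_mat[of _ "dim_row A" "dim_col A" _ "dim_col B"]) auto

lemma mat_mult_smult:
  fixes A B :: "complex mat"
  shows "dim_col A = dim_row B \<Longrightarrow> A * (c \<cdot>\<^sub>m B) = c \<cdot>\<^sub>m (A * B)"
  by (rule mult_smult_distrib[of _ "dim_row A" "dim_col A" _ "dim_col B"]) auto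

lemmas mat_distribs = mat_assoc mat_add_mult mat_mult_add mat_minus_mult mat_mult_minus
  mat_smult_mult mat_mult_smult mat_adjoint_mult mat_adjoint_add mat_adjoint_minus
  mat_adjoint_smult

lemma mat_mult_one [simp]:
  fixes A :: "complex mat"
  shows "dim_col A = n \<Longrightarrow> A * 1\<^sub>m n = A" "dim_row A = n \<Longrightarrow> 1\<^sub>m n * A = A"
  by (metis carrier_matI right_mult_one_mat, metis carrier_matI left_mult_one_mat)

lemma mat_mult_zero [simp]:
  fixes A :: "complex mat"
  shows "dim_col A = n \<Longrightarrow> A * 0\<^sub>m n k = 0\<^sub>m (dim_row A) k"
    "dim_row A = n \<Longrightarrow> 0\<^sub>m k n * A = 0\<^sub>m k (dim_col A)"
  by (metis carrier_matI right_mult_zero_mat, metis carrier_matI left_mult_zero_mat)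

lemma mat_smult_smult [simp]: "a \<cdot>\<^sub>m (b \<cdot>\<^sub>m A) = (a * b) \<cdot>\<^sub>m (A :: complex mat)"
  by (rule eq_matI) auto

lemma mat_one_smult [simp]: "1 \<cdot>\<^sub>m A = (A :: complex mat)"
  by (rule eq_matI) auto

lemma mat_minus_self [simp]: "A - A = 0\<^sub>m (dim_row A) (dim_col (A :: complex mat))"
  by (rule eq_matI) auto

lemma mat_mult_index:
  fixes A B :: "complex mat"
  assumes "i < dim_row A" "j < dim_col B" "dim_col A = dim_row B"
  shows "(A * B) $$ (i, j) = (\<Sum>l<dim_row B. A $$ (i, l) * B $$ (l, j))"
  using assms by (simp add: scalar_prod_def atLeast0LessThan)

lemma mat_mult_carrier [simp]: "dim_row A = n \<Longrightarrow> dim_col B = m \<Longrightarrow> A * B \<in> carrier_mat n m"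
  by (rule carrier_matI) auto

lemma mat_minus_carrier [simp]: "dim_row B = n \<Longrightarrow> dim_col B = m \<Longrightarrow> A - B \<in> carrier_mat n m"
  by (rule carrier_matI) auto

lemma mat_diff_eq_0_iff:
  fixes A B :: "complex mat"
  assumes "A \<in> carrier_mat n k" "B \<in> carrier_mat n k"
  shows "A - B = 0\<^sub>m n k \<longleftrightarrow> A = B"
proof
  assume 0: "A - B = 0\<^sub>m n k"
  show "A = B"
  proof (rule eq_matI)
    fix i j assume "i < dim_row B" "j < dim_col B"
    then have "(A - B) $$ (i, j) = 0" using assms 0 by simp
    then show "A $$ (i, j) = B $$ (i, j)" using assms \<open>i < dim_row B\<close> \<open>j < dim_col B\<close> by simp
  qed (use assms in auto)
qed (use assms in auto)

section \<open>Column norms and the size of isometries\<close>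

lemma mat_adjoint_mult_self_index:
  fixes A :: "complex mat"
  assumes "j < dim_col A"
  shows "(A\<dagger> * A) $$ (j, j) = of_real (\<Sum>i<dim_row A. (cmod (A $$ (i, j)))\<^sup>2)"
proof -
  have "(A\<dagger> * A) $$ (j, j) = (\<Sum>i<dim_row A. cnj (A $$ (i, j)) * A $$ (i, j))"
    using assms by (simp add: scalar_prod_def atLeast0LessThan)
  also have "\<dots> = of_real (\<Sum>i<dim_row A. (cmod (A $$ (i, j)))\<^sup>2)"
    unfolding of_real_sum by (intro sum.cong refl) (simp only: complex_norm_square mult.commute)
  finally show ?thesis .
qed

text \<open>All squared column norms vanish, being the diagonal entries of
  \<open>A\<dagger> * A\<close>.\<close>

lemma mat_adjoint_mult_self_eq_0:
  fixes A :: "complex mat"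
  assumes "A \<in> carrier_mat n m" "A\<dagger> * A = 0\<^sub>m m m"
  shows "A = 0\<^sub>m n m"
proof (rule eq_matI)
  fix i j assume ij: "i < dim_row (0\<^sub>m n m :: complex mat)" "j < dim_col (0\<^sub>m n m :: complex mat)"
  then have "of_real (\<Sum>i<dim_row A. (cmod (A $$ (i, j)))\<^sup>2) = (0 :: complex)"
    using mat_adjoint_mult_self_index[of j A] assms by simp
  then have "(\<Sum>i<dim_row A. (cmod (A $$ (i, j)))\<^sup>2) = 0" by (simp only: of_real_eq_0_iff)
  then have "\<forall>i\<in>{..<dim_row A}. (cmod (A $$ (i, j)))\<^sup>2 = 0"
    by (subst (asm) sum_nonneg_eq_0_iff) auto
  then show "A $$ (i, j) = 0\<^sub>m n m $$ (i, j)" using ij assms(1) by auto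
qed (use assms in auto)

text \<open>The squared moduli of the entries are summed in two ways: the \<open>k\<close> columns
  are unit vectors, so the total is \<open>k\<close>, and each of the \<open>n\<close> rows
  contributes a diagonal entry of the projection \<open>V * V\<dagger>\<close>, which is at most
  1.\<close>

lemma isometry_dim_le:
  fixes V :: "complex mat"
  assumes V: "V \<in> carrier_mat n k" and iso: "V\<dagger> * V = 1\<^sub>m k"
  shows "k \<le> n"
proof -
  define Q where "Q = V * V\<dagger>"
  define r where "r i = (\<Sum>j<k. (cmod (V $$ (i, j)))\<^sup>2)" for i
  have Q: "Q \<in> carrier_mat n n" "Q\<dagger> = Q" "Q\<dagger> * Q = Q"
    using V iso unfolding Q_def
    by (auto simp: mat_distribs) (simp add: mat_assoc[symmetric])
  \<comment> \<open>A diagonal entry of a self-adjoint idempotent \<open>Q\<close> is the squared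
    norm of its own column, hence at least its own square.\<close>
  have le1: "r i \<le> 1" if i: "i < n" for i
  proof -
    have "Q $$ (i, i) = of_real (r i)"
      using mat_adjoint_mult_self_index[of i "V\<dagger>"] V i unfolding Q_def r_def by auto
    moreover have "Q $$ (i, i) = of_real (\<Sum>j<n. (cmod (Q $$ (j, i)))\<^sup>2)"
      using mat_adjoint_mult_self_index[of i Q] Q(1) i unfolding Q(3) by simp
    ultimately have "r i = (\<Sum>j<n. (cmod (Q $$ (j, i)))\<^sup>2)" "(cmod (Q $$ (i, i)))\<^sup>2 = (r i)\<^sup>2"
      by (simp_all only: of_real_eq_iff norm_of_real power2_abs)
    then have "(r i)\<^sup>2 \<le> r i"
      using member_le_sum[of i "{..<n}" "\<lambda>j. (cmod (Q $$ (j, i)))\<^sup>2"] i by auto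
    then show ?thesis by (smt (verit) mult_le_cancel_right2 power2_eq_square)
  qed
  have "real k = (\<Sum>j<k. \<Sum>i<n. (cmod (V $$ (i, j)))\<^sup>2)"
  proof -
    have "(\<Sum>i<n. (cmod (V $$ (i, j)))\<^sup>2) = 1" if "j < k" for j
    proof -
      have "of_real (\<Sum>i<n. (cmod (V $$ (i, j)))\<^sup>2) = (1::complex)"
        using mat_adjoint_mult_self_index[of j V] V iso that by simp
      then show ?thesis by (simp only: of_real_eq_1_iff)
    qed
    then show ?thesis by simp
  qed
  also have "\<dots> = (\<Sum>i<n. r i)" unfolding r_def by (rule sum.swap)
  also have "\<dots> \<le> (\<Sum>i<n. 1)" by (rule sum_mono) (use le1 in auto)
  finally show ?thesis by simp
qed

section \<open>Orthonormal bases of ranges\<close>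

text \<open>Vectors are matrices with one column here, so that products and adjoints apply to them;
  only column 0 of \<open>w\<close> is read.\<close>

definition append_col :: "complex mat \<Rightarrow> complex mat \<Rightarrow> complex mat" where
  "append_col A w = mat (dim_row A) (Suc (dim_col A))
     (\<lambda>(i, j). if j < dim_col A then A $$ (i, j) else w $$ (i, 0))"

lemma append_col_carrier: "A \<in> carrier_mat n k \<Longrightarrow> append_col A w \<in> carrier_mat n (Suc k)"
  unfolding append_col_def carrier_mat_def by simp

lemma append_col_index:
  assumes "A \<in> carrier_mat n k" "i < n" "j < Suc k"
  shows "append_col A w $$ (i, j) = (if j < k then A $$ (i, j) else w $$ (i, 0))"
  using assms(2,3) carrier_matD[OF assms(1)] unfolding append_col_def by simp

lemma mult_append_col:
  assumes A: "A \<in> carrier_mat n m" and B: "B \<in> carrier_mat m k" and b: "b \<in> carrier_mat m 1"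
  shows "A * append_col B b = append_col (A * B) (A * b)"
proof (rule eq_matI)
  have AB: "A * B \<in> carrier_mat n k" using A B by simp
  note c = append_col_carrier[OF AB, of "A * b"] append_col_carrier[OF B, of b]
  show "dim_row (A * append_col B b) = dim_row (append_col (A * B) (A * b))"
    "dim_col (A * append_col B b) = dim_col (append_col (A * B) (A * b))"
    using carrier_matD[OF c(1)] carrier_matD[OF c(2)] carrier_matD[OF A] by simp_all
  fix i j assume "i < dim_row (append_col (A * B) (A * b))" "j < dim_col (append_col (A * B) (A * b))"
  then have ij: "i < n" "j < Suc k" using c by auto
  have "(A * append_col B b) $$ (i, j) = (\<Sum>l<m. A $$ (i, l) * append_col B b $$ (l, j))"
    using ij c A by (subst mat_mult_index) auto
  also have "\<dots> = (\<Sum>l<m. A $$ (i, l) * (if j < k then B $$ (l, j) else b $$ (l, 0)))"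
    by (intro sum.cong) (auto simp: append_col_index[OF B _ ij(2)])
  also have "\<dots> = (if j < k then (A * B) $$ (i, j) else (A * b) $$ (i, 0))"
    using ij A B b by (simp add: mat_mult_index del: index_mult_mat(1))
  finally show "(A * append_col B b) $$ (i, j) = append_col (A * B) (A * b) $$ (i, j)"
    by (simp add: append_col_index[OF AB ij])
qed

lemma append_col_isometry:
  assumes V: "V \<in> carrier_mat n k" "V\<dagger> * V = 1\<^sub>m k"
    and w: "w \<in> carrier_mat n 1" "w\<dagger> * w = 1\<^sub>m 1" and orth: "V\<dagger> * w = 0\<^sub>m k 1"
  shows "(append_col V w)\<dagger> * append_col V w = 1\<^sub>m (Suc k)"
proof (rule eq_matI)
  let ?V = "append_col V w"
  fix a b assume "a < dim_row (1\<^sub>m (Suc k) :: complex mat)" "b < dim_col (1\<^sub>m (Suc k) :: complex mat)"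
  then have ab: "a < Suc k" "b < Suc k" by auto
  note c = append_col_carrier[OF V(1), of w]
  have e: "(?V\<dagger> * ?V) $$ (a, b) = (\<Sum>i<n. cnj (?V $$ (i, a)) * ?V $$ (i, b))"
    using c ab by (subst mat_mult_index) auto
  have VV: "(\<Sum>i<n. cnj (V $$ (i, a)) * V $$ (i, b)) = (if a = b then 1 else 0)"
    if "a < k" "b < k" for a b
  proof -
    have "(V\<dagger> * V) $$ (a, b) = (\<Sum>i<n. cnj (V $$ (i, a)) * V $$ (i, b))"
      using V(1) that by (subst mat_mult_index) auto
    then show ?thesis using V(2) that by simp
  qed
  have ww: "(\<Sum>i<n. cnj (w $$ (i, 0)) * w $$ (i, 0)) = 1"
  proof -
    have "(w\<dagger> * w) $$ (0, 0) = (\<Sum>i<n. cnj (w $$ (i, 0)) * w $$ (i, 0))"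
      using w(1) by (subst mat_mult_index) auto
    then show ?thesis using w(2) by simp
  qed
  have Vw: "(\<Sum>i<n. cnj (V $$ (i, a)) * w $$ (i, 0)) = 0" if "a < k" for a
  proof -
    have "(V\<dagger> * w) $$ (a, 0) = (\<Sum>i<n. cnj (V $$ (i, a)) * w $$ (i, 0))"
      using V(1) w(1) that by (subst mat_mult_index) auto
    then show ?thesis using orth that by simp
  qed
  have wV: "(\<Sum>i<n. cnj (w $$ (i, 0)) * V $$ (i, a)) = 0" if "a < k" for a
    using arg_cong[OF Vw[OF that], of cnj] by (simp add: mult.commute)
  have "(\<Sum>i<n. cnj (?V $$ (i, a)) * ?V $$ (i, b)) = (\<Sum>i<n.
      cnj (if a < k then V $$ (i, a) else w $$ (i, 0)) * (if b < k then V $$ (i, b) else w $$ (i, 0)))"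
    using ab by (intro sum.cong) (auto simp: append_col_index[OF V(1)])
  also have "\<dots> = (1\<^sub>m (Suc k) :: complex mat) $$ (a, b)"
    using ab by (cases "a < k"; cases "b < k") (simp_all add: VV ww Vw wV)
  finally show "(?V\<dagger> * ?V) $$ (a, b) = (1\<^sub>m (Suc k) :: complex mat) $$ (a, b)" using e by simp
qed (use carrier_matD[OF append_col_carrier[OF V(1), of w]] in simp_all)

lemma nonzero_mult_column:
  fixes A :: "complex mat"
  assumes A: "A \<in> carrier_mat n m" "A \<noteq> 0\<^sub>m n m"
  obtains b where "b \<in> carrier_mat m 1" "A * b \<noteq> 0\<^sub>m n 1"
proof -
  obtain i j where ij: "i < n" "j < m" "A $$ (i, j) \<noteq> 0"
    using A by (metis carrier_matD eq_matI index_zero_mat)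
  let ?b = "mat m 1 (\<lambda>(r, _). if r = j then 1 else 0)"
  have "(A * ?b) $$ (i, 0) = (\<Sum>r<m. A $$ (i, r) * (if r = j then 1 else 0))"
    using A(1) ij by (simp add: scalar_prod_def atLeast0LessThan)
  also have "\<dots> = A $$ (i, j)" using ij by (simp add: if_distrib cong: if_cong)
  finally have "A * ?b \<noteq> 0\<^sub>m n 1" using ij by auto
  then show ?thesis using that[of ?b] by simp
qed

lemma normalize_column:
  fixes w :: "complex mat"
  assumes w: "w \<in> carrier_mat n 1" "w \<noteq> 0\<^sub>m n 1"
  shows "\<exists>c. c \<noteq> 0 \<and> (c \<cdot>\<^sub>m w)\<dagger> * (c \<cdot>\<^sub>m w) = 1\<^sub>m 1"
proof -
  define r where "r = (\<Sum>i<n. (cmod (w $$ (i, 0)))\<^sup>2)"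
  have ww: "w\<dagger> * w = of_real r \<cdot>\<^sub>m 1\<^sub>m 1"
    by (rule eq_matI) (use w mat_adjoint_mult_self_index[of 0 w] in \<open>auto simp: r_def\<close>)
  have "r \<noteq> 0"
  proof
    assume "r = 0"
    then have "w\<dagger> * w = 0\<^sub>m 1 1" using ww by auto
    then show False using mat_adjoint_mult_self_eq_0[OF w(1)] w(2) by simp
  qed
  moreover have "r \<ge> 0" unfolding r_def by (intro sum_nonneg) auto
  ultimately have r: "r > 0" by simp
  let ?c = "of_real (1 / sqrt r) :: complex"
  have "1 / sqrt r * (1 / sqrt r * r) = 1" using r by (simp add: real_div_sqrt)
  then have "?c * (?c * of_real r) = 1" by (metis of_real_1 of_real_mult)
  then have "(?c * (?c * of_real r)) \<cdot>\<^sub>m 1\<^sub>m 1 = (1\<^sub>m 1 :: complex mat)" by (intro eq_matI) auto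
  moreover have "(?c \<cdot>\<^sub>m w)\<dagger> * (?c \<cdot>\<^sub>m w) = (cnj ?c * ?c) \<cdot>\<^sub>m (w\<dagger> * w)"
    using w(1) by (simp add: mat_adjoint_smult mat_smult_mult mat_mult_smult mult.commute del: complex_cnj_complex_of_real)
  ultimately have "(?c \<cdot>\<^sub>m w)\<dagger> * (?c \<cdot>\<^sub>m w) = 1\<^sub>m 1"
    unfolding ww by (simp only: mat_smult_smult complex_cnj_complex_of_real mult.assoc)
  then show ?thesis using r by (intro exI[of _ ?c]) auto
qed

text \<open>The columns of \<open>V\<close> form an orthonormal basis of the range of
  \<open>A\<close>, found as an isometry of the form \<open>A * B\<close> with the most columns. If
  \<open>V * V\<dagger>\<close> did not fix \<open>A\<close>, a unit vector from the range of
  \<open>A\<close> orthogonal to \<open>V\<close> could be appended. The factor \<open>B\<close>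
  certifies that \<open>V\<close> stays inside the range.\<close>

lemma range_isometry:
  fixes A :: "complex mat"
  assumes A: "A \<in> carrier_mat n m"
  obtains k V B where "V \<in> carrier_mat n k" "B \<in> carrier_mat m k" "V = A * B" "V\<dagger> * V = 1\<^sub>m k"
    "V * (V\<dagger> * A) = A"
proof -
  define P where "P k \<longleftrightarrow>
    (\<exists>V B. V \<in> carrier_mat n k \<and> B \<in> carrier_mat m k \<and> V = A * B \<and> V\<dagger> * V = 1\<^sub>m k)" for k
  have P0: "P 0"
    unfolding P_def
  proof (intro exI conjI)
    show "0\<^sub>m n 0 \<in> carrier_mat n 0" "0\<^sub>m m 0 \<in> carrier_mat m 0" by auto
    show "0\<^sub>m n 0 = A * 0\<^sub>m m 0" using A by auto
  qed (rule eq_matI, auto)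
  have bound: "k \<le> n" if "P k" for k using that isometry_dim_le unfolding P_def by blast
  define k where "k = Greatest P"
  have "P k" unfolding k_def by (rule GreatestI_nat[of P, OF P0]) (use bound in blast)
  have mx: "l \<le> k" if "P l" for l
    unfolding k_def by (rule Greatest_le_nat[of P, OF that]) (use bound in blast)
  obtain V B where V: "V \<in> carrier_mat n k" and B: "B \<in> carrier_mat m k"
    and VB: "V = A * B" and iso: "V\<dagger> * V = 1\<^sub>m k"
    using \<open>P k\<close> unfolding P_def by blast
  \<comment> \<open>\<open>A * E\<close> is the part of \<open>A\<close> orthogonal to the columns
    of \<open>V\<close>; writing it with \<open>A\<close> on the left keeps it inside the range of
    \<open>A\<close>.\<close>
  define E where "E = 1\<^sub>m m - B * (V\<dagger> * A)"
  have E: "E \<in> carrier_mat m m" using A B V by (auto simp: E_def)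
  have AE: "A * E = A - V * (V\<dagger> * A)"
    using A B V by (simp add: E_def mat_distribs VB)
  have "A * E = 0\<^sub>m n m"
  proof (rule ccontr)
    assume "A * E \<noteq> 0\<^sub>m n m"
    then obtain b' where b': "b' \<in> carrier_mat m 1" "A * E * b' \<noteq> 0\<^sub>m n 1"
      using nonzero_mult_column[of "A * E" n m] A E by auto
    define b where "b = E * b'"
    have b: "b \<in> carrier_mat m 1" using E b' by (auto simp: b_def)
    have w: "A * b \<in> carrier_mat n 1" using A b by auto
    have Ab: "A * b = A * E * b'" using A E b' by (simp add: b_def mat_assoc)
    with b' have "A * b \<noteq> 0\<^sub>m n 1" by simp
    from normalize_column[OF w this] obtain c
      where c: "(c \<cdot>\<^sub>m (A * b))\<dagger> * (c \<cdot>\<^sub>m (A * b)) = 1\<^sub>m 1" by blast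
    have VAE: "V\<dagger> * (A * E) = 0\<^sub>m k m"
      unfolding AE using A V
      by (simp add: mat_mult_minus mat_mult_cong_assoc[OF iso])
    have orth: "V\<dagger> * (c \<cdot>\<^sub>m (A * b)) = 0\<^sub>m k 1"
    proof -
      have "V\<dagger> * (A * b) = V\<dagger> * (A * E) * b'" unfolding Ab using A V E b' by (simp add: mat_assoc)
      then show ?thesis unfolding VAE using A V b b' by (simp add: mat_mult_smult)
    qed
    have "c \<cdot>\<^sub>m (A * b) \<in> carrier_mat n 1" using w by simp
    from append_col_isometry[OF V iso this c orth]
    have "(append_col V (c \<cdot>\<^sub>m (A * b)))\<dagger> * append_col V (c \<cdot>\<^sub>m (A * b)) = 1\<^sub>m (Suc k)"
      .
    moreover have "A * append_col B (c \<cdot>\<^sub>m b) = append_col V (c \<cdot>\<^sub>m (A * b))"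
      unfolding VB using mult_append_col[OF A B, of "c \<cdot>\<^sub>m b"] A b by (simp add: mat_mult_smult)
    ultimately have "P (Suc k)"
      unfolding P_def using append_col_carrier[OF V] append_col_carrier[OF B] by metis
    then show False using mx by fastforce
  qed
  moreover have "V * (V\<dagger> * A) \<in> carrier_mat n m" using A V by (intro carrier_matI) simp_all
  ultimately have "V * (V\<dagger> * A) = A" using AE mat_diff_eq_0_iff[OF A] by simp
  then show ?thesis using that V B VB iso by blast
qed

text \<open>The columns of \<open>V\<close> lie in the range of \<open>P\<close>, so
  \<open>P * V = V\<close> and, by adjoints, \<open>V\<dagger> * P = V\<dagger>\<close>; then
  \<open>V * (V\<dagger> * P) = P\<close> collapses. This turns a unit projection into the inclusion
  of a code space that \<open>correctable\<close> asks for.\<close>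

lemma projection_isometry:
  fixes P :: "complex mat"
  assumes P: "P \<in> carrier_mat n n" "P\<dagger> = P" "P * P = P"
  obtains k V where "V \<in> carrier_mat n k" "V\<dagger> * V = 1\<^sub>m k" "V * V\<dagger> = P"
proof -
  obtain k V B where V: "V \<in> carrier_mat n k" "B \<in> carrier_mat n k" "V = P * B" "V\<dagger> * V = 1\<^sub>m k"
    "V * (V\<dagger> * P) = P"
    using range_isometry[OF P(1)] by metis
  have PV: "P * V = V" using P V(2) by (simp add: V(3) mat_assoc[symmetric])
  have "V\<dagger> * P = V\<dagger>"
    using arg_cong[OF PV, of mat_adjoint] P V(1) by (simp add: mat_adjoint_mult)
  then have "V * V\<dagger> = P" using V(5) by simp
  then show ?thesis using that V by blast
qed

text \<open>The eigenvector is sought for the compression of \<open>H\<close> to its own range,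
  which rules out the eigenvalue 0: a vector \<open>w = H * x\<close> with \<open>H * w = 0\<close>
  satisfies \<open>w\<dagger> * w = x\<dagger> * (H * w) = 0\<close>.\<close>

lemma selfadjoint_eigenvector:
  fixes H :: "complex mat"
  assumes H: "H \<in> carrier_mat n n" "H\<dagger> = H" "H \<noteq> 0\<^sub>m n n"
  obtains r :: real and w where "r \<noteq> 0" "w \<in> carrier_mat n 1" "w \<noteq> 0\<^sub>m n 1"
    "H * w = of_real r \<cdot>\<^sub>m w"
proof -
  obtain k V B where V: "V \<in> carrier_mat n k" and B: "B \<in> carrier_mat n k" and VB: "V = H * B"
    and iso: "V\<dagger> * V = 1\<^sub>m k" and VVH: "V * (V\<dagger> * H) = H"
    using range_isometry[OF H(1)] by metis
  have "k \<noteq> 0"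
  proof
    assume "k = 0"
    then have "V * (V\<dagger> * H) = 0\<^sub>m n n"
      using V H(1) by (intro eq_matI) (auto simp: scalar_prod_def)
    then show False using VVH H(3) by simp
  qed
  define G where "G = V\<dagger> * (H * V)"
  have G: "G \<in> carrier_mat k k" using V H by (auto simp: G_def)
  then obtain \<mu> where "\<mu> \<in> spectrum G" using spectrum_non_empty[of G k] \<open>k \<noteq> 0\<close> by auto
  then obtain y where y: "y \<in> carrier_vec k" "y \<noteq> 0\<^sub>v k" "G *\<^sub>v y = \<mu> \<cdot>\<^sub>v y"
    using G unfolding spectrum_def eigenvalue_def eigenvector_def by auto
  define z where "z = mat k 1 (\<lambda>(i, _). y $ i)"
  have z: "z \<in> carrier_mat k 1" by (simp add: z_def)
  have Gz: "G * z = \<mu> \<cdot>\<^sub>m z"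
  proof (rule eq_matI)
    fix i j assume "i < dim_row (\<mu> \<cdot>\<^sub>m z)" "j < dim_col (\<mu> \<cdot>\<^sub>m z)"
    then have ij: "i < k" "j = 0" using z by auto
    have "col z 0 = y" using y(1) by (intro eq_vecI) (auto simp: z_def)
    then show "(G * z) $$ (i, j) = (\<mu> \<cdot>\<^sub>m z) $$ (i, j)"
      using arg_cong[OF y(3), of "\<lambda>v. v $ i"] ij G y(1) z by (simp add: z_def)
  qed (use G z in auto)
  define w where "w = V * z"
  have w: "w \<in> carrier_mat n 1" using V z by (auto simp: w_def)
  have Vw: "V\<dagger> * w = z" using V z iso by (simp add: w_def mat_assoc[symmetric])
  have w0: "w \<noteq> 0\<^sub>m n 1"
  proof
    assume "w = 0\<^sub>m n 1"
    then have "z = 0\<^sub>m k 1" using Vw V by simp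
    then have "z $$ (i, 0) = 0" if "i < k" for i using that by simp
    then have "y = 0\<^sub>v k" using y(1) by (intro eq_vecI) (auto simp: z_def)
    then show False using y(2) by simp
  qed
  \<comment> \<open>The range of \<open>V\<close> contains that of \<open>H\<close>, so an
    eigenvector of the compression is one of \<open>H\<close> itself.\<close>
  have "H * w = V * (V\<dagger> * H) * w" using VVH by simp
  also have "\<dots> = V * (G * z)" using V z H by (simp add: w_def G_def mat_assoc)
  finally have Hw: "H * w = \<mu> \<cdot>\<^sub>m w" using V z by (simp add: Gz w_def mat_mult_smult)
  obtain c where c: "c \<noteq> 0" "(c \<cdot>\<^sub>m w)\<dagger> * (c \<cdot>\<^sub>m w) = 1\<^sub>m 1" using normalize_column[OF w w0] by blast
  define v where "v = c \<cdot>\<^sub>m w"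
  have v: "v \<in> carrier_mat n 1" "v\<dagger> * v = 1\<^sub>m 1" using w c by (auto simp: v_def)
  have Hv: "H * v = \<mu> \<cdot>\<^sub>m v"
    using H w Hw by (simp add: v_def mat_mult_smult mult.commute)
  \<comment> \<open>The eigenvalue is the expectation of \<open>H\<close> at a unit vector, hence
    real.\<close>
  have a: "v\<dagger> * (H * v) = \<mu> \<cdot>\<^sub>m 1\<^sub>m 1" using v Hv by (simp add: mat_mult_smult)
  have "(v\<dagger> * (H * v))\<dagger> = v\<dagger> * (H * v)" using v H by (simp add: mat_distribs)
  then have "cnj \<mu> \<cdot>\<^sub>m 1\<^sub>m 1 = \<mu> \<cdot>\<^sub>m (1\<^sub>m 1 :: complex mat)" unfolding a by (simp add: mat_adjoint_smult)
  from arg_cong[OF this, of "\<lambda>M. M $$ (0, 0)"] have "cnj \<mu> = \<mu>" by simp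
  then obtain r where r: "\<mu> = of_real r" by (metis Reals_cnj_iff Reals_cases)
  have "r \<noteq> 0"
  proof
    assume "r = 0"
    then have Hw0: "H * w = 0\<^sub>m n 1" using Hw r w by auto
    have "w\<dagger> * w = (B * z)\<dagger> * (H * w)"
      using H B z w by (simp add: w_def VB mat_distribs)
    also have "\<dots> = 0\<^sub>m 1 1" using Hw0 B z by simp
    finally show False using mat_adjoint_mult_self_eq_0[OF w] w0 by simp
  qed
  then show ?thesis using that[of r w] w w0 Hw r by simp
qed

section \<open>Structure of *-subalgebras of a matrix algebra\<close>

text \<open>Matrices of all sizes share one type, so the sum carries its dimensions; the empty sum
  is then a zero matrix of the right size.\<close>

definition msum :: "nat \<Rightarrow> nat \<Rightarrow> 'i set \<Rightarrow> ('i \<Rightarrow> complex mat) \<Rightarrow> complex mat" where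
  "msum n m I F = mat n m (\<lambda>(i, j). \<Sum>x\<in>I. F x $$ (i, j))"

lemma msum_carrier [simp]: "msum n m I F \<in> carrier_mat n m"
  and msum_dim [simp]: "dim_row (msum n m I F) = n" "dim_col (msum n m I F) = m"
  and msum_index [simp]: "i < n \<Longrightarrow> j < m \<Longrightarrow> msum n m I F $$ (i, j) = (\<Sum>x\<in>I. F x $$ (i, j))"
  by (simp_all add: msum_def)

lemma msum_cong: "(\<And>x. x \<in> I \<Longrightarrow> F x = G x) \<Longrightarrow> msum n m I F = msum n m I G"
  by (rule eq_matI) (auto intro!: sum.cong)

lemma msum_empty [simp]: "msum n m {} F = 0\<^sub>m n m"
  by (rule eq_matI) auto

lemma msum_insert:
  "finite I \<Longrightarrow> x \<notin> I \<Longrightarrow> F x \<in> carrier_mat n m \<Longrightarrow> msum n m (insert x I) F = F x + msum n m I F"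
  by (rule eq_matI) auto

lemma msum_delta:
  assumes "finite I" "a \<in> I" "F a \<in> carrier_mat n m"
  shows "msum n m I (\<lambda>x. if x = a then F x else 0\<^sub>m n m) = F a"
proof (rule eq_matI)
  fix i j assume ij: "i < dim_row (F a)" "j < dim_col (F a)"
  then have "msum n m I (\<lambda>x. if x = a then F x else 0\<^sub>m n m) $$ (i, j) =
      (\<Sum>x\<in>I. if x = a then F a $$ (i, j) else 0)"
    using assms(3) by (auto intro!: sum.cong)
  then show "msum n m I (\<lambda>x. if x = a then F x else 0\<^sub>m n m) $$ (i, j) = F a $$ (i, j)"
    using assms by simp
qed (use assms(3) in auto)

lemma mult_msum:
  assumes "A \<in> carrier_mat k n" "\<And>x. x \<in> I \<Longrightarrow> F x \<in> carrier_mat n m"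
  shows "A * msum n m I F = msum k m I (\<lambda>x. A * F x)"
proof (rule eq_matI)
  fix i j assume "i < dim_row (msum k m I (\<lambda>x. A * F x))" "j < dim_col (msum k m I (\<lambda>x. A * F x))"
  then have ij: "i < k" "j < m" by auto
  have "(A * msum n m I F) $$ (i, j) = (\<Sum>l<n. A $$ (i, l) * (\<Sum>x\<in>I. F x $$ (l, j)))"
    using ij assms(1) by (subst mat_mult_index) auto
  also have "\<dots> = (\<Sum>x\<in>I. \<Sum>l<n. A $$ (i, l) * F x $$ (l, j))"
    unfolding sum_distrib_left by (rule sum.swap)
  also have "\<dots> = (\<Sum>x\<in>I. (A * F x) $$ (i, j))"
    using ij assms(1) by (intro sum.cong refl, subst mat_mult_index) (auto dest: assms(2))
  finally show "(A * msum n m I F) $$ (i, j) = msum k m I (\<lambda>x. A * F x) $$ (i, j)" using ij by simp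
qed (use assms(1) in auto)

lemma msum_mult:
  assumes "A \<in> carrier_mat m k" "\<And>x. x \<in> I \<Longrightarrow> F x \<in> carrier_mat n m"
  shows "msum n m I F * A = msum n k I (\<lambda>x. F x * A)"
proof (rule eq_matI)
  fix i j assume "i < dim_row (msum n k I (\<lambda>x. F x * A))" "j < dim_col (msum n k I (\<lambda>x. F x * A))"
  then have ij: "i < n" "j < k" by auto
  have "(msum n m I F * A) $$ (i, j) = (\<Sum>l<m. (\<Sum>x\<in>I. F x $$ (i, l)) * A $$ (l, j))"
    using ij assms(1) by (subst mat_mult_index) auto
  also have "\<dots> = (\<Sum>x\<in>I. \<Sum>l<m. F x $$ (i, l) * A $$ (l, j))"
    unfolding sum_distrib_right by (rule sum.swap)
  also have "\<dots> = (\<Sum>x\<in>I. (F x * A) $$ (i, j))"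
  proof (intro sum.cong refl)
    fix x assume "x \<in> I"
    then show "(\<Sum>l<m. F x $$ (i, l) * A $$ (l, j)) = (F x * A) $$ (i, j)"
      using ij assms(1) assms(2)[of x] by (subst mat_mult_index) auto
  qed
  finally show "(msum n m I F * A) $$ (i, j) = msum n k I (\<lambda>x. F x * A) $$ (i, j)" using ij by simp
qed (use assms(1) in auto)

lemma mat_adjoint_msum:
  assumes "\<And>x. x \<in> I \<Longrightarrow> F x \<in> carrier_mat n m"
  shows "(msum n m I F)\<dagger> = msum m n I (\<lambda>x. (F x)\<dagger>)"
proof (rule eq_matI)
  fix i j assume "i < dim_row (msum m n I (\<lambda>x. (F x)\<dagger>))" "j < dim_col (msum m n I (\<lambda>x. (F x)\<dagger>))"
  then show "(msum n m I F)\<dagger> $$ (i, j) = msum m n I (\<lambda>x. (F x)\<dagger>) $$ (i, j)"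
    using carrier_matD[OF assms] by (auto intro!: sum.cong)
qed auto

definition mat_of_columns :: "nat \<Rightarrow> nat \<Rightarrow> (nat \<Rightarrow> complex mat) \<Rightarrow> complex mat" where
  "mat_of_columns n d w = mat n d (\<lambda>(i, s). w s $$ (i, 0))"

lemma mat_of_columns_carrier [simp]: "mat_of_columns n d w \<in> carrier_mat n d"
  and mat_of_columns_dim [simp]: "dim_row (mat_of_columns n d w) = n" "dim_col (mat_of_columns n d w) = d"
  and mat_of_columns_index [simp]: "i < n \<Longrightarrow> s < d \<Longrightarrow> mat_of_columns n d w $$ (i, s) = w s $$ (i, 0)"
  by (simp_all add: mat_of_columns_def)

lemma mult_mat_of_columns:
  assumes "M \<in> carrier_mat k n" "\<And>s. s < d \<Longrightarrow> w s \<in> carrier_mat n 1"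
  shows "M * mat_of_columns n d w = mat_of_columns k d (\<lambda>s. M * w s)"
proof (rule eq_matI)
  fix i s assume "i < dim_row (mat_of_columns k d (\<lambda>s. M * w s))"
    "s < dim_col (mat_of_columns k d (\<lambda>s. M * w s))"
  then have ids: "i < k" "s < d" by auto
  then show "(M * mat_of_columns n d w) $$ (i, s) = mat_of_columns k d (\<lambda>s. M * w s) $$ (i, s)"
    using assms(1) assms(2)[OF ids(2)] by (simp add: mat_mult_index del: index_mult_mat(1))
qed (use assms in auto)

lemma mat_of_columns_cong: "(\<And>s. s < d \<Longrightarrow> v s = w s) \<Longrightarrow> mat_of_columns n d v = mat_of_columns n d w"
  by (rule eq_matI) auto

lemma mat_of_columns_isometry:
  assumes w: "\<And>s. s < d \<Longrightarrow> w s \<in> carrier_mat n 1"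
    and orth: "\<And>s t. s < d \<Longrightarrow> t < d \<Longrightarrow> (w s)\<dagger> * w t = (if s = t then 1\<^sub>m 1 else 0\<^sub>m 1 1)"
  shows "(mat_of_columns n d w)\<dagger> * mat_of_columns n d w = 1\<^sub>m d"
proof (rule eq_matI)
  fix s t assume "s < dim_row (1\<^sub>m d :: complex mat)" "t < dim_col (1\<^sub>m d :: complex mat)"
  then have st: "s < d" "t < d" by auto
  have "((mat_of_columns n d w)\<dagger> * mat_of_columns n d w) $$ (s, t) = ((w s)\<dagger> * w t) $$ (0, 0)"
    using st w[OF st(1)] w[OF st(2)] by (simp add: mat_mult_index del: index_mult_mat(1))
  then show "((mat_of_columns n d w)\<dagger> * mat_of_columns n d w) $$ (s, t) = (1\<^sub>m d :: complex mat) $$ (s, t)"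
    using st orth by simp
qed auto

text \<open>A unit vector chosen in the range of each \<open>f i\<close> gives orthonormal columns,
  hence an isometry into dimension \<open>n\<close>. The bounds on the size of a simple summand, on
  the number of splittings and on the number of embedded copies all rest on this.\<close>

lemma orthogonal_family_card_le:
  fixes f :: "'i \<Rightarrow> complex mat"
  assumes fin: "finite I"
    and f: "\<And>i. i \<in> I \<Longrightarrow> f i \<in> carrier_mat n n" "\<And>i. i \<in> I \<Longrightarrow> f i \<noteq> 0\<^sub>m n n"
    and orth: "\<And>i j. i \<in> I \<Longrightarrow> j \<in> I \<Longrightarrow> i \<noteq> j \<Longrightarrow> (f i)\<dagger> * f j = 0\<^sub>m n n"
  shows "card I \<le> n"
proof -
  obtain h where h: "bij_betw h {..<card I} I"
    using ex_bij_betw_nat_finite[OF fin] by (auto simp: atLeast0LessThan)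
  have "\<exists>b. b \<in> carrier_mat n 1 \<and> (f i * b)\<dagger> * (f i * b) = 1\<^sub>m 1" if i: "i \<in> I" for i
  proof -
    obtain b where b: "b \<in> carrier_mat n 1" "f i * b \<noteq> 0\<^sub>m n 1"
      using nonzero_mult_column[OF f(1)[OF i] f(2)[OF i]] by metis
    then obtain c where "(c \<cdot>\<^sub>m (f i * b))\<dagger> * (c \<cdot>\<^sub>m (f i * b)) = 1\<^sub>m 1"
      using normalize_column[of "f i * b" n] f(1)[OF i] by auto
    then show ?thesis
      using b f(1)[OF i] by (intro exI[of _ "c \<cdot>\<^sub>m b"]) (simp add: mat_mult_smult)
  qed
  then obtain b where b: "\<And>i. i \<in> I \<Longrightarrow> b i \<in> carrier_mat n 1"
    "\<And>i. i \<in> I \<Longrightarrow> (f i * b i)\<dagger> * (f i * b i) = 1\<^sub>m 1"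
    by metis
  define w where "w s = f (h s) * b (h s)" for s
  have hI: "h s \<in> I" if "s < card I" for s using h that by (auto simp: bij_betw_def)
  have "(w s)\<dagger> * w t = (if s = t then 1\<^sub>m 1 else 0\<^sub>m 1 1)" if st: "s < card I" "t < card I" for s t
  proof (cases "s = t")
    case False
    then have ne: "h s \<noteq> h t" using h st by (auto simp: bij_betw_def inj_on_def)
    show ?thesis
      using False f(1)[OF hI[OF st(1)]] f(1)[OF hI[OF st(2)]] b(1)[OF hI[OF st(1)]]
        b(1)[OF hI[OF st(2)]] hI[OF st(1)] hI[OF st(2)]
      by (simp add: w_def mat_adjoint_mult mat_assoc mat_mult_cong_assoc[OF orth[OF hI[OF st(1)] hI[OF st(2)] ne]])
  qed (use b hI st in \<open>simp add: w_def\<close>)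
  moreover have "w s \<in> carrier_mat n 1" if "s < card I" for s
    using f(1)[OF hI[OF that]] b(1)[OF hI[OF that]] by (auto simp: w_def)
  ultimately show ?thesis
    using isometry_dim_le[OF mat_of_columns_carrier mat_of_columns_isometry] by blast
qed

section \<open>Minimal projections and simple summands\<close>

lemma star_subalgebraD:
  assumes "star_subalgebra n S"
  shows "X \<in> S \<Longrightarrow> X \<in> carrier_mat n n" "0\<^sub>m n n \<in> S" "X \<in> S \<Longrightarrow> Y \<in> S \<Longrightarrow> X + Y \<in> S"
    "X \<in> S \<Longrightarrow> Y \<in> S \<Longrightarrow> X * Y \<in> S" "X \<in> S \<Longrightarrow> c \<cdot>\<^sub>m X \<in> S" "X \<in> S \<Longrightarrow> X\<dagger> \<in> S"
  using assms by (auto simp: star_subalgebra_def)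

lemma star_subalgebra_minus:
  assumes S: "star_subalgebra n S" and XY: "X \<in> S" "Y \<in> S"
  shows "X - Y \<in> S"
proof -
  have "X - Y = X + (-1) \<cdot>\<^sub>m Y"
    using star_subalgebraD(1)[OF S XY(1)] star_subalgebraD(1)[OF S XY(2)] by (intro eq_matI) auto
  then show ?thesis using star_subalgebraD[OF S] XY by metis
qed

lemma star_subalgebra_msum:
  assumes S: "star_subalgebra n S" and "finite I" "\<And>x. x \<in> I \<Longrightarrow> F x \<in> S"
  shows "msum n n I F \<in> S"
  using assms(2,3)
proof (induction I)
  case (insert x I)
  then show ?case
    using star_subalgebraD(1,3)[OF S] by (simp add: msum_insert)
qed (use star_subalgebraD[OF S] in simp)

text \<open>A self-adjoint element of least rank is a multiple of a minimal projection.\<close>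

lemma minimal_projection_exists:
  assumes S: "star_subalgebra n S" and nz: "S \<noteq> {0\<^sub>m n n}"
  obtains p where "p \<in> S" "p\<dagger> = p" "p * p = p" "p \<noteq> 0\<^sub>m n n"
    "\<And>y. y \<in> S \<Longrightarrow> \<exists>c. p * (y * p) = c \<cdot>\<^sub>m p"
proof -
  note SD = star_subalgebraD[OF S]
  \<comment> \<open>\<open>R h k\<close> says that \<open>h\<close> has rank
    \<open>k\<close>.\<close>
  define R where "R h k \<longleftrightarrow> (\<exists>V B. V \<in> carrier_mat n k \<and> B \<in> carrier_mat n k \<and> V = h * B \<and>
    V\<dagger> * V = 1\<^sub>m k \<and> V * (V\<dagger> * h) = h)" for h :: "complex mat" and k
  have ex_R: "\<exists>k. R h k" if "h \<in> carrier_mat n n" for h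
    using range_isometry[OF that] unfolding R_def by metis
  define P where "P k \<longleftrightarrow> (\<exists>h\<in>S. h\<dagger> = h \<and> h \<noteq> 0\<^sub>m n n \<and> R h k)" for k
  obtain x where x: "x \<in> S" "x \<noteq> 0\<^sub>m n n" using nz SD(2) by blast
  \<comment> \<open>A nonzero self-adjoint element, so that a least rank exists.\<close>
  have "x\<dagger> * x \<noteq> 0\<^sub>m n n" using mat_adjoint_mult_self_eq_0[OF SD(1)[OF x(1)]] x(2) by blast
  moreover have "(x\<dagger> * x)\<dagger> = x\<dagger> * x" using SD(1)[OF x(1)] by (simp add: mat_adjoint_mult)
  moreover have "x\<dagger> * x \<in> S" by (intro SD(4,6) x)
  moreover obtain k where "R (x\<dagger> * x) k" using ex_R SD(1) \<open>x\<dagger> * x \<in> S\<close> by metis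
  ultimately have "\<exists>k. P k" unfolding P_def by metis
  then have "P (Least P)" by (rule LeastI_ex)
  define k where "k = Least P"
  obtain h V B where h: "h \<in> S" "h\<dagger> = h" "h \<noteq> 0\<^sub>m n n"
    and V: "V \<in> carrier_mat n k" "V\<dagger> * V = 1\<^sub>m k" "V * (V\<dagger> * h) = h"
    using \<open>P (Least P)\<close> unfolding P_def R_def k_def by blast
  have hc: "h \<in> carrier_mat n n" by (rule SD(1)[OF h(1)])
  \<comment> \<open>A self-adjoint element with range inside that of \<open>h\<close> that kills a
    nonzero vector of this range has smaller rank, hence vanishes.\<close>
  have least: "x = 0\<^sub>m n n" if x: "x \<in> S" "x\<dagger> = x" and xy: "x = h * y" "y \<in> carrier_mat n n"
    and w: "w = h * z" "z \<in> carrier_mat n 1" "w \<noteq> 0\<^sub>m n 1" "x * w = 0\<^sub>m n 1" for x y w z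
  proof (rule ccontr)
    assume "x \<noteq> 0\<^sub>m n n"
    moreover have xc: "x \<in> carrier_mat n n" by (rule SD(1)[OF x(1)])
    moreover obtain k' where "R x k'" using ex_R xc by blast
    ultimately have kk': "k \<le> k'" unfolding k_def P_def using x by (intro Least_le) blast
    obtain V' B' where V': "V' \<in> carrier_mat n k'" "V' = x * B'" "V'\<dagger> * V' = 1\<^sub>m k'"
      and B': "B' \<in> carrier_mat n k'"
      using \<open>R x k'\<close> unfolding R_def by blast
    have VV': "V * (V\<dagger> * V') = V'"
    proof -
      have "V * (V\<dagger> * (h * (y * B'))) = V * (V\<dagger> * h) * (y * B')"
        using V(1) hc xy(2) B' by (simp add: mat_assoc)
      then show ?thesis using V(3) V'(2) hc xy B' by (simp add: mat_assoc)
    qed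
    have VV'a: "V'\<dagger> * (V * V\<dagger>) = V'\<dagger>"
      using arg_cong[OF VV', of mat_adjoint] V(1) V'(1) by (simp add: mat_adjoint_mult mat_assoc)
    define W where "W = V\<dagger> * V'"
    have W: "W \<in> carrier_mat k k'" using V(1) V'(1) by (simp add: W_def)
    have WW: "W\<dagger> * W = 1\<^sub>m k'"
      using V(1) V'(1,3) VV' by (simp add: W_def mat_adjoint_mult mat_assoc)
    \<comment> \<open>Minimality leaves no room: \<open>W\<close>, which holds the coordinates of
      the basis \<open>V'\<close> in the basis \<open>V\<close>, is square and so unitary, and
      \<open>x\<close> has the whole range of \<open>h\<close> as its range. The vector
      \<open>w\<close> lies in it, but \<open>V'\<dagger> * w = 0\<close>.\<close>
    have "k' = k" using isometry_dim_le[OF W WW] kk' by simp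
    then have WW': "W * W\<dagger> = 1\<^sub>m k"
      using mat_mult_left_right_inverse[of "W\<dagger>" k W] W WW by simp
    have wc: "w \<in> carrier_mat n 1" using w hc by simp
    have "w = V * (V\<dagger> * h) * z" using V(3) w(1) by simp
    then have w1: "w = V * (V\<dagger> * w)" using V(1) hc w(1,2) by (simp add: mat_assoc)
    have "V'\<dagger> * w = B'\<dagger> * (x * w)"
      using V'(2) x(2) xc B' wc by (simp add: mat_adjoint_mult mat_assoc)
    then have V'w: "V'\<dagger> * w = 0\<^sub>m k' 1" using w(4) B' by simp
    have "w = V * ((W * W\<dagger>) * (V\<dagger> * w))" unfolding WW' using w1 V(1) wc by simp
    also have "\<dots> = (V * (V\<dagger> * V')) * ((V'\<dagger> * (V * V\<dagger>)) * w)"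
      using V(1) V'(1) wc by (simp add: W_def mat_adjoint_mult mat_assoc)
    also have "\<dots> = V' * (V'\<dagger> * w)" unfolding VV' VV'a ..
    also have "\<dots> = 0\<^sub>m n 1" unfolding V'w using V'(1) by simp
    finally show False using w(3) by simp
  qed
  obtain r w where rw: "r \<noteq> 0" "w \<in> carrier_mat n 1" "w \<noteq> 0\<^sub>m n 1" "h * w = complex_of_real r \<cdot>\<^sub>m w"
    using selfadjoint_eigenvector[OF hc h(2,3)] by metis
  let ?r = "complex_of_real r"
  \<comment> \<open>This element kills the eigenvector \<open>w\<close>, so it is zero, and
    \<open>h\<close> divided by its eigenvalue is idempotent.\<close>
  have "h * h - ?r \<cdot>\<^sub>m h = 0\<^sub>m n n"
  proof (rule least)
    show "h * h - ?r \<cdot>\<^sub>m h \<in> S" by (intro star_subalgebra_minus[OF S] SD(4,5) h)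
    show "(h * h - ?r \<cdot>\<^sub>m h)\<dagger> = h * h - ?r \<cdot>\<^sub>m h" using hc h(2) by (simp add: mat_distribs)
    show "h * h - ?r \<cdot>\<^sub>m h = h * (h - ?r \<cdot>\<^sub>m 1\<^sub>m n)" using hc by (simp add: mat_mult_minus mat_mult_smult)
    show "w = h * ((1 / ?r) \<cdot>\<^sub>m w)" using rw hc by (simp add: mat_mult_smult)
    show "(h * h - ?r \<cdot>\<^sub>m h) * w = 0\<^sub>m n 1"
      using rw hc by (simp add: mat_minus_mult mat_assoc mat_mult_smult mat_smult_mult)
  qed (use rw hc in auto)
  then have hh: "h * h = ?r \<cdot>\<^sub>m h" using mat_diff_eq_0_iff[of "h * h" n n "?r \<cdot>\<^sub>m h"] hc by simp
  define p where "p = (1 / ?r) \<cdot>\<^sub>m h"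
  have hp: "h = ?r \<cdot>\<^sub>m p" using rw(1) by (simp add: p_def)
  have pc: "p \<in> carrier_mat n n" using hc by (simp add: p_def)
  have pS: "p \<in> S" unfolding p_def by (intro SD(5) h)
  have pa: "p\<dagger> = p" using h(2) by (simp add: p_def mat_adjoint_smult)
  have pp: "p * p = p" using hc rw(1) by (simp add: p_def mat_mult_smult mat_smult_mult hh)
  have p0: "p \<noteq> 0\<^sub>m n n" using h(3) hp by auto
  \<comment> \<open>The same argument in the corner: subtracting from a self-adjoint
    \<open>y\<close> the multiple of \<open>p\<close> by an eigenvalue \<open>s\<close> kills an
    eigenvector, which lies in the range of \<open>p\<close> because \<open>s\<close> is not
    zero.\<close>
  have sa: "\<exists>c. y = c \<cdot>\<^sub>m p" if y: "y \<in> S" "y\<dagger> = y" "p * y = y" "y * p = y" for y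
  proof (cases "y = 0\<^sub>m n n")
    case True
    then show ?thesis using pc by (intro exI[of _ 0]) auto
  next
    case False
    have yc: "y \<in> carrier_mat n n" by (rule SD(1)[OF y(1)])
    obtain s v where sv: "s \<noteq> 0" "v \<in> carrier_mat n 1" "v \<noteq> 0\<^sub>m n 1" "y * v = complex_of_real s \<cdot>\<^sub>m v"
      using selfadjoint_eigenvector[OF yc y(2) False] by metis
    let ?s = "complex_of_real s"
    have pyv: "p * (y * v) = y * v" using yc pc sv(2) by (simp add: mat_mult_cong_assoc[OF y(3)])
    then have pv: "p * v = v"
    proof -
      have "(1 / ?s) \<cdot>\<^sub>m (p * (y * v)) = (1 / ?s) \<cdot>\<^sub>m (y * v)" using pyv by simp
      then show ?thesis using sv pc by (simp add: mat_mult_smult)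
    qed
    have "y - ?s \<cdot>\<^sub>m p = 0\<^sub>m n n"
    proof (rule least)
      show "y - ?s \<cdot>\<^sub>m p \<in> S" by (intro star_subalgebra_minus[OF S] SD(5) y pS)
      show "(y - ?s \<cdot>\<^sub>m p)\<dagger> = y - ?s \<cdot>\<^sub>m p" using yc pc pa y(2) by (simp add: mat_distribs)
      show "y - ?s \<cdot>\<^sub>m p = h * ((1 / ?r) \<cdot>\<^sub>m (y - ?s \<cdot>\<^sub>m 1\<^sub>m n))"
      proof -
        define M where "M = y - ?s \<cdot>\<^sub>m 1\<^sub>m n"
        have Mc: "M \<in> carrier_mat n n" using yc by (simp add: M_def)
        have "p * M = y - ?s \<cdot>\<^sub>m p"
          using yc pc y(3) by (simp add: M_def mat_mult_minus mat_mult_smult)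
        moreover have "h * ((1 / ?r) \<cdot>\<^sub>m M) = p * M"
          unfolding hp using rw(1) pc Mc by (simp add: mat_mult_smult mat_smult_mult)
        ultimately show ?thesis by (simp add: M_def)
      qed
      show "v = h * ((1 / ?r) \<cdot>\<^sub>m v)"
        unfolding hp using rw(1) pc sv pv by (simp add: mat_mult_smult mat_smult_mult)
      show "(y - ?s \<cdot>\<^sub>m p) * v = 0\<^sub>m n 1"
        using sv yc pc pv by (simp add: mat_minus_mult mat_smult_mult)
    qed (use sv yc in auto)
    then show ?thesis using mat_diff_eq_0_iff[of y n n "?s \<cdot>\<^sub>m p"] yc pc by auto
  qed
  have "\<exists>c. p * (y * p) = c \<cdot>\<^sub>m p" if y: "y \<in> S" for y
  proof -
    define q where "q = p * (y * p)"
    have yc: "y \<in> carrier_mat n n" by (rule SD(1)[OF y])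
    have qS: "q \<in> S" unfolding q_def by (intro SD(4) pS y)
    then have qc: "q \<in> carrier_mat n n" by (rule SD(1))
    have pq: "p * q = q" "q * p = q"
      using yc pc by (simp_all add: q_def mat_assoc mat_mult_cong_assoc[OF pp] pp)
    have pqa: "p * q\<dagger> = q\<dagger>" "q\<dagger> * p = q\<dagger>"
      using arg_cong[OF pq(2), of mat_adjoint] arg_cong[OF pq(1), of mat_adjoint] pc qc
      by (simp_all add: mat_adjoint_mult pa)
    \<comment> \<open>The corner element \<open>q\<close> need not be self-adjoint;
      \<open>q + q\<dagger>\<close> and \<open>\<i> \<cdot>\<^sub>m (q - q\<dagger>)\<close> are,
      and \<open>q\<close> is recovered from them.\<close>
    have "\<exists>c. q + q\<dagger> = c \<cdot>\<^sub>m p"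
    proof (rule sa)
      show "q + q\<dagger> \<in> S" by (intro SD(3,6) qS)
      show "(q + q\<dagger>)\<dagger> = q + q\<dagger>" using qc by (simp add: mat_adjoint_add comm_add_mat[of _ n n])
    qed (use pc qc pq pqa in \<open>simp_all add: mat_mult_add mat_add_mult\<close>)
    then obtain c where c: "q + q\<dagger> = c \<cdot>\<^sub>m p" ..
    have "\<exists>c. \<i> \<cdot>\<^sub>m (q - q\<dagger>) = c \<cdot>\<^sub>m p"
    proof (rule sa)
      show "\<i> \<cdot>\<^sub>m (q - q\<dagger>) \<in> S" by (intro star_subalgebra_minus[OF S] SD(5,6) qS)
      show "(\<i> \<cdot>\<^sub>m (q - q\<dagger>))\<dagger> = \<i> \<cdot>\<^sub>m (q - q\<dagger>)"
        using qc by (intro eq_matI) (auto simp: algebra_simps)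
    qed (use pc qc pq pqa in \<open>simp_all add: mat_mult_minus mat_minus_mult mat_mult_smult mat_smult_mult\<close>)
    then obtain d where d: "\<i> \<cdot>\<^sub>m (q - q\<dagger>) = d \<cdot>\<^sub>m p" ..
    have "q = ((c - \<i> * d) / 2) \<cdot>\<^sub>m p"
    proof (rule eq_matI)
      fix i j assume "i < dim_row (((c - \<i> * d) / 2) \<cdot>\<^sub>m p)" "j < dim_col (((c - \<i> * d) / 2) \<cdot>\<^sub>m p)"
      then have ij: "i < n" "j < n" using pc by auto
      have 1: "q $$ (i, j) + q\<dagger> $$ (i, j) = c * p $$ (i, j)"
        using arg_cong[OF c, of "\<lambda>M. M $$ (i, j)"] ij qc pc by simp
      have 2: "\<i> * (q $$ (i, j) - q\<dagger> $$ (i, j)) = d * p $$ (i, j)"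
        using arg_cong[OF d, of "\<lambda>M. M $$ (i, j)"] ij qc pc by simp
      have "2 * q $$ (i, j) = (q $$ (i, j) + q\<dagger> $$ (i, j)) - \<i> * (\<i> * (q $$ (i, j) - q\<dagger> $$ (i, j)))"
        by (simp add: algebra_simps)
      then have "2 * q $$ (i, j) = (c - \<i> * d) * p $$ (i, j)"
        unfolding 1 2 by (simp add: algebra_simps)
      then have "q $$ (i, j) = (c - \<i> * d) * p $$ (i, j) / 2"
        by (metis nonzero_mult_div_cancel_left zero_neq_numeral)
      then show "q $$ (i, j) = (((c - \<i> * d) / 2) \<cdot>\<^sub>m p) $$ (i, j)" using ij pc by simp
    qed (use qc pc in auto)
    then show ?thesis unfolding q_def by blast
  qed
  then show ?thesis using that pS pa pp p0 by blast
qed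

text \<open>For a minimal projection \<open>p\<close> with a unit vector \<open>\<omega>\<close> in its range, the columns of \<open>U\<close> are
  \<open>u s * \<omega>\<close>, where the \<open>u s\<close> form a maximal family in \<open>S * p\<close> with \<open>(u s)\<dagger> * u t = \<delta>\<^sub>s\<^sub>t p\<close>; the central
  projection is \<open>e = (\<Sum>s. u s * (u s)\<dagger>)\<close>.\<close>

lemma simple_summand_exists:
  assumes S: "star_subalgebra n S" and nz: "S \<noteq> {0\<^sub>m n n}"
  obtains e d U where "e \<in> S" "e\<dagger> = e" "e * e = e" "e \<noteq> 0\<^sub>m n n" "\<And>x. x \<in> S \<Longrightarrow> e * x = x * e"
    "0 < d" "U \<in> carrier_mat n d" "U\<dagger> * U = 1\<^sub>m d" "e * U = U"
    "\<And>x. x \<in> S \<Longrightarrow> x * U = U * (U\<dagger> * (x * U))"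
    "\<And>x. x \<in> S \<Longrightarrow> x * U = 0\<^sub>m n d \<Longrightarrow> x * e = 0\<^sub>m n n"
    "\<And>Y. Y \<in> carrier_mat d d \<Longrightarrow> \<exists>x\<in>S. U\<dagger> * (x * U) = Y"
proof -
  note SD = star_subalgebraD[OF S]
  obtain p where p: "p \<in> S" "p\<dagger> = p" "p * p = p" "p \<noteq> 0\<^sub>m n n"
    and minp: "\<And>y. y \<in> S \<Longrightarrow> \<exists>c. p * (y * p) = c \<cdot>\<^sub>m p"
    using minimal_projection_exists[OF S nz] by metis
  have pc: "p \<in> carrier_mat n n" by (rule SD(1)[OF p(1)])
  obtain b where b: "b \<in> carrier_mat n 1" "p * b \<noteq> 0\<^sub>m n 1"
    using nonzero_mult_column[OF pc p(4)] by metis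
  have pb: "p * b \<in> carrier_mat n 1" using pc b by simp
  obtain c where c: "(c \<cdot>\<^sub>m (p * b))\<dagger> * (c \<cdot>\<^sub>m (p * b)) = 1\<^sub>m 1"
    using normalize_column[OF pb b(2)] by blast
  define \<omega> where "\<omega> = c \<cdot>\<^sub>m (p * b)"
  have \<omega>: "\<omega> \<in> carrier_mat n 1" "\<omega>\<dagger> * \<omega> = 1\<^sub>m 1" using pb c by (simp_all add: \<omega>_def)
  have p\<omega>: "p * \<omega> = \<omega>" using pc b by (simp add: \<omega>_def mat_mult_smult mat_mult_cong_assoc[OF p(3)])
  \<comment> \<open>The unit vector \<open>\<omega>\<close> with
    \<open>p * \<omega> = \<omega>\<close> reads off the scalar in
    \<open>y\<dagger> * y = c \<cdot>\<^sub>m p\<close> as a squared norm. This later shows that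
    \<open>c\<close> is positive for nonzero \<open>y\<close>, and that \<open>c = 0\<close> when
    \<open>y\<close> kills \<open>\<omega>\<close>.\<close>
  have vec_state: "(y * \<omega>)\<dagger> * (y * \<omega>) = c \<cdot>\<^sub>m 1\<^sub>m 1"
    if "y \<in> carrier_mat n n" "y\<dagger> * y = c \<cdot>\<^sub>m p" for y c
  proof -
    have "(y * \<omega>)\<dagger> * (y * \<omega>) = \<omega>\<dagger> * ((y\<dagger> * y) * \<omega>)"
      using that(1) \<omega>(1) by (simp add: mat_adjoint_mult mat_assoc)
    then show ?thesis using \<omega> pc p\<omega> by (simp add: that(2) mat_smult_mult mat_mult_smult)
  qed
  \<comment> \<open>For \<open>y\<close> and \<open>z\<close> in the left ideal
    \<open>S * p\<close>, the product \<open>y\<dagger> * z\<close> lies in the corner of the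
    minimal projection and is thus a scalar: an inner product on this ideal.\<close>
  have corner: "\<exists>c. y\<dagger> * z = c \<cdot>\<^sub>m p" if yz: "y \<in> S" "z \<in> S" "y * p = y" "z * p = z" for y z
  proof -
    have cs: "y \<in> carrier_mat n n" "z \<in> carrier_mat n n" using SD(1) yz by blast+
    have "p * y\<dagger> = y\<dagger>" using arg_cong[OF yz(3), of mat_adjoint] cs pc by (simp add: mat_adjoint_mult p(2))
    then have "p * ((y\<dagger> * z) * p) = y\<dagger> * z"
      using cs pc yz(4) by (simp add: mat_assoc mat_mult_cong_assoc[of p "y\<dagger>"])
    moreover have "y\<dagger> * z \<in> S" by (intro SD(4,6) yz)
    ultimately show ?thesis using minp by metis
  qed
  \<comment> \<open>\<open>Q d\<close> says that the ideal contains \<open>d\<close> orthonormal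
    elements for this inner product; \<open>p\<close> alone shows \<open>Q 1\<close>.\<close>
  define Q where "Q d \<longleftrightarrow> (\<exists>u. (\<forall>s<d. u s \<in> S \<and> u s * p = u s) \<and>
    (\<forall>s<d. \<forall>t<d. (u s)\<dagger> * u t = (if s = t then p else 0\<^sub>m n n)))" for d :: nat
  have Q1: "Q 1" unfolding Q_def by (intro exI[of _ "\<lambda>_. p"]) (use p in simp)
  have bound: "d \<le> n" if Qd: "Q d" for d
  proof -
    obtain u where u: "\<And>s. s < d \<Longrightarrow> u s \<in> S"
      and uu: "\<And>s t. s < d \<Longrightarrow> t < d \<Longrightarrow> (u s)\<dagger> * u t = (if s = t then p else 0\<^sub>m n n)"
      using Qd unfolding Q_def by blast
    have "card {..<d} \<le> n"
    proof (rule orthogonal_family_card_le[of _ u])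
      fix s assume "s \<in> {..<d}"
      then have s: "s < d" by simp
      show "u s \<in> carrier_mat n n" using SD(1)[OF u[OF s]] .
      show "u s \<noteq> 0\<^sub>m n n"
      proof
        assume "u s = 0\<^sub>m n n"
        then have "(u s)\<dagger> * u s = 0\<^sub>m n n" by simp
        then show False using uu[OF s s] p(4) by simp
      qed
    qed (use uu in auto)
    then show ?thesis by simp
  qed
  define d where "d = Greatest Q"
  have "Q d" unfolding d_def by (rule GreatestI_nat[of Q, OF Q1]) (use bound in blast)
  have mx: "l \<le> d" if "Q l" for l
    unfolding d_def by (rule Greatest_le_nat[of Q, OF that]) (use bound in blast)
  have d0: "0 < d" using mx[OF Q1] by simp
  obtain u where uS: "\<And>s. s < d \<Longrightarrow> u s \<in> S" and up: "\<And>s. s < d \<Longrightarrow> u s * p = u s"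
    and uu: "\<And>s t. s < d \<Longrightarrow> t < d \<Longrightarrow> (u s)\<dagger> * u t = (if s = t then p else 0\<^sub>m n n)"
    using \<open>Q d\<close> unfolding Q_def by blast
  have uc: "u s \<in> carrier_mat n n" if "s < d" for s using SD(1)[OF uS[OF that]] .
  note ud [simp] = carrier_matD[OF uc]
  have pu: "p * (u s)\<dagger> = (u s)\<dagger>" if "s < d" for s
    using arg_cong[OF up[OF that], of mat_adjoint] uc[OF that] pc by (simp add: mat_adjoint_mult p(2))
  define e where "e = msum n n {..<d} (\<lambda>s. u s * (u s)\<dagger>)"
  have uuc: "u s * (u s)\<dagger> \<in> carrier_mat n n" if "s < d" for s using uc[OF that] by simp
  have eS: "e \<in> S" unfolding e_def by (rule star_subalgebra_msum[OF S]) (auto intro: SD(4,6) uS)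
  have ec: "e \<in> carrier_mat n n" by (rule SD(1)[OF eS])
  have ea: "e\<dagger> = e"
    unfolding e_def by (subst mat_adjoint_msum) (use uc in \<open>auto simp: mat_adjoint_mult intro: msum_cong\<close>)
  have e_mult: "e * y = msum n k {..<d} (\<lambda>s. u s * ((u s)\<dagger> * y))" if y: "y \<in> carrier_mat n k" for y k
    unfolding e_def using y uuc
    by (subst msum_mult[of _ n k]) (auto intro!: msum_cong simp: mat_assoc)
  have mult_e: "y * e = msum n n {..<d} (\<lambda>s. (y * u s) * (u s)\<dagger>)" if y: "y \<in> carrier_mat n n" for y
    unfolding e_def using y uuc
    by (subst mult_msum[of _ n n]) (auto intro!: msum_cong simp: mat_assoc)
  have eu: "e * u t = u t" if t: "t < d" for t
  proof -
    have "e * u t = msum n n {..<d} (\<lambda>s. if s = t then u s else 0\<^sub>m n n)"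
      unfolding e_mult[OF uc[OF t]] using t uc up by (intro msum_cong) (auto simp: uu)
    also have "\<dots> = u t" using t uc[OF t] by (intro msum_delta) auto
    finally show ?thesis .
  qed
  have ue: "(u t)\<dagger> * e = (u t)\<dagger>" if t: "t < d" for t
    using arg_cong[OF eu[OF t], of mat_adjoint] ec uc[OF t] by (simp add: mat_adjoint_mult ea)
  have ee: "e * e = e"
  proof -
    have "msum n n {..<d} (\<lambda>s. e * u s * (u s)\<dagger>) = e"
    proof -
      have "msum n n {..<d} (\<lambda>s. e * u s * (u s)\<dagger>) = msum n n {..<d} (\<lambda>s. u s * (u s)\<dagger>)"
        by (intro msum_cong) (simp add: eu)
      then show ?thesis unfolding e_def[symmetric] .
    qed
    then show ?thesis using mult_e[OF ec] by simp
  qed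
  have e0: "e \<noteq> 0\<^sub>m n n"
  proof
    assume "e = 0\<^sub>m n n"
    then have "u 0 = 0\<^sub>m n n" using eu[OF d0] uc[OF d0] by simp
    then show False using uu[OF d0 d0] p(4) by simp
  qed
  \<comment> \<open>Otherwise the part \<open>y\<close> of \<open>x * u t\<close> orthogonal to all
    \<open>u s\<close> is a nonzero element of the ideal, and after normalisation it would extend a
    family of greatest size.\<close>
  have key: "e * (x * u t) = x * u t" if x: "x \<in> S" and t: "t < d" for x t
  proof (rule ccontr)
    assume ne: "e * (x * u t) \<noteq> x * u t"
    have xc: "x \<in> carrier_mat n n" by (rule SD(1)[OF x])
    have xuc: "x * u t \<in> carrier_mat n n" using xc uc[OF t] by simp
    define y where "y = x * u t - e * (x * u t)"
    have yS: "y \<in> S" unfolding y_def by (intro star_subalgebra_minus[OF S] SD(4) x uS t eS)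
    have yc: "y \<in> carrier_mat n n" by (rule SD(1)[OF yS])
    have yp: "y * p = y"
      unfolding y_def using xc uc[OF t] ec pc by (simp add: mat_minus_mult mat_assoc up[OF t])
    have uy: "(u s)\<dagger> * y = 0\<^sub>m n n" if s: "s < d" for s
      unfolding y_def using xc uc[OF t] ec uc[OF s]
      by (simp add: mat_mult_minus mat_mult_cong_assoc[OF ue[OF s]])
    have yu: "y\<dagger> * u s = 0\<^sub>m n n" if s: "s < d" for s
      using arg_cong[OF uy[OF s], of mat_adjoint] yc uc[OF s] by (simp add: mat_adjoint_mult)
    have "y \<noteq> 0\<^sub>m n n"
      using ne mat_diff_eq_0_iff[OF xuc, of "e * (x * u t)"] ec xc uc[OF t] by (auto simp: y_def)
    then have yy: "y\<dagger> * y \<noteq> 0\<^sub>m n n" using mat_adjoint_mult_self_eq_0[OF yc] by blast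
    obtain c where c: "y\<dagger> * y = c \<cdot>\<^sub>m p" using corner[OF yS yS yp yp] by blast
    define r where "r = (\<Sum>i<n. (cmod ((y * \<omega>) $$ (i, 0)))\<^sup>2)"
    have "((y * \<omega>)\<dagger> * (y * \<omega>)) $$ (0, 0) = of_real r"
      unfolding r_def using mat_adjoint_mult_self_index[of 0 "y * \<omega>"] yc \<omega>(1) by simp
    then have cr: "c = of_real r" unfolding vec_state[OF yc c] by simp
    moreover have "c \<noteq> 0" using yy pc unfolding c by auto
    moreover have "r \<ge> 0" unfolding r_def by (intro sum_nonneg) auto
    ultimately have r: "r > 0" by simp
    have "1 / sqrt r * (1 / sqrt r * r) = 1" using r by (simp add: real_div_sqrt)
    then have rr: "complex_of_real (1 / sqrt r) * (complex_of_real (1 / sqrt r) * of_real r) = 1"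
      by (metis of_real_1 of_real_mult)
    define z where "z = complex_of_real (1 / sqrt r) \<cdot>\<^sub>m y"
    have zz: "z\<dagger> * z = p"
    proof -
      have "z\<dagger> * z =
        (complex_of_real (1 / sqrt r) * complex_of_real (1 / sqrt r)) \<cdot>\<^sub>m (y\<dagger> * y)"
        unfolding z_def using yc
        by (simp add: mat_adjoint_smult mat_smult_mult mat_mult_smult del: of_real_divide)
      also have "\<dots> = 1 \<cdot>\<^sub>m p" unfolding c cr mat_smult_smult mult.assoc rr ..
      finally show ?thesis using pc by auto
    qed
    have "Q (Suc d)"
      unfolding Q_def
    proof (intro exI[of _ "u(d := z)"] conjI allI impI)
      fix s assume "s < Suc d"
      show "(u(d := z)) s \<in> S" using \<open>s < Suc d\<close> uS SD(5)[OF yS] by (auto simp: z_def less_Suc_eq)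
      show "(u(d := z)) s * p = (u(d := z)) s"
        using \<open>s < Suc d\<close> up yp yc pc by (auto simp: z_def less_Suc_eq mat_smult_mult)
      fix t assume "t < Suc d"
      have "z\<dagger> * u s = 0\<^sub>m n n" "(u s)\<dagger> * z = 0\<^sub>m n n" if "s < d" for s
        using yu[OF that] uy[OF that] yc uc[OF that]
        by (simp_all add: z_def mat_adjoint_smult mat_smult_mult mat_mult_smult del: of_real_divide)
      then show "((u(d := z)) s)\<dagger> * (u(d := z)) t = (if s = t then p else 0\<^sub>m n n)"
        using \<open>s < Suc d\<close> \<open>t < Suc d\<close> uu zz by (auto simp: less_Suc_eq)
    qed
    then show False using mx[of "Suc d"] by simp
  qed
  have exe: "e * (x * e) = x * e" if x: "x \<in> S" for x
  proof -
    have xc: "x \<in> carrier_mat n n" by (rule SD(1)[OF x])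
    have "e * (x * e) = e * x * e" using ec xc by (simp add: mat_assoc)
    also have "\<dots> = msum n n {..<d} (\<lambda>s. (e * x * u s) * (u s)\<dagger>)" using ec xc by (intro mult_e) simp
    also have "\<dots> = x * e"
      unfolding mult_e[OF xc] by (intro msum_cong) (use ec xc uc key x in \<open>simp add: mat_assoc\<close>)
    finally show ?thesis .
  qed
  \<comment> \<open>\<open>exe\<close> says that the range of \<open>e\<close> is invariant under
    \<open>S\<close>; as \<open>S\<close> is closed under adjoints, the orthogonal complement is
    invariant as well, so \<open>e\<close> commutes with \<open>S\<close>.\<close>
  have central: "e * x = x * e" if x: "x \<in> S" for x
  proof -
    have xc: "x \<in> carrier_mat n n" by (rule SD(1)[OF x])
    have "(e * (x\<dagger> * e))\<dagger> = (x\<dagger> * e)\<dagger>" using exe[OF SD(6)[OF x]] by simp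
    then have "e * (x * e) = e * x" using ec xc by (simp add: mat_adjoint_mult ea mat_assoc)
    then show ?thesis using exe[OF x] by simp
  qed
  define U where "U = mat_of_columns n d (\<lambda>s. u s * \<omega>)"
  have Uc: "U \<in> carrier_mat n d" by (simp add: U_def)
  have u\<omega>c: "u s * \<omega> \<in> carrier_mat n 1" if "s < d" for s using uc[OF that] \<omega>(1) by simp
  have UU: "U\<dagger> * U = 1\<^sub>m d"
    unfolding U_def
  proof (rule mat_of_columns_isometry)
    fix s t assume st: "s < d" "t < d"
    have "(u s * \<omega>)\<dagger> * (u t * \<omega>) = \<omega>\<dagger> * (((u s)\<dagger> * u t) * \<omega>)"
      using uc[OF st(1)] uc[OF st(2)] \<omega>(1) by (simp add: mat_adjoint_mult mat_assoc)
    then show "(u s * \<omega>)\<dagger> * (u t * \<omega>) = (if s = t then 1\<^sub>m 1 else 0\<^sub>m 1 1)"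
      using \<omega> p\<omega> by (simp add: uu[OF st])
  qed (use u\<omega>c in auto)
  have MU: "M * U = mat_of_columns n d (\<lambda>s. (M * u s) * \<omega>)" if M: "M \<in> carrier_mat n n" for M
    unfolding U_def using M u\<omega>c \<omega>(1)
    by (subst mult_mat_of_columns[of _ n n]) (auto intro!: mat_of_columns_cong simp: mat_assoc)
  have eU: "e * U = U"
  proof -
    have "mat_of_columns n d (\<lambda>s. (e * u s) * \<omega>) = U"
      unfolding U_def by (intro mat_of_columns_cong) (simp add: eu)
    then show ?thesis using MU[OF ec] by simp
  qed
  have UY: "U * Y = mat_of_columns n d (\<lambda>t. msum n 1 {..<d} (\<lambda>s. Y $$ (s, t) \<cdot>\<^sub>m (u s * \<omega>)))"
    if Y: "Y \<in> carrier_mat d d" for Y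
  proof (rule eq_matI)
    let ?R = "mat_of_columns n d (\<lambda>t. msum n 1 {..<d} (\<lambda>s. Y $$ (s, t) \<cdot>\<^sub>m (u s * \<omega>)))"
    fix i t assume "i < dim_row ?R" "t < dim_col ?R"
    then have it: "i < n" "t < d" by auto
    have "(U * Y) $$ (i, t) = (\<Sum>s<d. (u s * \<omega>) $$ (i, 0) * Y $$ (s, t))"
      using it Uc Y by (subst mat_mult_index) (auto simp: U_def)
    also have "\<dots> = ?R $$ (i, t)"
      using it carrier_matD[OF u\<omega>c] by (auto intro!: sum.cong simp: mult.commute simp del: index_mult_mat(1))
    finally show "(U * Y) $$ (i, t) = ?R $$ (i, t)" .
  qed (use Uc Y in auto)
  \<comment> \<open>Inserting \<open>e\<close> expands \<open>x * u t\<close> in the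
    \<open>u s\<close>, with coefficients the scalars \<open>c s t\<close> of
    \<open>(u s)\<dagger> * (x * u t)\<close>; these are the matrix of \<open>x\<close> in the basis
    \<open>u s * \<omega>\<close>.\<close>
  have inv: "x * U = U * (U\<dagger> * (x * U))" if x: "x \<in> S" for x
  proof -
    have xc: "x \<in> carrier_mat n n" by (rule SD(1)[OF x])
    have "\<exists>c. (u s)\<dagger> * (x * u t) = c \<cdot>\<^sub>m p" if "s < d" "t < d" for s t
    proof (rule corner)
      show "x * u t * p = x * u t" using xc uc[OF that(2)] pc by (simp add: mat_assoc up[OF that(2)])
    qed (use that uS up x SD(4) in auto)
    then obtain c where c: "\<And>s t. s < d \<Longrightarrow> t < d \<Longrightarrow> (u s)\<dagger> * (x * u t) = c s t \<cdot>\<^sub>m p" by metis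
    define Y where "Y = mat d d (\<lambda>(s, t). c s t)"
    have Yc: "Y \<in> carrier_mat d d" by (simp add: Y_def)
    have "x * U = U * Y"
      unfolding MU[OF xc] UY[OF Yc]
    proof (rule mat_of_columns_cong)
      fix t assume t: "t < d"
      have xut: "x * u t \<in> carrier_mat n n" using xc uc[OF t] by simp
      have "x * u t = msum n n {..<d} (\<lambda>s. u s * ((u s)\<dagger> * (x * u t)))"
        using key[OF x t] e_mult[OF xut] by simp
      also have "\<dots> = msum n n {..<d} (\<lambda>s. c s t \<cdot>\<^sub>m u s)"
        by (intro msum_cong) (use t uc pc up c in \<open>simp add: mat_mult_smult\<close>)
      finally have "x * u t * \<omega> = msum n n {..<d} (\<lambda>s. c s t \<cdot>\<^sub>m u s) * \<omega>" by simp
      also have "\<dots> = msum n 1 {..<d} (\<lambda>s. c s t \<cdot>\<^sub>m u s * \<omega>)"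
        by (rule msum_mult) (use \<omega> uc in auto)
      also have "\<dots> = msum n 1 {..<d} (\<lambda>s. Y $$ (s, t) \<cdot>\<^sub>m (u s * \<omega>))"
        by (intro msum_cong) (use t uc \<omega>(1) in \<open>simp add: Y_def mat_smult_mult\<close>)
      finally show "x * u t * \<omega> = msum n 1 {..<d} (\<lambda>s. Y $$ (s, t) \<cdot>\<^sub>m (u s * \<omega>))" .
    qed
    then show ?thesis using Uc Yc by (simp add: mat_mult_cong_assoc[OF UU])
  qed
  \<comment> \<open>\<open>x * u s\<close> is an element of the ideal that kills
    \<open>\<omega>\<close>, so its inner product with itself is 0 and it vanishes; by the formula
    for \<open>e\<close>, so does \<open>x * e\<close>.\<close>
  have inj: "x * e = 0\<^sub>m n n" if x: "x \<in> S" and 0: "x * U = 0\<^sub>m n d" for x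
  proof -
    have xc: "x \<in> carrier_mat n n" by (rule SD(1)[OF x])
    have "x * u s = 0\<^sub>m n n" if s: "s < d" for s
    proof -
      have yS: "x * u s \<in> S" by (intro SD(4) x uS s)
      have yc: "x * u s \<in> carrier_mat n n" by (rule SD(1)[OF yS])
      have yp: "x * u s * p = x * u s" using xc uc[OF s] pc by (simp add: mat_assoc up[OF s])
      obtain c where c: "(x * u s)\<dagger> * (x * u s) = c \<cdot>\<^sub>m p" using corner[OF yS yS yp yp] by blast
      have "x * u s * \<omega> = 0\<^sub>m n 1"
      proof (rule eq_matI)
        fix i j assume "i < dim_row (0\<^sub>m n 1 :: complex mat)" "j < dim_col (0\<^sub>m n 1 :: complex mat)"
        then have ij: "i < n" "j = 0" by auto
        have "mat_of_columns n d (\<lambda>s. x * u s * \<omega>) $$ (i, s) = 0\<^sub>m n d $$ (i, s)"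
          using MU[OF xc] 0 by simp
        then show "(x * u s * \<omega>) $$ (i, j) = 0\<^sub>m n 1 $$ (i, j)"
          using ij s by (simp del: index_mult_mat(1))
      qed (use yc \<omega>(1) in auto)
      then have "(x * u s * \<omega>)\<dagger> * (x * u s * \<omega>) = 0\<^sub>m 1 1" by simp
      then have "c \<cdot>\<^sub>m 1\<^sub>m 1 = (0\<^sub>m 1 1 :: complex mat)" unfolding vec_state[OF yc c] .
      from arg_cong[OF this, of "\<lambda>M. M $$ (0, 0)"] have "c = 0" by simp
      then have "(x * u s)\<dagger> * (x * u s) = 0\<^sub>m n n" using c pc by auto
      then show ?thesis using mat_adjoint_mult_self_eq_0[OF yc] by simp
    qed
    then have "x * e = msum n n {..<d} (\<lambda>s. 0\<^sub>m n n)"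
      unfolding mult_e[OF xc] by (intro msum_cong) (use uc in simp)
    also have "\<dots> = 0\<^sub>m n n" by (rule eq_matI) auto
    finally show ?thesis .
  qed
  have surj: "\<exists>x\<in>S. U\<dagger> * (x * U) = Y" if Yc: "Y \<in> carrier_mat d d" for Y
  proof -
    \<comment> \<open>The elements \<open>u s * (u t)\<dagger>\<close> act on the columns of
      \<open>U\<close> as matrix units.\<close>
    define x where "x = msum n n ({..<d} \<times> {..<d}) (\<lambda>(s, t). Y $$ (s, t) \<cdot>\<^sub>m (u s * (u t)\<dagger>))"
    have xS: "x \<in> S"
      unfolding x_def by (rule star_subalgebra_msum[OF S]) (auto intro!: SD(4,5,6) uS)
    have xc: "x \<in> carrier_mat n n" by (rule SD(1)[OF xS])
    have "x * U = U * Y"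
      unfolding MU[OF xc] UY[OF Yc]
    proof (rule mat_of_columns_cong)
      fix t assume t: "t < d"
      have "x * (u t * \<omega>) = msum n 1 ({..<d} \<times> {..<d})
          (\<lambda>(s, r). (Y $$ (s, r) \<cdot>\<^sub>m (u s * (u r)\<dagger>)) * (u t * \<omega>))"
        unfolding x_def
        by (subst msum_mult[of _ n 1]) (use uc \<omega>(1) t in \<open>auto intro!: msum_cong\<close>)
      also have "\<dots> = msum n 1 ({..<d} \<times> {..<d})
          (\<lambda>(s, r). if r = t then Y $$ (s, t) \<cdot>\<^sub>m (u s * \<omega>) else 0\<^sub>m n 1)"
      proof (rule msum_cong, clarify)
        fix s r assume sr: "s < d" "r < d"
        have "(Y $$ (s, r) \<cdot>\<^sub>m (u s * (u r)\<dagger>)) * (u t * \<omega>) =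
            Y $$ (s, r) \<cdot>\<^sub>m (u s * (((u r)\<dagger> * u t) * \<omega>))"
          using uc[OF sr(1)] uc[OF sr(2)] uc[OF t] \<omega>(1) by (simp add: mat_smult_mult mat_assoc)
        then show "(Y $$ (s, r) \<cdot>\<^sub>m (u s * (u r)\<dagger>)) * (u t * \<omega>) =
            (if r = t then Y $$ (s, t) \<cdot>\<^sub>m (u s * \<omega>) else 0\<^sub>m n 1)"
          using uc[OF sr(1)] \<omega>(1) p\<omega> by (simp add: uu[OF sr(2) t])
      qed
      also have "\<dots> = msum n 1 {..<d} (\<lambda>s. Y $$ (s, t) \<cdot>\<^sub>m (u s * \<omega>))"
      proof (rule eq_matI, goal_cases)
        case (1 i j)
        then have ij: "i < n" "j < 1" by auto
        have "(\<Sum>(s, r)\<in>{..<d} \<times> {..<d}. (if r = t then Y $$ (s, t) \<cdot>\<^sub>m (u s * \<omega>) else 0\<^sub>m n 1) $$ (i, j)) =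
            (\<Sum>s<d. \<Sum>r<d. if r = t then (Y $$ (s, t) \<cdot>\<^sub>m (u s * \<omega>)) $$ (i, j) else 0)"
          unfolding sum.cartesian_product[symmetric] using ij
          by (intro sum.cong refl) (simp del: index_mult_mat(1) index_smult_mat(1))
        also have "\<dots> = (\<Sum>s<d. (Y $$ (s, t) \<cdot>\<^sub>m (u s * \<omega>)) $$ (i, j))" using t by simp
        finally show ?case using ij by (simp add: case_prod_unfold del: index_mult_mat(1) index_smult_mat(1))
      qed auto
      finally show "x * u t * \<omega> = msum n 1 {..<d} (\<lambda>s. Y $$ (s, t) \<cdot>\<^sub>m (u s * \<omega>))"
        using xc uc[OF t] \<omega>(1) by (simp add: mat_assoc)
    qed
    then have "U\<dagger> * (x * U) = Y" using Uc Yc by (simp add: mat_mult_cong_assoc[OF UU])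
    then show ?thesis using xS by blast
  qed
  show ?thesis
    by (rule that[OF eS ea ee e0 central d0 Uc UU eU inv inj surj])
qed

section \<open>Splitting a subalgebra into blocks\<close>

text \<open>The clauses make the compressions \<open>(U c)\<dagger> * (x * U c)\<close>, taken over
  all \<open>c\<close>, an isomorphism of \<open>S\<close> onto a direct sum of matrix algebras:
  invariance of the range of \<open>U c\<close> gives multiplicativity, and the last two clauses
  give injectivity and surjectivity. Surjectivity has to be joint, or equivalent blocks could be
  listed twice.\<close>

definition block_decomposition ::
    "nat \<Rightarrow> complex mat set \<Rightarrow> nat \<Rightarrow> (nat \<Rightarrow> nat) \<Rightarrow> (nat \<Rightarrow> complex mat) \<Rightarrow> bool" where
  "block_decomposition n S K d U \<longleftrightarrow>
     (\<forall>c<K. 0 < d c \<and> U c \<in> carrier_mat n (d c) \<and> (U c)\<dagger> * U c = 1\<^sub>m (d c) \<and>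
        (\<forall>x\<in>S. x * U c = U c * ((U c)\<dagger> * (x * U c)))) \<and>
     (\<forall>x\<in>S. (\<forall>c<K. x * U c = 0\<^sub>m n (d c)) \<longrightarrow> x = 0\<^sub>m n n) \<and>
     (\<forall>Y. (\<forall>c<K. Y c \<in> carrier_mat (d c) (d c)) \<longrightarrow>
        (\<exists>x\<in>S. \<forall>c<K. (U c)\<dagger> * (x * U c) = Y c))"

text \<open>\<open>S\<close> is the direct sum of the ideal \<open>S * e\<close> and of the elements
  with \<open>x * e = 0\<close>. The new block sees only the first part and the old blocks only the
  second, so prescribed compressions are realised by adding one element from each.\<close>

lemma block_decomposition_step:
  assumes S: "star_subalgebra n S"
    and e: "e \<in> S" "e * e = e" "\<And>x. x \<in> S \<Longrightarrow> e * x = x * e"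
    and d': "0 < d'" and U': "U' \<in> carrier_mat n d'" "U'\<dagger> * U' = 1\<^sub>m d'" "e * U' = U'"
    and inv': "\<And>x. x \<in> S \<Longrightarrow> x * U' = U' * (U'\<dagger> * (x * U'))"
    and inj': "\<And>x. x \<in> S \<Longrightarrow> x * U' = 0\<^sub>m n d' \<Longrightarrow> x * e = 0\<^sub>m n n"
    and surj': "\<And>Y. Y \<in> carrier_mat d' d' \<Longrightarrow> \<exists>x\<in>S. U'\<dagger> * (x * U') = Y"
    and rest: "block_decomposition n {x \<in> S. x * e = 0\<^sub>m n n} K d U"
  shows "block_decomposition n S (Suc K) (d(K := d')) (U(K := U'))"
proof -
  note SD = star_subalgebraD[OF S]
  let ?S = "{x \<in> S. x * e = 0\<^sub>m n n}"
  have ec: "e \<in> carrier_mat n n" by (rule SD(1)[OF e(1)])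
  have dU: "0 < d c" "U c \<in> carrier_mat n (d c)" "(U c)\<dagger> * U c = 1\<^sub>m (d c)" if "c < K" for c
    using rest that unfolding block_decomposition_def by auto
  have inv: "x * U c = U c * ((U c)\<dagger> * (x * U c))" if "c < K" "x \<in> ?S" for c x
    using rest that unfolding block_decomposition_def by blast
  have inj: "x = 0\<^sub>m n n" if "x \<in> ?S" "\<And>c. c < K \<Longrightarrow> x * U c = 0\<^sub>m n (d c)" for x
    using rest that unfolding block_decomposition_def by blast
  have surj: "\<exists>x\<in>?S. \<forall>c<K. (U c)\<dagger> * (x * U c) = Y c"
    if "\<And>c. c < K \<Longrightarrow> Y c \<in> carrier_mat (d c) (d c)" for Y :: "nat \<Rightarrow> complex mat"
    using rest that unfolding block_decomposition_def by blast
  \<comment> \<open>An element of the complement acting as the identity on the old blocks: since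
    \<open>e * y = 0\<close>, the old blocks are annihilated by \<open>e\<close>.\<close>
  obtain y where y: "y \<in> ?S" "\<And>c. c < K \<Longrightarrow> (U c)\<dagger> * (y * U c) = 1\<^sub>m (d c)"
    using surj[of "\<lambda>c. 1\<^sub>m (d c)"] by auto
  have yc: "y \<in> carrier_mat n n" using SD(1) y(1) by simp
  have eU: "e * U c = 0\<^sub>m n (d c)" if c: "c < K" for c
  proof -
    have "y * U c = U c" using inv[OF c y(1)] y(2)[OF c] dU(2)[OF c] by simp
    then have "e * U c = e * y * U c" using ec yc dU(2)[OF c] by (simp add: mat_assoc)
    also have "\<dots> = 0\<^sub>m n n * U c" using e(3)[of y] y(1) by simp
    finally show ?thesis using dU(2)[OF c] by simp
  qed
  have proj: "x - x * e \<in> ?S" if x: "x \<in> S" for x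
  proof -
    have xc: "x \<in> carrier_mat n n" by (rule SD(1)[OF x])
    have "x - x * e \<in> S" by (intro star_subalgebra_minus[OF S] SD(4) x e(1))
    moreover have "(x - x * e) * e = 0\<^sub>m n n" using xc ec by (simp add: mat_minus_mult mat_assoc e(2))
    ultimately show ?thesis by simp
  qed
  have projU: "(x - x * e) * U c = x * U c" if x: "x \<in> S" and c: "c < K" for x c
  proof -
    have xc: "x \<in> carrier_mat n n" by (rule SD(1)[OF x])
    have "(x - x * e) * U c = x * U c - 0\<^sub>m n (d c)"
      using xc ec dU(2)[OF c] by (simp add: mat_minus_mult mat_assoc eU[OF c])
    also have "\<dots> = x * U c" using xc dU(2)[OF c] by (intro eq_matI) auto
    finally show ?thesis .
  qed
  show ?thesis
    unfolding block_decomposition_def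
  proof (intro conjI allI impI ballI)
    fix c assume "c < Suc K"
    then show "0 < (d(K := d')) c" "(U(K := U')) c \<in> carrier_mat n ((d(K := d')) c)"
      "((U(K := U')) c)\<dagger> * (U(K := U')) c = 1\<^sub>m ((d(K := d')) c)"
      using dU d' U' by (auto simp: less_Suc_eq)
    fix x assume x: "x \<in> S"
    show "x * (U(K := U')) c = (U(K := U')) c * (((U(K := U')) c)\<dagger> * (x * (U(K := U')) c))"
    proof (cases "c = K")
      case False
      then have c: "c < K" using \<open>c < Suc K\<close> by simp
      show ?thesis using inv[OF c proj[OF x]] False by (simp add: projU[OF x c])
    qed (use inv'[OF x] in simp)
  next
    fix x assume x: "x \<in> S" and 0: "\<forall>c<Suc K. x * (U(K := U')) c = 0\<^sub>m n ((d(K := d')) c)"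
    have xc: "x \<in> carrier_mat n n" by (rule SD(1)[OF x])
    have "x - x * e = 0\<^sub>m n n"
    proof (rule inj[OF proj[OF x]])
      fix c assume c: "c < K"
      then show "(x - x * e) * U c = 0\<^sub>m n (d c)" using 0[rule_format, of c] by (simp add: projU[OF x c])
    qed
    then have "x = x * e" using mat_diff_eq_0_iff[OF xc, of "x * e"] xc ec by simp
    also have "\<dots> = 0\<^sub>m n n" using inj'[OF x] 0[rule_format, of K] by simp
    finally show "x = 0\<^sub>m n n" .
  next
    fix Y :: "nat \<Rightarrow> complex mat"
    assume Y: "\<forall>c<Suc K. Y c \<in> carrier_mat ((d(K := d')) c) ((d(K := d')) c)"
    have "Y c \<in> carrier_mat (d c) (d c)" if "c < K" for c using Y[rule_format, of c] that by simp
    then obtain x1 where x1: "x1 \<in> ?S" "\<And>c. c < K \<Longrightarrow> (U c)\<dagger> * (x1 * U c) = Y c"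
      using surj[of Y] by blast
    obtain x2 where x2: "x2 \<in> S" "U'\<dagger> * (x2 * U') = Y K" using surj' Y[rule_format, of K] by auto
    have xc: "x1 \<in> carrier_mat n n" "x2 \<in> carrier_mat n n" using SD(1) x1(1) x2(1) by simp_all
    have a: "(x1 + x2 * e) * U c = x1 * U c" if c: "c < K" for c
    proof -
      have "(x1 + x2 * e) * U c = x1 * U c + 0\<^sub>m n (d c)"
        using xc ec dU(2)[OF c] by (simp add: mat_add_mult mat_assoc eU[OF c])
      also have "\<dots> = x1 * U c" using xc dU(2)[OF c] by (intro eq_matI) auto
      finally show ?thesis .
    qed
    have b: "(x1 + x2 * e) * U' = x2 * U'"
    proof -
      have "x1 * U' = x1 * e * U'" using xc ec U'(1,3) by (simp add: mat_assoc)
      also have "\<dots> = 0\<^sub>m n d'" using x1(1) U'(1) by simp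
      finally have "(x1 + x2 * e) * U' = 0\<^sub>m n d' + x2 * U'"
        using xc ec U'(1) by (simp add: mat_add_mult mat_assoc U'(3))
      also have "\<dots> = x2 * U'" using xc U'(1) by (intro eq_matI) auto
      finally show ?thesis .
    qed
    show "\<exists>x\<in>S. \<forall>c<Suc K. ((U(K := U')) c)\<dagger> * (x * (U(K := U')) c) = Y c"
    proof (intro bexI allI impI)
      show "x1 + x2 * e \<in> S" using SD(3,4) x1(1) x2(1) e(1) by simp
      fix c assume "c < Suc K"
      then show "((U(K := U')) c)\<dagger> * ((x1 + x2 * e) * (U(K := U')) c) = Y c"
        using a b x1(2) x2(2) by (cases "c = K") auto
    qed
  qed
qed

text \<open>Closure under adjoints is where centrality enters: \<open>x\<dagger> * e\<close> is the
  adjoint of \<open>e * x\<close>.\<close>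

lemma star_subalgebra_complement:
  assumes S: "star_subalgebra n S" and e: "e \<in> S" "e\<dagger> = e" "\<And>x. x \<in> S \<Longrightarrow> e * x = x * e"
  shows "star_subalgebra n {x \<in> S. x * e = 0\<^sub>m n n}"
proof -
  note SD = star_subalgebraD[OF S]
  have ec: "e \<in> carrier_mat n n" by (rule SD(1)[OF e(1)])
  show ?thesis
    unfolding star_subalgebra_def
  proof (intro conjI ballI allI)
    show "{x \<in> S. x * e = 0\<^sub>m n n} \<subseteq> carrier_mat n n" using SD(1) by blast
    show "0\<^sub>m n n \<in> {x \<in> S. x * e = 0\<^sub>m n n}" using SD(2) ec by simp
    fix x assume x: "x \<in> {x \<in> S. x * e = 0\<^sub>m n n}"
    then have xc: "x \<in> carrier_mat n n" and xS: "x \<in> S" and xe: "x * e = 0\<^sub>m n n" using SD(1) by auto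
    show "c \<cdot>\<^sub>m x \<in> {x \<in> S. x * e = 0\<^sub>m n n}" for c
      using SD(5)[OF xS] xc ec xe by (simp add: mat_smult_mult)
    have "e * x = 0\<^sub>m n n" using e(3)[OF xS] xe by simp
    from arg_cong[OF this, of mat_adjoint] have "x\<dagger> * e = 0\<^sub>m n n"
      using xc ec by (simp add: mat_adjoint_mult e(2))
    then show "x\<dagger> \<in> {x \<in> S. x * e = 0\<^sub>m n n}" using SD(6)[OF xS] by simp
    fix y assume y: "y \<in> {x \<in> S. x * e = 0\<^sub>m n n}"
    then have yc: "y \<in> carrier_mat n n" and yS: "y \<in> S" and ye: "y * e = 0\<^sub>m n n" using SD(1) by auto
    show "x + y \<in> {x \<in> S. x * e = 0\<^sub>m n n}"
      using SD(3)[OF xS yS] xc yc ec xe ye by (simp add: mat_add_mult)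
    show "x * y \<in> {x \<in> S. x * e = 0\<^sub>m n n}"
      using SD(4)[OF xS yS] xc yc ec ye by (simp add: mat_assoc)
  qed
qed

text \<open>The induction is on a bound for the size of orthogonal families of nonzero elements of \<open>S\<close>:
  splitting off a central projection \<open>e\<close> lowers it, because \<open>e\<close> extends any such family of
  the complement.\<close>

theorem block_decomposition_exists:
  assumes "star_subalgebra n S"
  shows "\<exists>K d U. block_decomposition n S K d U"
proof -
  have "\<exists>K d U. block_decomposition n S K d U"
    if "star_subalgebra n S"
      and "\<And>(k :: nat) f. (\<forall>i<k. f i \<in> S \<and> f i \<noteq> 0\<^sub>m n n) \<Longrightarrow>
        (\<forall>i<k. \<forall>j<k. i \<noteq> j \<longrightarrow> (f i)\<dagger> * f j = 0\<^sub>m n n) \<Longrightarrow> k \<le> N" for N :: nat and S :: "complex mat set"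
    using that
  proof (induction N arbitrary: S)
    case (0 S)
    have "S = {0\<^sub>m n n}"
    proof (rule ccontr)
      assume "S \<noteq> {0\<^sub>m n n}"
      then obtain x where "x \<in> S" "x \<noteq> 0\<^sub>m n n" using star_subalgebraD(2)[OF 0(1)] by blast
      then show False using 0(2)[of 1 "\<lambda>_. x"] by simp
    qed
    then show ?case
      by (intro exI[of _ 0] exI[of _ "\<lambda>_. 1"] exI[of _ "\<lambda>_. 1\<^sub>m n"]) (simp add: block_decomposition_def)
  next
    case (Suc N S)
    note S = Suc.prems(1)
    note SD = star_subalgebraD[OF S]
    show ?case
    proof (cases "S = {0\<^sub>m n n}")
      case True
      then show ?thesis
        by (intro exI[of _ 0] exI[of _ "\<lambda>_. 1"] exI[of _ "\<lambda>_. 1\<^sub>m n"]) (simp add: block_decomposition_def)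
    next
      case False
      obtain e d' U' where e: "e \<in> S" "e\<dagger> = e" "e * e = e" "e \<noteq> 0\<^sub>m n n" "\<And>x. x \<in> S \<Longrightarrow> e * x = x * e"
        and d': "0 < d'" and U': "U' \<in> carrier_mat n d'" "U'\<dagger> * U' = 1\<^sub>m d'" "e * U' = U'"
        and blk: "\<And>x. x \<in> S \<Longrightarrow> x * U' = U' * (U'\<dagger> * (x * U'))"
          "\<And>x. x \<in> S \<Longrightarrow> x * U' = 0\<^sub>m n d' \<Longrightarrow> x * e = 0\<^sub>m n n"
          "\<And>Y. Y \<in> carrier_mat d' d' \<Longrightarrow> \<exists>x\<in>S. U'\<dagger> * (x * U') = Y"
        by (rule simple_summand_exists[OF S False], rule that; (assumption | blast))
      let ?S = "{x \<in> S. x * e = 0\<^sub>m n n}"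
      have "\<exists>K d U. block_decomposition n ?S K d U"
      proof (rule Suc.IH)
        show "star_subalgebra n ?S" by (rule star_subalgebra_complement[OF S e(1,2,5)])
        fix k :: nat and f assume f: "\<forall>i<k. f i \<in> ?S \<and> f i \<noteq> 0\<^sub>m n n"
          and orth: "\<forall>i<k. \<forall>j<k. i \<noteq> j \<longrightarrow> (f i)\<dagger> * f j = 0\<^sub>m n n"
        have ec: "e \<in> carrier_mat n n" by (rule SD(1)[OF e(1)])
        have ef: "e * f i = 0\<^sub>m n n" "(f i)\<dagger> * e = 0\<^sub>m n n" if "i < k" for i
        proof -
          have fS: "f i \<in> S" "f i * e = 0\<^sub>m n n" using f that by auto
          then show ef: "e * f i = 0\<^sub>m n n" using e(5) by simp
          show "(f i)\<dagger> * e = 0\<^sub>m n n"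
            using arg_cong[OF ef, of mat_adjoint] ec SD(1)[OF fS(1)] by (simp add: mat_adjoint_mult e(2))
        qed
        have "Suc k \<le> Suc N"
        proof (rule Suc.prems(2)[of "Suc k" "f(k := e)"])
          show "\<forall>i<Suc k. (f(k := e)) i \<in> S \<and> (f(k := e)) i \<noteq> 0\<^sub>m n n"
            using f e(1,4) by (auto simp: less_Suc_eq)
          show "\<forall>i<Suc k. \<forall>j<Suc k. i \<noteq> j \<longrightarrow> ((f(k := e)) i)\<dagger> * (f(k := e)) j = 0\<^sub>m n n"
            using orth ef e(2) by (auto simp: less_Suc_eq)
        qed
        then show "k \<le> N" by simp
      qed
      then obtain K d U where "block_decomposition n ?S K d U" by blast
      from block_decomposition_step[OF S e(1,3,5) d' U' blk this] show ?thesis by blast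
    qed
  qed
  \<comment> \<open>The dimension \<open>n\<close> is an admissible initial bound for the
    induction.\<close>
  moreover have "k \<le> n"
    if f: "\<forall>i<k. f i \<in> S \<and> f i \<noteq> 0\<^sub>m n n" and "\<forall>i<k. \<forall>j<k. i \<noteq> j \<longrightarrow> (f i)\<dagger> * f j = 0\<^sub>m n n"
    for k :: nat and f :: "nat \<Rightarrow> complex mat"
  proof -
    have "card {..<k} \<le> n"
      by (rule orthogonal_family_card_le[of _ f]) (use that star_subalgebraD(1)[OF assms] in auto)
    then show ?thesis by simp
  qed
  ultimately show ?thesis using assms by blast
qed

section \<open>Embeddings of *-algebras\<close>

lemma star_hom_iff:
  "f \<in> star_hom A B \<longleftrightarrow>
     (\<forall>x\<in>carrier A. f x \<in> carrier B) \<and>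
     (\<forall>x\<in>carrier A. \<forall>y\<in>carrier A. f (x \<oplus>\<^bsub>A\<^esub> y) = f x \<oplus>\<^bsub>B\<^esub> f y) \<and>
     (\<forall>x\<in>carrier A. \<forall>y\<in>carrier A. f (x \<otimes>\<^bsub>A\<^esub> y) = f x \<otimes>\<^bsub>B\<^esub> f y) \<and>
     (\<forall>c. \<forall>x\<in>carrier A. f (c \<odot>\<^bsub>A\<^esub> x) = c \<odot>\<^bsub>B\<^esub> f x) \<and>
     (\<forall>x\<in>carrier A. f (star A x) = star B (f x))"
  unfolding star_hom_def LinearCombinations.module_hom_def hom_def by auto

lemma star_homD:
  assumes "f \<in> star_hom A B"
  shows "x \<in> carrier A \<Longrightarrow> f x \<in> carrier B"
    "x \<in> carrier A \<Longrightarrow> y \<in> carrier A \<Longrightarrow> f (x \<oplus>\<^bsub>A\<^esub> y) = f x \<oplus>\<^bsub>B\<^esub> f y"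
    "x \<in> carrier A \<Longrightarrow> y \<in> carrier A \<Longrightarrow> f (x \<otimes>\<^bsub>A\<^esub> y) = f x \<otimes>\<^bsub>B\<^esub> f y"
    "x \<in> carrier A \<Longrightarrow> f (c \<odot>\<^bsub>A\<^esub> x) = c \<odot>\<^bsub>B\<^esub> f x"
    "x \<in> carrier A \<Longrightarrow> f (star A x) = star B (f x)"
  using assms by (auto simp: star_hom_iff)

lemma star_hom_comp:
  assumes "f \<in> star_hom A B" "g \<in> star_hom B C"
  shows "g \<circ> f \<in> star_hom A C"
  using star_homD[OF assms(1)] star_homD[OF assms(2)] by (simp add: star_hom_iff)

lemma embeds_trans:
  assumes "embeds A B" "embeds B C"
  shows "embeds A C"
proof -
  obtain f g where f: "f \<in> star_hom A B" "inj_on f (carrier A)"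
    and g: "g \<in> star_hom B C" "inj_on g (carrier B)"
    using assms unfolding embeds_def by blast
  have "inj_on (g \<circ> f) (carrier A)"
    using f g star_homD(1)[OF f(1)] by (intro comp_inj_on) (auto intro: inj_on_subset)
  then show ?thesis unfolding embeds_def using star_hom_comp[OF f(1) g(1)] by blast
qed

lemma star_isomorphic_imp_embeds: "star_isomorphic A B \<Longrightarrow> embeds A B"
  unfolding star_isomorphic_def embeds_def bij_betw_def by blast

lemma star_isomorphic_trans:
  assumes "star_isomorphic A B" "star_isomorphic B C"
  shows "star_isomorphic A C"
  using assms star_hom_comp bij_betw_trans unfolding star_isomorphic_def by blast

section \<open>Algebraic laws and their transport\<close>

text \<open>The laws without finite dimension, norm and nonvanishing, so that they can be checked
  one by one in images and componentwise in direct sums, including empty ones. Additive inverses are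
  expressed as multiples by \<open>-1\<close>.\<close>

locale unital_star_algebra =
  fixes A :: "'a star_algebra" (structure)
  assumes laws: "\<zero> \<in> carrier A" "\<one> \<in> carrier A"
    "x \<in> carrier A \<Longrightarrow> y \<in> carrier A \<Longrightarrow> x \<oplus> y \<in> carrier A"
    "x \<in> carrier A \<Longrightarrow> y \<in> carrier A \<Longrightarrow> x \<otimes> y \<in> carrier A"
    "x \<in> carrier A \<Longrightarrow> c \<odot> x \<in> carrier A"
    "x \<in> carrier A \<Longrightarrow> star A x \<in> carrier A"
    "x \<in> carrier A \<Longrightarrow> y \<in> carrier A \<Longrightarrow> z \<in> carrier A \<Longrightarrow> x \<oplus> y \<oplus> z = x \<oplus> (y \<oplus> z)"
    "x \<in> carrier A \<Longrightarrow> y \<in> carrier A \<Longrightarrow> x \<oplus> y = y \<oplus> x"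
    "x \<in> carrier A \<Longrightarrow> \<zero> \<oplus> x = x"
    "x \<in> carrier A \<Longrightarrow> (- 1) \<odot> x \<oplus> x = \<zero>"
    "x \<in> carrier A \<Longrightarrow> y \<in> carrier A \<Longrightarrow> z \<in> carrier A \<Longrightarrow> x \<otimes> y \<otimes> z = x \<otimes> (y \<otimes> z)"
    "x \<in> carrier A \<Longrightarrow> \<one> \<otimes> x = x" "x \<in> carrier A \<Longrightarrow> x \<otimes> \<one> = x"
    "x \<in> carrier A \<Longrightarrow> y \<in> carrier A \<Longrightarrow> z \<in> carrier A \<Longrightarrow> (x \<oplus> y) \<otimes> z = x \<otimes> z \<oplus> y \<otimes> z"
    "x \<in> carrier A \<Longrightarrow> y \<in> carrier A \<Longrightarrow> z \<in> carrier A \<Longrightarrow> z \<otimes> (x \<oplus> y) = z \<otimes> x \<oplus> z \<otimes> y"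
    "x \<in> carrier A \<Longrightarrow> (a + b) \<odot> x = a \<odot> x \<oplus> b \<odot> x"
    "x \<in> carrier A \<Longrightarrow> y \<in> carrier A \<Longrightarrow> a \<odot> (x \<oplus> y) = a \<odot> x \<oplus> a \<odot> y"
    "x \<in> carrier A \<Longrightarrow> (a * b) \<odot> x = a \<odot> (b \<odot> x)"
    "x \<in> carrier A \<Longrightarrow> 1 \<odot> x = x"
    "x \<in> carrier A \<Longrightarrow> y \<in> carrier A \<Longrightarrow> (c \<odot> x) \<otimes> y = c \<odot> (x \<otimes> y)"
    "x \<in> carrier A \<Longrightarrow> y \<in> carrier A \<Longrightarrow> x \<otimes> (c \<odot> y) = c \<odot> (x \<otimes> y)"
    "x \<in> carrier A \<Longrightarrow> star A (star A x) = x"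
    "x \<in> carrier A \<Longrightarrow> y \<in> carrier A \<Longrightarrow> star A (x \<oplus> y) = star A x \<oplus> star A y"
    "x \<in> carrier A \<Longrightarrow> y \<in> carrier A \<Longrightarrow> star A (x \<otimes> y) = star A y \<otimes> star A x"
    "x \<in> carrier A \<Longrightarrow> star A (c \<odot> x) = cnj c \<odot> star A x"

lemmas unital_star_algebraD = unital_star_algebra.laws

lemma (in unital_star_algebra) is_ring: "ring A"
  and is_vectorspace: "vectorspace class_ring A"
proof -
  have ab: "abelian_group A"
  proof (rule abelian_groupI)
    fix x assume "x \<in> carrier A"
    then show "\<exists>y\<in>carrier A. y \<oplus> x = \<zero>" using laws(5,10) by blast
  qed (rule laws; assumption)+
  have "monoid A" by (rule monoidI) (use laws in auto)
  then show "ring A" by (intro ringI ab) (use laws in auto)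
  have "Module.module class_ring A"
    by (intro moduleI class_cring.is_cring ab) (use laws in auto)
  then show "vectorspace class_ring A"
    by (intro vectorspace.intro) (auto intro: class_field)
qed

lemma fd_cstar_algebra_iff:
  "fd_cstar_algebra A \<longleftrightarrow> unital_star_algebra A \<and> vectorspace.fin_dim class_ring A \<and>
     carrier A \<noteq> {\<zero>\<^bsub>A\<^esub>} \<and> (\<exists>nrm. is_cstar_norm A nrm)"
proof
  assume A: "fd_cstar_algebra A"
  then interpret ring A by (simp add: fd_cstar_algebra_def)
  interpret V: vectorspace class_ring A using A by (simp add: fd_cstar_algebra_def)
  have l: "(a + b) \<odot>\<^bsub>A\<^esub> x = a \<odot>\<^bsub>A\<^esub> x \<oplus>\<^bsub>A\<^esub> b \<odot>\<^bsub>A\<^esub> x" if "x \<in> carrier A" for x a b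
    using V.smult_l_distr[of a b x] that by simp
  have one: "1 \<odot>\<^bsub>A\<^esub> x = x" if "x \<in> carrier A" for x using V.smult_one[of x] that by simp
  have "unital_star_algebra A"
  proof
    fix x y a b
    assume x: "x \<in> carrier A"
    show "a \<odot>\<^bsub>A\<^esub> x \<in> carrier A" by (rule V.smult_closed) (use x in auto)
    show "(a * b) \<odot>\<^bsub>A\<^esub> x = a \<odot>\<^bsub>A\<^esub> (b \<odot>\<^bsub>A\<^esub> x)" using V.smult_assoc1[of a b x] x by simp
    have "(- 1) \<odot>\<^bsub>A\<^esub> x \<oplus>\<^bsub>A\<^esub> x = (- 1 + 1) \<odot>\<^bsub>A\<^esub> x" using l[OF x, of "- 1" 1] one[OF x] by simp
    also have "\<dots> = \<zero>\<^bsub>A\<^esub>" using V.lmult_0[OF x] by simp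
    finally show "(- 1) \<odot>\<^bsub>A\<^esub> x \<oplus>\<^bsub>A\<^esub> x = \<zero>\<^bsub>A\<^esub>" .
    assume y: "y \<in> carrier A"
    show "x \<oplus>\<^bsub>A\<^esub> y = y \<oplus>\<^bsub>A\<^esub> x" using x y by (rule a_comm)
    show "a \<odot>\<^bsub>A\<^esub> (x \<oplus>\<^bsub>A\<^esub> y) = a \<odot>\<^bsub>A\<^esub> x \<oplus>\<^bsub>A\<^esub> a \<odot>\<^bsub>A\<^esub> y" using V.smult_r_distr[of a x y] x y by simp
  qed (use A l one in \<open>simp_all add: fd_cstar_algebra_def a_assoc m_assoc l_distr r_distr\<close>)
  then show "unital_star_algebra A \<and> vectorspace.fin_dim class_ring A \<and>
     carrier A \<noteq> {\<zero>\<^bsub>A\<^esub>} \<and> (\<exists>nrm. is_cstar_norm A nrm)"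
    using A by (simp add: fd_cstar_algebra_def)
next
  assume A: "unital_star_algebra A \<and> vectorspace.fin_dim class_ring A \<and>
     carrier A \<noteq> {\<zero>\<^bsub>A\<^esub>} \<and> (\<exists>nrm. is_cstar_norm A nrm)"
  then interpret unital_star_algebra A by simp
  show "fd_cstar_algebra A"
    using A is_ring is_vectorspace by (simp add: fd_cstar_algebra_def laws(6,20-25))
qed

text \<open>Each law is a closure condition or an equation and passes to the image of a
  homomorphism; the range of a representation becomes an algebra in this way.\<close>

lemma unital_star_algebra_image:
  fixes B (structure)
  assumes A: "unital_star_algebra A" and f: "f \<in> star_hom A B"
    and im: "f ` carrier A = carrier B" "f \<zero>\<^bsub>A\<^esub> = \<zero>" "f \<one>\<^bsub>A\<^esub> = \<one>"
  shows "unital_star_algebra B"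
proof -
  note D = unital_star_algebraD(1-7,9-)[OF A]
  note h = star_homD(2-5)[OF f, symmetric] im(2,3)[symmetric]
  have c: "\<exists>x\<in>carrier A. y = f x" if "y \<in> carrier B" for y using that im(1) by auto
  have fB: "f x \<in> carrier B" if "x \<in> carrier A" for x using that im(1) by auto
  show ?thesis
  proof (rule unital_star_algebra.intro)
    show "\<zero> \<in> carrier B" "\<one> \<in> carrier B" using fB[OF D(1)] fB[OF D(2)] im(2,3) by simp_all
    fix x assume "x \<in> carrier B"
    then obtain x' where x: "x' \<in> carrier A" "x = f x'" using c by blast
    show "star B x \<in> carrier B" "\<zero> \<oplus> x = x" "(- 1) \<odot> x \<oplus> x = \<zero>"
      "\<one> \<otimes> x = x" "x \<otimes> \<one> = x" "1 \<odot> x = x" "star B (star B x) = x"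
      unfolding x(2) using x(1) fB by (simp_all add: h D)
    fix a b
    show "a \<odot> x \<in> carrier B" "(a + b) \<odot> x = a \<odot> x \<oplus> b \<odot> x"
      "(a * b) \<odot> x = a \<odot> (b \<odot> x)" "star B (a \<odot> x) = cnj a \<odot> star B x"
      unfolding x(2) using x(1) fB by (simp_all add: h D)
    fix y assume "y \<in> carrier B"
    then obtain y' where y: "y' \<in> carrier A" "y = f y'" using c by blast
    show "x \<oplus> y \<in> carrier B" "x \<otimes> y \<in> carrier B"
      "a \<odot> (x \<oplus> y) = a \<odot> x \<oplus> a \<odot> y"
      "(a \<odot> x) \<otimes> y = a \<odot> (x \<otimes> y)" "x \<otimes> (a \<odot> y) = a \<odot> (x \<otimes> y)"
      "star B (x \<oplus> y) = star B x \<oplus> star B y" "star B (x \<otimes> y) = star B y \<otimes> star B x"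
      unfolding x(2) y(2) using x(1) y(1) fB by (simp_all add: h D)
    show "x \<oplus> y = y \<oplus> x"
      unfolding x(2) y(2) using unital_star_algebraD(8)[OF A x(1) y(1)] x(1) y(1) by (simp add: h)
    fix z assume "z \<in> carrier B"
    then obtain z' where z: "z' \<in> carrier A" "z = f z'" using c by blast
    show "x \<oplus> y \<oplus> z = x \<oplus> (y \<oplus> z)" "x \<otimes> y \<otimes> z = x \<otimes> (y \<otimes> z)"
      "(x \<oplus> y) \<otimes> z = x \<otimes> z \<oplus> y \<otimes> z"
      "z \<otimes> (x \<oplus> y) = z \<otimes> x \<oplus> z \<otimes> y"
      unfolding x(2) y(2) z(2) using x(1) y(1) z(1) by (simp_all add: h D)
  qed
qed

section \<open>Injective maps and dimension\<close>

lemma (in linear_map) inj_image_lin_indpt: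
  assumes inj: "inj_on T (carrier V)" and A: "A \<subseteq> carrier V" "finite A" "V.module.lin_indpt A"
  shows "W.module.lin_indpt (T ` A)"
proof
  assume "W.module.lin_dep (T ` A)"
  then obtain B a w where B: "finite B" "B \<subseteq> T ` A" "a \<in> B \<rightarrow> carrier K"
    "W.module.lincomb a B = \<zero>\<^bsub>W\<^esub>" "w \<in> B" "a w \<noteq> \<zero>\<^bsub>K\<^esub>"
    unfolding W.module.lin_dep_def by blast
  define C where "C = {x \<in> A. T x \<in> B}"
  have C: "C \<subseteq> carrier V" "finite C" "T ` C = B" using A B(2) by (auto simp: C_def)
  have a: "a \<circ> T \<in> C \<rightarrow> carrier K" using B(3) C(3) by auto
  have "T (V.module.lincomb (a \<circ> T) C) = \<zero>\<^bsub>W\<^esub>"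
    using lincomb_linear_image[OF inj C(1), of a] B(3,4) C by simp
  moreover have "V.module.lincomb (a \<circ> T) C \<in> carrier V" using C(1) a by (rule V.module.lincomb_closed)
  ultimately have 0: "V.module.lincomb (a \<circ> T) C = \<zero>\<^bsub>V\<^esub>"
    using inj T0_is_0 by (metis V.module.M.zero_closed inj_onD)
  obtain x where x: "x \<in> C" "w = T x" using B(5) C(3) by blast
  have "V.module.lin_dep A"
    unfolding V.module.lin_dep_def
    by (rule exI[of _ C], rule exI[of _ "a \<circ> T"], rule exI[of _ x])
      (use C a 0 x B(6) in \<open>auto simp: C_def\<close>)
  then show False using A(3) by blast
qed

lemma (in linear_map) inj_image_card:
  assumes "inj_on T (carrier V)" "A \<subseteq> carrier V"
  shows "card (T ` A) = card A"
  using assms card_image inj_on_subset by blast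

text \<open>Independent sets of \<open>V\<close> are mapped injectively to independent sets of
  \<open>W\<close>, so their size is bounded by \<open>W.dim\<close> and a maximal one exists; it is
  finite and spans.\<close>

lemma (in linear_map) inj_fin_dim:
  assumes inj: "inj_on T (carrier V)" and W: "W.fin_dim"
  shows "V.fin_dim"
proof -
  have bound: "card A \<le> W.dim" if "A \<subseteq> carrier V" "finite A" "V.module.lin_indpt A" for A
  proof -
    have "card (T ` A) \<le> W.dim"
      by (rule W.li_le_dim(2)[OF W _ inj_image_lin_indpt[OF inj that]]) (use that in auto)
    then show ?thesis using inj_image_card[OF inj that(1)] by simp
  qed
  have "\<exists>A. finite A \<and> maximal A (\<lambda>S. S \<subseteq> carrier V \<and> V.module.lin_indpt S)"
  proof (rule maximal_exists[of _ "W.dim" "{}"])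
    fix A assume A: "A \<subseteq> carrier V \<and> V.module.lin_indpt A"
    have "finite A"
    proof (rule ccontr)
      assume "infinite A"
      then obtain B where B: "finite B" "card B = Suc W.dim" "B \<subseteq> A"
        by (meson infinite_arbitrarily_large)
      then have "V.module.lin_indpt B" using A V.module.subset_li_is_li by blast
      then show False using bound[of B] A B by auto
    qed
    then show "finite A \<and> card A \<le> W.dim" using bound A by blast
  qed (auto simp: V.module.lin_dep_def)
  then show ?thesis using V.max_li_is_gen unfolding V.fin_dim_def maximal_def by blast
qed

text \<open>The image of a basis is independent; when the dimensions agree it is a basis of
  \<open>W\<close>, so the map is onto.\<close>

lemma (in linear_map) inj_dim_le:
  assumes inj: "inj_on T (carrier V)" and W: "W.fin_dim"
  shows "V.dim \<le> W.dim" and "V.dim = W.dim \<Longrightarrow> T ` carrier V = carrier W"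
proof -
  have V: "V.fin_dim" by (rule inj_fin_dim[OF inj W])
  then obtain \<beta> where \<beta>: "finite \<beta>" "V.basis \<beta>" using V.finite_basis_exists by blast
  then have \<beta>': "\<beta> \<subseteq> carrier V" "V.module.lin_indpt \<beta>" "card \<beta> = V.dim"
    using V.dim_basis[of \<beta>] by (auto simp: V.basis_def)
  have li: "W.module.lin_indpt (T ` \<beta>)" by (rule inj_image_lin_indpt[OF inj \<beta>'(1) \<beta>(1) \<beta>'(2)])
  have c: "card (T ` \<beta>) = V.dim" using inj_image_card[OF inj \<beta>'(1)] \<beta>'(3) by simp
  have sub: "T ` \<beta> \<subseteq> carrier W" using \<beta>'(1) by auto
  show "V.dim \<le> W.dim" using W.li_le_dim(2)[OF W sub li] c by simp
  assume eq: "V.dim = W.dim"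
  have "W.basis (T ` \<beta>)" by (rule W.dim_li_is_basis[OF W _ sub li]) (use \<beta> c eq in auto)
  then have span: "W.module.span (T ` \<beta>) = carrier W" by (simp add: W.basis_def)
  show "T ` carrier V = carrier W"
  proof
    show "carrier W \<subseteq> T ` carrier V"
    proof
      fix w assume "w \<in> carrier W"
      then have "w \<in> W.module.span (T ` \<beta>)" using span by simp
      then obtain a B where aB: "finite B" "B \<subseteq> T ` \<beta>" "a \<in> B \<rightarrow> carrier K" "w = W.module.lincomb a B"
        unfolding W.module.span_def by blast
      define C where "C = {x \<in> \<beta>. T x \<in> B}"
      have C: "C \<subseteq> carrier V" "finite C" "T ` C = B" using \<beta>(1) \<beta>'(1) aB(2) by (auto simp: C_def)
      have a: "a \<circ> T \<in> C \<rightarrow> carrier K" using aB(3) C(3) by auto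
      have "w = T (V.module.lincomb (a \<circ> T) C)"
        using lincomb_linear_image[OF inj C(1), of a] aB C by simp
      then show "w \<in> T ` carrier V" using V.module.lincomb_closed[OF C(1) a] by blast
    qed
  qed auto
qed

lemma star_hom_linear_map:
  assumes "unital_star_algebra A" "unital_star_algebra B" "f \<in> star_hom A B"
  shows "linear_map class_ring A B f"
  using assms unital_star_algebra.is_vectorspace[of A] unital_star_algebra.is_vectorspace[of B]
  unfolding linear_map_def mod_hom_def mod_hom_axioms_def star_hom_def vectorspace_def by blast

lemma star_hom_zero:
  assumes "unital_star_algebra A" "unital_star_algebra B" "f \<in> star_hom A B"
  shows "f \<zero>\<^bsub>A\<^esub> = \<zero>\<^bsub>B\<^esub>"
  using linear_map.T0_is_0[OF star_hom_linear_map[OF assms]] .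

text \<open>Injectivity is used twice: it bounds the dimension, and it makes the norm
  \<open>nrm \<circ> f\<close> definite.\<close>

lemma fd_cstar_algebra_if_embeds:
  assumes B: "unital_star_algebra B" "carrier B \<noteq> {\<zero>\<^bsub>B\<^esub>}"
    and BA: "embeds B A" and A: "fd_cstar_algebra A"
  shows "fd_cstar_algebra B"
proof -
  obtain f where f: "f \<in> star_hom B A" "inj_on f (carrier B)" using BA unfolding embeds_def by blast
  have A': "unital_star_algebra A" "vectorspace.fin_dim class_ring A"
    using A unfolding fd_cstar_algebra_iff by auto
  obtain nrm where nrm: "is_cstar_norm A nrm" using A unfolding fd_cstar_algebra_iff by auto
  have "vectorspace.fin_dim class_ring B"
    by (rule linear_map.inj_fin_dim[OF star_hom_linear_map[OF B(1) A'(1) f(1)] f(2) A'(2)])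
  moreover have "is_cstar_norm B (nrm \<circ> f)"
    unfolding is_cstar_norm_def
  proof (intro conjI ballI allI)
    note h = star_homD[OF f(1)]
    fix x assume x: "x \<in> carrier B"
    show "0 \<le> (nrm \<circ> f) x" using nrm h(1)[OF x] by (simp add: is_cstar_norm_def)
    have "f x = \<zero>\<^bsub>A\<^esub> \<longleftrightarrow> x = \<zero>\<^bsub>B\<^esub>"
      using star_hom_zero[OF B(1) A'(1) f(1)] inj_onD[OF f(2) _ x unital_star_algebraD(1)[OF B(1)]] by auto
    then show "((nrm \<circ> f) x = 0) = (x = \<zero>\<^bsub>B\<^esub>)" using nrm h(1)[OF x] by (simp add: is_cstar_norm_def)
    show "(nrm \<circ> f) (c \<odot>\<^bsub>B\<^esub> x) = cmod c * (nrm \<circ> f) x" for c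
      using nrm h(1,4)[OF x] by (simp add: is_cstar_norm_def)
    show "(nrm \<circ> f) (star B x \<otimes>\<^bsub>B\<^esub> x) = ((nrm \<circ> f) x)\<^sup>2"
      using nrm h(1,5)[OF x] h(3)[OF unital_star_algebraD(6)[OF B(1) x] x] by (simp add: is_cstar_norm_def)
    fix y assume y: "y \<in> carrier B"
    show "(nrm \<circ> f) (x \<oplus>\<^bsub>B\<^esub> y) \<le> (nrm \<circ> f) x + (nrm \<circ> f) y"
      using nrm h(1)[OF x] h(1)[OF y] h(2)[OF x y] by (simp add: is_cstar_norm_def)
    show "(nrm \<circ> f) (x \<otimes>\<^bsub>B\<^esub> y) \<le> (nrm \<circ> f) x * (nrm \<circ> f) y"
      using nrm h(1)[OF x] h(1)[OF y] h(3)[OF x y] by (simp add: is_cstar_norm_def)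
  qed
  ultimately show ?thesis unfolding fd_cstar_algebra_iff using B by blast
qed

text \<open>An embedding onto \<open>B\<close> would be an isomorphism, so the image is a proper
  subspace. The dimension thereby measures the descent through strict embeddings.\<close>

lemma strictly_embeds_dim_less:
  assumes A: "fd_cstar_algebra A" and B: "fd_cstar_algebra B" and AB: "strictly_embeds A B"
  shows "vectorspace.dim class_ring A < vectorspace.dim class_ring B"
proof -
  obtain f where f: "f \<in> star_hom A B" "inj_on f (carrier A)"
    using AB unfolding strictly_embeds_def embeds_def by blast
  have u: "unital_star_algebra A" "unital_star_algebra B" "vectorspace.fin_dim class_ring B"
    using A B unfolding fd_cstar_algebra_iff by auto
  note dim = linear_map.inj_dim_le[OF star_hom_linear_map[OF u(1,2) f(1)] f(2) u(3)]
  have "f ` carrier A \<noteq> carrier B"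
    using f AB unfolding strictly_embeds_def star_isomorphic_def bij_betw_def by blast
  then show ?thesis using dim by (metis le_neq_implies_less)
qed

lemma star_isomorphic_sym:
  assumes A: "unital_star_algebra A" and AB: "star_isomorphic A B"
  shows "star_isomorphic B A"
proof -
  obtain f where f: "f \<in> star_hom A B" "bij_betw f (carrier A) (carrier B)"
    using AB unfolding star_isomorphic_def by blast
  define g where "g = inv_into (carrier A) f"
  have g: "g y \<in> carrier A" "f (g y) = y" if "y \<in> carrier B" for y
    using f(2) that unfolding g_def bij_betw_def by (auto simp: inv_into_into f_inv_into_f)
  have gf: "g (f x) = x" if "x \<in> carrier A" for x
    using f(2) that unfolding g_def bij_betw_def by (auto simp: inv_into_f_f)
  note D = unital_star_algebraD(3-6)[OF A]
  note h = star_homD[OF f(1)]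
  have "g \<in> star_hom B A"
    unfolding star_hom_iff
  proof (intro conjI ballI allI)
    fix x assume x: "x \<in> carrier B"
    show "g x \<in> carrier A" using g x by blast
    show "g (c \<odot>\<^bsub>B\<^esub> x) = c \<odot>\<^bsub>A\<^esub> g x" for c
      using gf[OF D(3)[OF g(1)[OF x]]] h(4)[OF g(1)[OF x]] g(2)[OF x] by metis
    show "g (star B x) = star A (g x)"
      using gf[OF D(4)[OF g(1)[OF x]]] h(5)[OF g(1)[OF x]] g(2)[OF x] by metis
    fix y assume y: "y \<in> carrier B"
    show "g (x \<oplus>\<^bsub>B\<^esub> y) = g x \<oplus>\<^bsub>A\<^esub> g y"
      using gf[OF D(1)[OF g(1)[OF x] g(1)[OF y]]] h(2)[OF g(1)[OF x] g(1)[OF y]] g(2)[OF x] g(2)[OF y]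
      by metis
    show "g (x \<otimes>\<^bsub>B\<^esub> y) = g x \<otimes>\<^bsub>A\<^esub> g y"
      using gf[OF D(2)[OF g(1)[OF x] g(1)[OF y]]] h(3)[OF g(1)[OF x] g(1)[OF y]] g(2)[OF x] g(2)[OF y]
      by metis
  qed
  moreover have "bij_betw g (carrier B) (carrier A)"
    unfolding g_def using f(2) by (rule bij_betw_inv_into)
  ultimately show ?thesis unfolding star_isomorphic_def by blast
qed

section \<open>Matrix algebras and direct sums\<close>

lemma matrix_algebra_simps [simp]:
  "carrier (matrix_algebra d) = carrier_mat d d" "x \<otimes>\<^bsub>matrix_algebra d\<^esub> y = x * y"
  "\<one>\<^bsub>matrix_algebra d\<^esub> = 1\<^sub>m d" "\<zero>\<^bsub>matrix_algebra d\<^esub> = 0\<^sub>m d d" "x \<oplus>\<^bsub>matrix_algebra d\<^esub> y = x + y"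
  "c \<odot>\<^bsub>matrix_algebra d\<^esub> x = c \<cdot>\<^sub>m x" "star (matrix_algebra d) x = x\<dagger>"
  by (simp_all add: matrix_algebra_def)

lemma unital_star_algebra_matrix_algebra: "unital_star_algebra (matrix_algebra d)"
proof (rule unital_star_algebra.intro; unfold matrix_algebra_simps)
  show "0\<^sub>m d d \<in> carrier_mat d d" "1\<^sub>m d \<in> carrier_mat d d" by auto
  fix x y z :: "complex mat" and a b :: complex
  assume x: "x \<in> carrier_mat d d"
  show "a \<cdot>\<^sub>m x \<in> carrier_mat d d" "x\<dagger> \<in> carrier_mat d d" "0\<^sub>m d d + x = x" "1\<^sub>m d * x = x" "x * 1\<^sub>m d = x"
    "1 \<cdot>\<^sub>m x = x" "(x\<dagger>)\<dagger> = x" "(a * b) \<cdot>\<^sub>m x = a \<cdot>\<^sub>m (b \<cdot>\<^sub>m x)"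
    using x by simp_all
  show "- 1 \<cdot>\<^sub>m x + x = 0\<^sub>m d d" "(a + b) \<cdot>\<^sub>m x = a \<cdot>\<^sub>m x + b \<cdot>\<^sub>m x"
    using x by (auto intro!: eq_matI simp: algebra_simps)
  show "(a \<cdot>\<^sub>m x)\<dagger> = cnj a \<cdot>\<^sub>m x\<dagger>" by (rule mat_adjoint_smult)
  assume y: "y \<in> carrier_mat d d"
  show "x + y \<in> carrier_mat d d" "x * y \<in> carrier_mat d d" using x y by simp_all
  show "x + y = y + x" "a \<cdot>\<^sub>m (x + y) = a \<cdot>\<^sub>m x + a \<cdot>\<^sub>m y" "(x + y)\<dagger> = x\<dagger> + y\<dagger>"
    using x y by (auto intro!: eq_matI simp: algebra_simps)
  show "(a \<cdot>\<^sub>m x) * y = a \<cdot>\<^sub>m (x * y)" "x * (a \<cdot>\<^sub>m y) = a \<cdot>\<^sub>m (x * y)" "(x * y)\<dagger> = y\<dagger> * x\<dagger>"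
    using x y by (simp_all add: mat_distribs)
  assume z: "z \<in> carrier_mat d d"
  show "x + y + z = x + (y + z)" using x y z by (auto intro!: eq_matI)
  show "x * y * z = x * (y * z)" "(x + y) * z = x * z + y * z" "z * (x + y) = z * x + z * y"
    using x y z by (simp_all add: mat_assoc mat_add_mult mat_mult_add)
qed

lemma direct_sum_simps [simp]:
  "carrier (direct_sum I A) = (\<Pi>\<^sub>E i\<in>I. carrier (A i))"
  "x \<otimes>\<^bsub>direct_sum I A\<^esub> y = (\<lambda>i\<in>I. x i \<otimes>\<^bsub>A i\<^esub> y i)"
  "\<one>\<^bsub>direct_sum I A\<^esub> = (\<lambda>i\<in>I. \<one>\<^bsub>A i\<^esub>)" "\<zero>\<^bsub>direct_sum I A\<^esub> = (\<lambda>i\<in>I. \<zero>\<^bsub>A i\<^esub>)"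
  "x \<oplus>\<^bsub>direct_sum I A\<^esub> y = (\<lambda>i\<in>I. x i \<oplus>\<^bsub>A i\<^esub> y i)"
  "c \<odot>\<^bsub>direct_sum I A\<^esub> x = (\<lambda>i\<in>I. c \<odot>\<^bsub>A i\<^esub> x i)"
  "star (direct_sum I A) x = (\<lambda>i\<in>I. star (A i) (x i))"
  by (simp_all add: direct_sum_def)

lemma unital_star_algebra_direct_sum:
  assumes "\<And>i. i \<in> I \<Longrightarrow> unital_star_algebra (A i)"
  shows "unital_star_algebra (direct_sum I A)"
proof -
  note D = unital_star_algebraD[OF assms]
  have ext: "(\<lambda>i\<in>I. F i) = x" if "x \<in> (\<Pi>\<^sub>E i\<in>I. carrier (A i))" "\<And>i. i \<in> I \<Longrightarrow> F i = x i" for F x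
    using that by (intro extensionalityI[of _ I]) (auto simp: PiE_def)
  show ?thesis
  proof (rule unital_star_algebra.intro; unfold direct_sum_simps)
    show "(\<lambda>i\<in>I. \<zero>\<^bsub>A i\<^esub>) \<in> (\<Pi>\<^sub>E i\<in>I. carrier (A i))" "(\<lambda>i\<in>I. \<one>\<^bsub>A i\<^esub>) \<in> (\<Pi>\<^sub>E i\<in>I. carrier (A i))"
      using D(1,2) by auto
    fix x assume x: "x \<in> (\<Pi>\<^sub>E i\<in>I. carrier (A i))"
    have xi: "x i \<in> carrier (A i)" if "i \<in> I" for i using x that by auto
    show "(\<lambda>i\<in>I. star (A i) (x i)) \<in> (\<Pi>\<^sub>E i\<in>I. carrier (A i))"
      "(\<lambda>i\<in>I. c \<odot>\<^bsub>A i\<^esub> x i) \<in> (\<Pi>\<^sub>E i\<in>I. carrier (A i))" for c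
      using D(5,6) xi by auto
    show "(\<lambda>i\<in>I. (\<lambda>i\<in>I. \<zero>\<^bsub>A i\<^esub>) i \<oplus>\<^bsub>A i\<^esub> x i) = x" "(\<lambda>i\<in>I. (\<lambda>i\<in>I. \<one>\<^bsub>A i\<^esub>) i \<otimes>\<^bsub>A i\<^esub> x i) = x"
      "(\<lambda>i\<in>I. x i \<otimes>\<^bsub>A i\<^esub> (\<lambda>i\<in>I. \<one>\<^bsub>A i\<^esub>) i) = x" "(\<lambda>i\<in>I. 1 \<odot>\<^bsub>A i\<^esub> x i) = x"
      "(\<lambda>i\<in>I. star (A i) ((\<lambda>i\<in>I. star (A i) (x i)) i)) = x"
      by (rule ext[OF x], simp add: D(9,12,13,19,22) xi)+
    show "(\<lambda>i\<in>I. (\<lambda>i\<in>I. - 1 \<odot>\<^bsub>A i\<^esub> x i) i \<oplus>\<^bsub>A i\<^esub> x i) = (\<lambda>i\<in>I. \<zero>\<^bsub>A i\<^esub>)"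
      by (rule restrict_ext) (simp add: D(10) xi)
    fix a b
    show "(\<lambda>i\<in>I. (a + b) \<odot>\<^bsub>A i\<^esub> x i) = (\<lambda>i\<in>I. (\<lambda>i\<in>I. a \<odot>\<^bsub>A i\<^esub> x i) i \<oplus>\<^bsub>A i\<^esub> (\<lambda>i\<in>I. b \<odot>\<^bsub>A i\<^esub> x i) i)"
      "(\<lambda>i\<in>I. (a * b) \<odot>\<^bsub>A i\<^esub> x i) = (\<lambda>i\<in>I. a \<odot>\<^bsub>A i\<^esub> (\<lambda>i\<in>I. b \<odot>\<^bsub>A i\<^esub> x i) i)"
      "(\<lambda>i\<in>I. star (A i) ((\<lambda>i\<in>I. a \<odot>\<^bsub>A i\<^esub> x i) i)) = (\<lambda>i\<in>I. cnj a \<odot>\<^bsub>A i\<^esub> (\<lambda>i\<in>I. star (A i) (x i)) i)"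
      by (rule restrict_ext, simp add: D(16,18,25) xi)+
    fix y assume y: "y \<in> (\<Pi>\<^sub>E i\<in>I. carrier (A i))"
    have yi: "y i \<in> carrier (A i)" if "i \<in> I" for i using y that by auto
    show "(\<lambda>i\<in>I. x i \<oplus>\<^bsub>A i\<^esub> y i) \<in> (\<Pi>\<^sub>E i\<in>I. carrier (A i))"
      "(\<lambda>i\<in>I. x i \<otimes>\<^bsub>A i\<^esub> y i) \<in> (\<Pi>\<^sub>E i\<in>I. carrier (A i))"
      using D(3,4) xi yi by auto
    show "(\<lambda>i\<in>I. x i \<oplus>\<^bsub>A i\<^esub> y i) = (\<lambda>i\<in>I. y i \<oplus>\<^bsub>A i\<^esub> x i)"
      by (rule restrict_ext) (rule D(8)[OF _ xi yi])
    show "(\<lambda>i\<in>I. a \<odot>\<^bsub>A i\<^esub> (\<lambda>i\<in>I. x i \<oplus>\<^bsub>A i\<^esub> y i) i) =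
        (\<lambda>i\<in>I. (\<lambda>i\<in>I. a \<odot>\<^bsub>A i\<^esub> x i) i \<oplus>\<^bsub>A i\<^esub> (\<lambda>i\<in>I. a \<odot>\<^bsub>A i\<^esub> y i) i)"
      "(\<lambda>i\<in>I. (\<lambda>i\<in>I. a \<odot>\<^bsub>A i\<^esub> x i) i \<otimes>\<^bsub>A i\<^esub> y i) = (\<lambda>i\<in>I. a \<odot>\<^bsub>A i\<^esub> (\<lambda>i\<in>I. x i \<otimes>\<^bsub>A i\<^esub> y i) i)"
      "(\<lambda>i\<in>I. x i \<otimes>\<^bsub>A i\<^esub> (\<lambda>i\<in>I. a \<odot>\<^bsub>A i\<^esub> y i) i) = (\<lambda>i\<in>I. a \<odot>\<^bsub>A i\<^esub> (\<lambda>i\<in>I. x i \<otimes>\<^bsub>A i\<^esub> y i) i)"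
      "(\<lambda>i\<in>I. star (A i) ((\<lambda>i\<in>I. x i \<oplus>\<^bsub>A i\<^esub> y i) i)) =
        (\<lambda>i\<in>I. (\<lambda>i\<in>I. star (A i) (x i)) i \<oplus>\<^bsub>A i\<^esub> (\<lambda>i\<in>I. star (A i) (y i)) i)"
      "(\<lambda>i\<in>I. star (A i) ((\<lambda>i\<in>I. x i \<otimes>\<^bsub>A i\<^esub> y i) i)) =
        (\<lambda>i\<in>I. (\<lambda>i\<in>I. star (A i) (y i)) i \<otimes>\<^bsub>A i\<^esub> (\<lambda>i\<in>I. star (A i) (x i)) i)"
      by (rule restrict_ext, simp add: D(17,20,21,23,24) xi yi)+
    fix z assume z: "z \<in> (\<Pi>\<^sub>E i\<in>I. carrier (A i))"
    have zi: "z i \<in> carrier (A i)" if "i \<in> I" for i using z that by auto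
    show "(\<lambda>i\<in>I. (\<lambda>i\<in>I. x i \<oplus>\<^bsub>A i\<^esub> y i) i \<oplus>\<^bsub>A i\<^esub> z i) = (\<lambda>i\<in>I. x i \<oplus>\<^bsub>A i\<^esub> (\<lambda>i\<in>I. y i \<oplus>\<^bsub>A i\<^esub> z i) i)"
      "(\<lambda>i\<in>I. (\<lambda>i\<in>I. x i \<otimes>\<^bsub>A i\<^esub> y i) i \<otimes>\<^bsub>A i\<^esub> z i) = (\<lambda>i\<in>I. x i \<otimes>\<^bsub>A i\<^esub> (\<lambda>i\<in>I. y i \<otimes>\<^bsub>A i\<^esub> z i) i)"
      "(\<lambda>i\<in>I. (\<lambda>i\<in>I. x i \<oplus>\<^bsub>A i\<^esub> y i) i \<otimes>\<^bsub>A i\<^esub> z i) =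
        (\<lambda>i\<in>I. (\<lambda>i\<in>I. x i \<otimes>\<^bsub>A i\<^esub> z i) i \<oplus>\<^bsub>A i\<^esub> (\<lambda>i\<in>I. y i \<otimes>\<^bsub>A i\<^esub> z i) i)"
      "(\<lambda>i\<in>I. z i \<otimes>\<^bsub>A i\<^esub> (\<lambda>i\<in>I. x i \<oplus>\<^bsub>A i\<^esub> y i) i) =
        (\<lambda>i\<in>I. (\<lambda>i\<in>I. z i \<otimes>\<^bsub>A i\<^esub> x i) i \<oplus>\<^bsub>A i\<^esub> (\<lambda>i\<in>I. z i \<otimes>\<^bsub>A i\<^esub> y i) i)"
      by (rule restrict_ext, simp add: D(7,11,14,15) xi yi zi)+
  qed
qed

lemma star_hom_direct_sumI:
  assumes "\<And>i. i \<in> I \<Longrightarrow> (\<lambda>x. g x i) \<in> star_hom C (A i)"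
  shows "(\<lambda>x. \<lambda>i\<in>I. g x i) \<in> star_hom C (direct_sum I A)"
  unfolding star_hom_iff direct_sum_simps
  by (intro conjI ballI allI restrict_PiE_iff[THEN iffD2] restrict_ext)
    (simp_all add: star_homD[OF assms])

abbreviation matrix_sum :: "nat \<Rightarrow> (nat \<Rightarrow> nat) \<Rightarrow> (nat \<Rightarrow> complex mat) star_algebra" where
  "matrix_sum K r \<equiv> direct_sum {..<K} (\<lambda>i. matrix_algebra (r i))"

lemma star_subalgebra_image:
  assumes A: "unital_star_algebra A" and \<pi>: "\<pi> \<in> star_hom A (matrix_algebra n)"
  shows "star_subalgebra n (\<pi> ` carrier A)"
proof -
  note D = unital_star_algebraD[OF A]
  note h = star_homD[OF \<pi>, unfolded matrix_algebra_simps]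
  have z: "\<pi> \<zero>\<^bsub>A\<^esub> = 0\<^sub>m n n"
    using star_hom_zero[OF A unital_star_algebra_matrix_algebra \<pi>] by simp
  show ?thesis
    unfolding star_subalgebra_def
  proof (intro conjI ballI allI)
    show "\<pi> ` carrier A \<subseteq> carrier_mat n n" using h(1) by blast
    show "0\<^sub>m n n \<in> \<pi> ` carrier A" using z D(1) by (metis imageI)
    fix X assume "X \<in> \<pi> ` carrier A"
    then obtain x where x: "x \<in> carrier A" "X = \<pi> x" by blast
    show "c \<cdot>\<^sub>m X \<in> \<pi> ` carrier A" for c using h(4)[OF x(1)] D(5)[OF x(1)] x(2) by (metis imageI)
    show "X\<dagger> \<in> \<pi> ` carrier A" using h(5)[OF x(1)] D(6)[OF x(1)] x(2) by (metis imageI)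
    fix Y assume "Y \<in> \<pi> ` carrier A"
    then obtain y where y: "y \<in> carrier A" "Y = \<pi> y" by blast
    show "X + Y \<in> \<pi> ` carrier A" using h(2)[OF x(1) y(1)] D(3)[OF x(1) y(1)] x(2) y(2) by (metis imageI)
    show "X * Y \<in> \<pi> ` carrier A" using h(3)[OF x(1) y(1)] D(4)[OF x(1) y(1)] x(2) y(2) by (metis imageI)
  qed
qed

text \<open>The isomorphism compresses a representing matrix to the irreducible blocks of the
  represented algebra.\<close>

theorem star_isomorphic_direct_sum_of_matrix_algebras:
  assumes A: "unital_star_algebra A" and \<pi>: "\<pi> \<in> star_hom A (matrix_algebra n)" "inj_on \<pi> (carrier A)"
  shows "\<exists>(K :: nat) d. (\<forall>c<K. 0 < d c) \<and> star_isomorphic A (matrix_sum K d)"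
proof -
  note D = unital_star_algebraD[OF A]
  note h = star_homD[OF \<pi>(1), unfolded matrix_algebra_simps]
  obtain K d U where "block_decomposition n (\<pi> ` carrier A) K d U"
    using block_decomposition_exists[OF star_subalgebra_image[OF A \<pi>(1)]] by blast
  then have d: "\<And>c. c < K \<Longrightarrow> 0 < d c" and U: "\<And>c. c < K \<Longrightarrow> U c \<in> carrier_mat n (d c)"
    and inv: "\<And>c x. c < K \<Longrightarrow> x \<in> carrier A \<Longrightarrow> \<pi> x * U c = U c * ((U c)\<dagger> * (\<pi> x * U c))"
    and inj: "\<And>x. x \<in> carrier A \<Longrightarrow> (\<forall>c<K. \<pi> x * U c = 0\<^sub>m n (d c)) \<Longrightarrow> \<pi> x = 0\<^sub>m n n"
    and surj: "\<And>Y. \<forall>c<K. Y c \<in> carrier_mat (d c) (d c) \<Longrightarrow>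
      \<exists>x\<in>carrier A. \<forall>c<K. (U c)\<dagger> * (\<pi> x * U c) = Y c"
    unfolding block_decomposition_def by blast+
  define f where "f x = (\<lambda>c\<in>{..<K}. (U c)\<dagger> * (\<pi> x * U c))" for x
  note Ud = carrier_matD[OF U]
  have f: "f \<in> star_hom A (matrix_sum K d)"
    unfolding f_def
  proof (rule star_hom_direct_sumI, unfold star_hom_iff matrix_algebra_simps, intro conjI ballI allI)
    fix c x assume "c \<in> {..<K}" and x: "x \<in> carrier A"
    then have c: "c < K" by simp
    note \<pi>x = carrier_matD[OF h(1)[OF x]] and Ud = Ud[OF c]
    show "(U c)\<dagger> * (\<pi> x * U c) \<in> carrier_mat (d c) (d c)" using \<pi>x Ud by simp
    show "(U c)\<dagger> * (\<pi> (a \<odot>\<^bsub>A\<^esub> x) * U c) = a \<cdot>\<^sub>m ((U c)\<dagger> * (\<pi> x * U c))" for a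
      unfolding h(4)[OF x] using \<pi>x Ud by (simp add: mat_smult_mult mat_mult_smult)
    show "(U c)\<dagger> * (\<pi> (star A x) * U c) = ((U c)\<dagger> * (\<pi> x * U c))\<dagger>"
      unfolding h(5)[OF x] using \<pi>x Ud by (simp add: mat_adjoint_mult mat_assoc)
    fix y assume y: "y \<in> carrier A"
    note \<pi>y = carrier_matD[OF h(1)[OF y]]
    show "(U c)\<dagger> * (\<pi> (x \<oplus>\<^bsub>A\<^esub> y) * U c) = (U c)\<dagger> * (\<pi> x * U c) + (U c)\<dagger> * (\<pi> y * U c)"
      unfolding h(2)[OF x y] using \<pi>x \<pi>y Ud by (simp add: mat_add_mult mat_mult_add)
    \<comment> \<open>Invariance of the range of \<open>U c\<close> allows the projection
      \<open>U c * (U c)\<dagger>\<close> to be inserted between the two factors.\<close>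
    have "(U c)\<dagger> * (\<pi> x * \<pi> y * U c) = (U c)\<dagger> * (\<pi> x * (U c * ((U c)\<dagger> * (\<pi> y * U c))))"
      using inv[OF c y] \<pi>x \<pi>y Ud by (simp add: mat_assoc)
    then show "(U c)\<dagger> * (\<pi> (x \<otimes>\<^bsub>A\<^esub> y) * U c) = (U c)\<dagger> * (\<pi> x * U c) * ((U c)\<dagger> * (\<pi> y * U c))"
      unfolding h(3)[OF x y] using \<pi>x \<pi>y Ud by (simp add: mat_assoc)
  qed
  have "inj_on f (carrier A)"
  proof (rule inj_onI)
    fix x y assume x: "x \<in> carrier A" and y: "y \<in> carrier A" and eq: "f x = f y"
    note \<pi>x = carrier_matD[OF h(1)[OF x]] and \<pi>y = carrier_matD[OF h(1)[OF y]]
    define w where "w = x \<oplus>\<^bsub>A\<^esub> (- 1) \<odot>\<^bsub>A\<^esub> y"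
    have w: "w \<in> carrier A" unfolding w_def by (intro D(3,5) x y)
    have "\<pi> w = \<pi> x + (- 1) \<cdot>\<^sub>m \<pi> y" unfolding w_def h(2)[OF x D(5)[OF y]] h(4)[OF y] ..
    also have "\<dots> = \<pi> x - \<pi> y" using \<pi>x \<pi>y by (intro eq_matI) auto
    finally have \<pi>w: "\<pi> w = \<pi> x - \<pi> y" .
    have "\<pi> w * U c = 0\<^sub>m n (d c)" if c: "c < K" for c
    proof -
      have "(U c)\<dagger> * (\<pi> x * U c) = (U c)\<dagger> * (\<pi> y * U c)"
        using fun_cong[OF eq, of c] c by (simp add: f_def)
      then have "\<pi> x * U c = \<pi> y * U c" using inv[OF c x] inv[OF c y] by simp
      then show ?thesis unfolding \<pi>w using \<pi>x \<pi>y Ud[OF c] by (simp add: mat_minus_mult)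
    qed
    then have "\<pi> x - \<pi> y = 0\<^sub>m n n" using inj[OF w] \<pi>w by simp
    then have "\<pi> x = \<pi> y" using mat_diff_eq_0_iff[OF h(1)[OF x] h(1)[OF y]] by simp
    then show "x = y" using \<pi>(2) x y by (auto dest: inj_onD)
  qed
  moreover have "f ` carrier A = (\<Pi>\<^sub>E i\<in>{..<K}. carrier_mat (d i) (d i))"
  proof
    show "f ` carrier A \<subseteq> (\<Pi>\<^sub>E i\<in>{..<K}. carrier_mat (d i) (d i))"
      using star_homD(1)[OF f] by auto
    show "(\<Pi>\<^sub>E i\<in>{..<K}. carrier_mat (d i) (d i)) \<subseteq> f ` carrier A"
    proof
      fix Y :: "nat \<Rightarrow> complex mat" assume Y: "Y \<in> (\<Pi>\<^sub>E i\<in>{..<K}. carrier_mat (d i) (d i))"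
      then have "\<forall>c<K. Y c \<in> carrier_mat (d c) (d c)" by auto
      from surj[OF this] obtain x where x: "x \<in> carrier A" "\<forall>c<K. (U c)\<dagger> * (\<pi> x * U c) = Y c" by blast
      have "f x = Y"
        unfolding f_def using x Y by (intro extensionalityI[of _ "{..<K}"]) (auto simp: PiE_def)
      then show "Y \<in> f ` carrier A" using x(1) by blast
    qed
  qed
  ultimately have "bij_betw f (carrier A) (carrier (matrix_sum K d))"
    by (simp add: bij_betw_def)
  from this f have iso: "star_isomorphic A (matrix_sum K d)"
    unfolding star_isomorphic_def by (rule bexI)
  show ?thesis by (rule exI[of _ K], rule exI[of _ d]) (simp add: d iso)
qed

text \<open>The structure theorem numbers the summands, whereas \<open>capacity_algebra\<close>
  indexes them by size and position.\<close>

lemma star_isomorphic_direct_sum_reindex: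
  assumes \<beta>: "bij_betw \<beta> I J" and eq: "\<And>i. i \<in> I \<Longrightarrow> A i = B (\<beta> i)"
  shows "star_isomorphic (direct_sum J B) (direct_sum I A)"
proof -
  have \<beta>J: "\<beta> i \<in> J" if "i \<in> I" for i using \<beta> that by (auto simp: bij_betw_def)
  define f where "f x = (\<lambda>i\<in>I. x (\<beta> i))" for x :: "'b \<Rightarrow> 'c"
  have "f \<in> star_hom (direct_sum J B) (direct_sum I A)"
    unfolding star_hom_iff direct_sum_simps
    using \<beta>J eq by (auto simp: f_def restrict_def fun_eq_iff)
  moreover have "bij_betw f (\<Pi>\<^sub>E j\<in>J. carrier (B j)) (\<Pi>\<^sub>E i\<in>I. carrier (A i))"
  proof (rule bij_betw_byWitness[where f' = "\<lambda>y. \<lambda>j\<in>J. y (inv_into I \<beta> j)"])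
    have inv: "inv_into I \<beta> (\<beta> i) = i" if "i \<in> I" for i
      using \<beta> that by (simp add: bij_betw_def inv_into_f_f)
    have inv': "inv_into I \<beta> j \<in> I" "\<beta> (inv_into I \<beta> j) = j" if "j \<in> J" for j
      using \<beta> that by (auto simp: bij_betw_def inv_into_into f_inv_into_f)
    show "\<forall>x\<in>\<Pi>\<^sub>E j\<in>J. carrier (B j). (\<lambda>j\<in>J. f x (inv_into I \<beta> j)) = x"
      using inv' by (auto simp: f_def fun_eq_iff PiE_def extensional_def)
    show "\<forall>y\<in>\<Pi>\<^sub>E i\<in>I. carrier (A i). f (\<lambda>j\<in>J. y (inv_into I \<beta> j)) = y"
      using inv \<beta>J by (auto simp: f_def fun_eq_iff PiE_def extensional_def)
    show "f ` (\<Pi>\<^sub>E j\<in>J. carrier (B j)) \<subseteq> (\<Pi>\<^sub>E i\<in>I. carrier (A i))"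
      using \<beta>J eq by (auto simp: f_def)
    show "(\<lambda>y. \<lambda>j\<in>J. y (inv_into I \<beta> j)) ` (\<Pi>\<^sub>E i\<in>I. carrier (A i)) \<subseteq> (\<Pi>\<^sub>E j\<in>J. carrier (B j))"
    proof clarify
      fix y assume y: "y \<in> (\<Pi>\<^sub>E i\<in>I. carrier (A i))"
      have "y (inv_into I \<beta> j) \<in> carrier (B j)" if "j \<in> J" for j
        using PiE_mem[OF y inv'(1)[OF that]] inv'(2)[OF that] eq[OF inv'(1)[OF that]] by simp
      then show "(\<lambda>j\<in>J. y (inv_into I \<beta> j)) \<in> (\<Pi>\<^sub>E j\<in>J. carrier (B j))" by simp
    qed
  qed
  ultimately show ?thesis unfolding star_isomorphic_def by auto
qed

section \<open>Embeddings of powers of a matrix algebra\<close>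

lemma msum_add:
  assumes "\<And>x. x \<in> I \<Longrightarrow> F x \<in> carrier_mat n m" "\<And>x. x \<in> I \<Longrightarrow> G x \<in> carrier_mat n m"
  shows "msum n m I (\<lambda>x. F x + G x) = msum n m I F + msum n m I G"
proof (rule eq_matI)
  fix i j assume "i < dim_row (msum n m I F + msum n m I G)" "j < dim_col (msum n m I F + msum n m I G)"
  then show "msum n m I (\<lambda>x. F x + G x) $$ (i, j) = (msum n m I F + msum n m I G) $$ (i, j)"
    using carrier_matD[OF assms(1)] carrier_matD[OF assms(2)] by (simp add: sum.distrib)
qed auto

lemma msum_smult:
  assumes "\<And>x. x \<in> I \<Longrightarrow> F x \<in> carrier_mat n m"
  shows "msum n m I (\<lambda>x. c \<cdot>\<^sub>m F x) = c \<cdot>\<^sub>m msum n m I F"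
proof (rule eq_matI)
  fix i j assume "i < dim_row (c \<cdot>\<^sub>m msum n m I F)" "j < dim_col (c \<cdot>\<^sub>m msum n m I F)"
  then show "msum n m I (\<lambda>x. c \<cdot>\<^sub>m F x) $$ (i, j) = (c \<cdot>\<^sub>m msum n m I F) $$ (i, j)"
    using carrier_matD[OF assms] by (simp add: sum_distrib_left)
qed auto

text \<open>Summand \<open>j\<close> is placed by \<open>V j\<close> at the \<open>b j\<close>-th diagonal \<open>d \<times> d\<close> block of summand \<open>\<iota> j\<close>.\<close>

lemma matrix_power_embeds:
  fixes c d K :: nat
  assumes c: "c \<le> (\<Sum>i<K. r i div d)"
  shows "embeds (matrix_sum c (\<lambda>_. d)) (matrix_sum K r)"
proof -
  \<comment> \<open>The pairs \<open>(i, b)\<close> with \<open>b < r i div d\<close> are the free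
    diagonal blocks; there are at least \<open>c\<close> of them, so \<open>h\<close> can give each
    copy a block of its own.\<close>
  have "card {..<c} \<le> card (SIGMA i:{..<K}. {..<r i div d})" using c by (subst card_SigmaI) auto
  then obtain h where h: "h ` {..<c} \<subseteq> (SIGMA i:{..<K}. {..<r i div d})" "inj_on h {..<c}"
    using card_le_inj[of "{..<c}" "SIGMA i:{..<K}. {..<r i div d}"] by auto
  define \<iota> b where "\<iota> j = fst (h j)" and "b j = snd (h j)" for j
  have \<iota>: "\<iota> j < K" "b j < r (\<iota> j) div d" if "j < c" for j
    using h(1) that unfolding \<iota>_def b_def by (force dest: subsetD[of _ _ "h j"])+
  have le: "b j * d + t < r (\<iota> j)" if "j < c" "t < d" for j t
  proof -
    have "b j * d + t < (b j + 1) * d" using that(2) by simp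
    also have "\<dots> \<le> r (\<iota> j) div d * d" using \<iota>(2)[OF that(1)] by (intro mult_right_mono) auto
    also have "\<dots> \<le> r (\<iota> j)" by simp
    finally show ?thesis .
  qed
  define V where "V j = mat (r (\<iota> j)) d (\<lambda>(p, t). if p = b j * d + t then 1 else 0 :: complex)" for j
  define J where "J i = {j. j < c \<and> \<iota> j = i}" for i
  have fin: "finite (J i)" for i unfolding J_def by simp
  have V: "V j \<in> carrier_mat (r i) d" "j < c" if "j \<in> J i" for i j using that by (auto simp: V_def J_def)
  note Vd = carrier_matD[OF V(1)]
  have VV: "(V j)\<dagger> * V j' = (if j = j' then 1\<^sub>m d else 0\<^sub>m d d)" if jj: "j \<in> J i" "j' \<in> J i" for i j j'
  proof (rule eq_matI)
    fix s t
    assume "s < dim_row (if j = j' then 1\<^sub>m d else 0\<^sub>m d d :: complex mat)"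
      "t < dim_col (if j = j' then 1\<^sub>m d else 0\<^sub>m d d :: complex mat)"
    then have st: "s < d" "t < d" by (auto split: if_splits)
    have i: "\<iota> j = i" "\<iota> j' = i" "j < c" "j' < c" using jj by (auto simp: J_def)
    have "((V j)\<dagger> * V j') $$ (s, t) = (\<Sum>p<r i. cnj (V j $$ (p, s)) * V j' $$ (p, t))"
      using st Vd[OF jj(1)] Vd[OF jj(2)] by (subst mat_mult_index) auto
    also have "\<dots> = (\<Sum>p<r i. if p = b j * d + s then (if b j * d + s = b j' * d + t then 1 else 0) else 0)"
      using st i by (intro sum.cong) (auto simp: V_def)
    also have "\<dots> = (if b j * d + s = b j' * d + t then 1 else 0)"
      using le[OF i(3) st(1)] i(1) by simp
    also have "\<dots> = (if j = j' \<and> s = t then 1 else 0)"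
    proof -
      have "b j = b j' \<and> s = t" if "b j * d + s = b j' * d + t"
        using that st by (metis add.commute div_mult_self3 div_less mod_mult_self3 mod_less add_0 less_nat_zero_code)
      moreover have "j = j'" if "b j = b j'"
      proof -
        have "h j = h j'" using that i(1,2) unfolding \<iota>_def b_def by (simp add: prod_eq_iff)
        then show ?thesis using h(2) i(3,4) by (auto dest: inj_onD)
      qed
      ultimately show ?thesis by auto
    qed
    finally show "((V j)\<dagger> * V j') $$ (s, t) = (if j = j' then 1\<^sub>m d else 0\<^sub>m d d) $$ (s, t)"
      using st by simp
  qed (use Vd[OF jj(1)] Vd[OF jj(2)] in auto)
  let ?C = "matrix_sum c (\<lambda>_. d)"
  define g where "g x i = msum (r i) (r i) (J i) (\<lambda>j. V j * (x j * (V j)\<dagger>))" for x i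
  have xd: "dim_row (x j) = d" "dim_col (x j) = d" if "x \<in> carrier ?C" "j \<in> J i" for x j i
    using that by (auto simp: J_def PiE_def Pi_def)
  have summand: "V j * (x j * (V j)\<dagger>) \<in> carrier_mat (r i) (r i)" if "j \<in> J i" for x j i
    using Vd[OF that] by simp
  \<comment> \<open>On the range of \<open>V j\<close> the image acts as \<open>x j\<close>. Both
    multiplicativity and injectivity are read off from this.\<close>
  have gV: "g x i * V j = V j * x j" if x: "x \<in> carrier ?C" and j: "j \<in> J i" for x i j
  proof -
    have "g x i * V j = msum (r i) d (J i) (\<lambda>l. V l * (x l * (V l)\<dagger>) * V j)"
      unfolding g_def using V(1)[OF j] summand by (rule msum_mult)
    also have "\<dots> = msum (r i) d (J i) (\<lambda>l. if l = j then V l * x l else 0\<^sub>m (r i) d)"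
    proof (rule msum_cong)
      fix l assume l: "l \<in> J i"
      have "V l * (x l * (V l)\<dagger>) * V j = V l * (x l * ((V l)\<dagger> * V j))"
        using Vd[OF l] Vd[OF j] xd[OF x l] by (simp add: mat_assoc)
      then show "V l * (x l * (V l)\<dagger>) * V j = (if l = j then V l * x l else 0\<^sub>m (r i) d)"
        using Vd[OF l] xd[OF x l] Vd[OF j] xd[OF x j] by (simp add: VV[OF l j])
    qed
    also have "\<dots> = V j * x j" using fin j Vd[OF j] xd[OF x j] by (intro msum_delta) auto
    finally show ?thesis .
  qed
  define f where "f x = (\<lambda>i\<in>{..<K}. g x i)" for x
  have f: "f \<in> star_hom ?C (matrix_sum K r)"
    unfolding f_def
  proof (rule star_hom_direct_sumI, unfold star_hom_iff matrix_algebra_simps, intro conjI ballI allI)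
    fix i x assume i: "i \<in> {..<K}" and x: "x \<in> carrier ?C"
    show gx: "g x i \<in> carrier_mat (r i) (r i)" by (simp add: g_def)
    show "g (a \<odot>\<^bsub>?C\<^esub> x) i = a \<cdot>\<^sub>m g x i" for a
    proof -
      have "g (a \<odot>\<^bsub>?C\<^esub> x) i = msum (r i) (r i) (J i) (\<lambda>j. a \<cdot>\<^sub>m (V j * (x j * (V j)\<dagger>)))"
        unfolding g_def
      proof (rule msum_cong)
        fix j assume j: "j \<in> J i"
        show "V j * ((a \<odot>\<^bsub>?C\<^esub> x) j * (V j)\<dagger>) = a \<cdot>\<^sub>m (V j * (x j * (V j)\<dagger>))"
          using V(2)[OF j] Vd[OF j] xd[OF x j] by (simp add: mat_smult_mult mat_mult_smult)
      qed
      also have "\<dots> = a \<cdot>\<^sub>m g x i" unfolding g_def by (rule msum_smult[OF summand])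
      finally show ?thesis .
    qed
    show "g (star ?C x) i = (g x i)\<dagger>"
    proof -
      have "(g x i)\<dagger> = msum (r i) (r i) (J i) (\<lambda>j. (V j * (x j * (V j)\<dagger>))\<dagger>)"
        unfolding g_def by (rule mat_adjoint_msum[OF summand])
      also have "\<dots> = g (star ?C x) i"
        unfolding g_def
      proof (rule msum_cong)
        fix j assume j: "j \<in> J i"
        show "(V j * (x j * (V j)\<dagger>))\<dagger> = V j * (star ?C x j * (V j)\<dagger>)"
          using V(2)[OF j] Vd[OF j] xd[OF x j] by (simp add: mat_adjoint_mult mat_assoc)
      qed
      finally show ?thesis by simp
    qed
    fix y assume y: "y \<in> carrier ?C"
    show "g (x \<oplus>\<^bsub>?C\<^esub> y) i = g x i + g y i"
    proof -
      have "g (x \<oplus>\<^bsub>?C\<^esub> y) i = msum (r i) (r i) (J i)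
          (\<lambda>j. V j * (x j * (V j)\<dagger>) + V j * (y j * (V j)\<dagger>))"
        unfolding g_def
      proof (rule msum_cong)
        fix j assume j: "j \<in> J i"
        show "V j * ((x \<oplus>\<^bsub>?C\<^esub> y) j * (V j)\<dagger>) = V j * (x j * (V j)\<dagger>) + V j * (y j * (V j)\<dagger>)"
          using V(2)[OF j] Vd[OF j] xd[OF x j] xd[OF y j] by (simp add: mat_add_mult mat_mult_add)
      qed
      also have "\<dots> = g x i + g y i" unfolding g_def by (rule msum_add[OF summand summand])
      finally show ?thesis .
    qed
    have "g x i * g y i = msum (r i) (r i) (J i) (\<lambda>j. g x i * (V j * (y j * (V j)\<dagger>)))"
      unfolding g_def[of y] by (rule mult_msum[OF gx summand])
    also have "\<dots> = g (x \<otimes>\<^bsub>?C\<^esub> y) i"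
      unfolding g_def[of "x \<otimes>\<^bsub>?C\<^esub> y"]
    proof (rule msum_cong)
      fix j assume j: "j \<in> J i"
      have "g x i * (V j * (y j * (V j)\<dagger>)) = V j * x j * (y j * (V j)\<dagger>)"
        using Vd[OF j] xd[OF y j] gx by (simp add: mat_mult_cong_assoc[OF gV[OF x j]])
      then show "g x i * (V j * (y j * (V j)\<dagger>)) = V j * ((x \<otimes>\<^bsub>?C\<^esub> y) j * (V j)\<dagger>)"
        using V(2)[OF j] Vd[OF j] xd[OF x j] xd[OF y j] by (simp add: mat_assoc)
    qed
    finally show "g (x \<otimes>\<^bsub>?C\<^esub> y) i = g x i * g y i" by simp
  qed
  have "inj_on f (carrier ?C)"
  proof (rule inj_onI)
    fix x y assume x: "x \<in> carrier ?C" and y: "y \<in> carrier ?C" and eq: "f x = f y"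
    show "x = y"
    proof (rule extensionalityI[of _ "{..<c}"])
      fix j assume "j \<in> {..<c}"
      then have j: "j \<in> J (\<iota> j)" "\<iota> j < K" using \<iota>(1) by (auto simp: J_def)
      have "g x (\<iota> j) = g y (\<iota> j)" using fun_cong[OF eq, of "\<iota> j"] j(2) by (simp add: f_def)
      then have "V j * x j = V j * y j" using gV[OF x j(1)] gV[OF y j(1)] by simp
      then have "(V j)\<dagger> * (V j * x j) = (V j)\<dagger> * (V j * y j)" by simp
      then show "x j = y j"
        using VV[OF j(1) j(1)] Vd[OF j(1)] xd[OF x j(1)] xd[OF y j(1)]
        by (simp add: mat_mult_cong_assoc[OF VV[OF j(1) j(1)]])
    qed (use x y in \<open>auto simp: PiE_def\<close>)
  qed
  then show ?thesis unfolding embeds_def using f by blast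
qed

text \<open>Each copy \<open>j\<close> is nonzero in some target summand, and there all
  \<open>d\<close> diagonal matrix units of the copy survive. The copies assigned to summand
  \<open>i\<close> thus yield \<open>card (J i) * d\<close> orthogonal nonzero matrices of size
  \<open>r i\<close>.\<close>

lemma matrix_power_embeds_imp_le:
  fixes c d K :: nat
  assumes d: "0 < d"
    and emb: "embeds (matrix_sum c (\<lambda>_. d)) (matrix_sum K r)"
  shows "c \<le> (\<Sum>i<K. r i div d)"
proof -
  let ?C = "matrix_sum c (\<lambda>_. d)" and ?D = "matrix_sum K r"
  obtain f where f: "f \<in> star_hom ?C ?D" "inj_on f (carrier ?C)" using emb unfolding embeds_def by blast
  note h = star_homD[OF f(1)]
  have uC: "unital_star_algebra ?C" and uD: "unital_star_algebra ?D"
    by (intro unital_star_algebra_direct_sum unital_star_algebra_matrix_algebra)+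
  define e where "e k l = mat d d (\<lambda>(a, b). if a = k \<and> b = l then 1 else 0 :: complex)" for k l
  have ec: "e k l \<in> carrier_mat d d" for k l by (simp add: e_def)
  have ee: "e k l * e l' q = (if l = l' then e k q else 0\<^sub>m d d)" if "l < d" for k l l' q
  proof (rule eq_matI, goal_cases)
    case (1 a b)
    then have ab: "a < d" "b < d" using ec by (auto split: if_splits simp: e_def)
    have "(e k l * e l' q) $$ (a, b) = (\<Sum>s<d. e k l $$ (a, s) * e l' q $$ (s, b))"
      using ab ec[of k l] ec[of l' q] by (subst mat_mult_index) auto
    also have "\<dots> = (\<Sum>s<d. if s = l then (if a = k \<and> l = l' \<and> b = q then 1 else 0) else 0)"
      using ab by (intro sum.cong) (auto simp: e_def)
    finally show ?case using ab that by (simp add: e_def)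
  qed (auto simp: e_def split: if_splits)
  have ea: "(e k l)\<dagger> = e l k" for k l by (rule eq_matI) (auto simp: e_def)
  define E where "E j k l = (\<lambda>i\<in>{..<c}. if i = j then e k l else 0\<^sub>m d d)" for j k l
  have EC: "E j k l \<in> carrier ?C" for j k l using ec by (auto simp: E_def)
  have EE: "E j k l \<otimes>\<^bsub>?C\<^esub> E j' l' q = (if j = j' \<and> l = l' then E j k q else \<zero>\<^bsub>?C\<^esub>)"
    if "l < d" for j j' k l l' q
    using ec that by (auto simp: E_def ee fun_eq_iff carrier_matD[OF ec])
  have Ea: "star ?C (E j k l) = E j l k" for j k l by (auto simp: E_def ea fun_eq_iff)
  have f0: "f \<zero>\<^bsub>?C\<^esub> = \<zero>\<^bsub>?D\<^esub>" by (rule star_hom_zero[OF uC uD f(1)])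
  have FD: "f (E j k l) i \<in> carrier_mat (r i) (r i)" if "i < K" for j k l i
    using h(1)[OF EC[of j k l]] that by auto
  have FF: "f (E j k l) i * f (E j' l' q) i = (if j = j' \<and> l = l' then f (E j k q) i else 0\<^sub>m (r i) (r i))"
    if "l < d" "i < K" for j j' k l l' q i
    using fun_cong[OF h(3)[OF EC[of j k l] EC[of j' l' q]], of i] that f0 unfolding EE[OF that(1)]
    by (auto split: if_splits)
  have Fa: "(f (E j k l) i)\<dagger> = f (E j l k) i" if "i < K" for j k l i
    using fun_cong[OF h(5)[OF EC[of j k l]], of i] that unfolding Ea by simp
  have "\<exists>i<K. f (E j 0 0) i \<noteq> 0\<^sub>m (r i) (r i)" if j: "j < c" for j
  proof (rule ccontr)
    assume "\<not> ?thesis"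
    then have "f (E j 0 0) = \<zero>\<^bsub>?D\<^esub>"
      using h(1)[OF EC[of j 0 0]] by (intro extensionalityI[of _ "{..<K}"]) (auto simp: PiE_def)
    then have "E j 0 0 = \<zero>\<^bsub>?C\<^esub>"
      using f0 inj_onD[OF f(2) _ EC unital_star_algebraD(1)[OF uC]] by metis
    then have "e 0 0 = 0\<^sub>m d d" using j by (auto simp: E_def dest: fun_cong[of _ _ j])
    then have "e 0 0 $$ (0, 0) = 0" using d by simp
    then show False using d by (simp add: e_def)
  qed
  then obtain \<iota> where \<iota>: "\<And>j. j < c \<Longrightarrow> \<iota> j < K" "\<And>j. j < c \<Longrightarrow> f (E j 0 0) (\<iota> j) \<noteq> 0\<^sub>m (r (\<iota> j)) (r (\<iota> j))"
    by metis
  \<comment> \<open>A copy may be nonzero in several summands; it is counted only in the chosen one,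
    so the sets \<open>J i\<close> partition the copies.\<close>
  define J where "J i = {j. j < c \<and> \<iota> j = i}" for i
  have "card (J i) \<le> r i div d" if i: "i < K" for i
  proof -
    have "card (J i \<times> {..<d}) \<le> r i"
    proof (rule orthogonal_family_card_le[where f = "\<lambda>(j, k). f (E j k k) i"])
      show "finite (J i \<times> {..<d})" by (simp add: J_def)
      fix p assume "p \<in> J i \<times> {..<d}"
      then obtain j k where p: "p = (j, k)" "j < c" "\<iota> j = i" "k < d" by (auto simp: J_def)
      show "(case p of (j, k) \<Rightarrow> f (E j k k) i) \<in> carrier_mat (r i) (r i)" using FD[OF i] p by simp
      show "(case p of (j, k) \<Rightarrow> f (E j k k) i) \<noteq> 0\<^sub>m (r i) (r i)"
      proof
        assume "(case p of (j, k) \<Rightarrow> f (E j k k) i) = 0\<^sub>m (r i) (r i)"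
        then have 0: "f (E j k k) i = 0\<^sub>m (r i) (r i)" using p by simp
        \<comment> \<open>The diagonal units are equivalent: \<open>E j 0 0\<close> factors through
          \<open>E j k k\<close>, so its component would vanish too.\<close>
        have "f (E j 0 0) i = f (E j 0 k) i * f (E j k 0) i" using FF[OF p(4) i, of j 0 j k 0] by simp
        also have "f (E j 0 k) i = f (E j 0 k) i * f (E j k k) i" using FF[OF p(4) i, of j 0 j k k] by simp
        also have "\<dots> = 0\<^sub>m (r i) (r i)" using 0 FD[OF i, of j 0 k] by simp
        also have "0\<^sub>m (r i) (r i) * f (E j k 0) i = 0\<^sub>m (r i) (r i)" using FD[OF i, of j k 0] by simp
        finally show False using \<iota>(2)[OF p(2)] p(3) by simp
      qed
      fix p' assume "p' \<in> J i \<times> {..<d}" "p \<noteq> p'"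
      then obtain j' k' where p': "p' = (j', k')" "k' < d" "\<not> (j = j' \<and> k = k')" using p by auto
      show "(case p of (j, k) \<Rightarrow> f (E j k k) i)\<dagger> * (case p' of (j, k) \<Rightarrow> f (E j k k) i) = 0\<^sub>m (r i) (r i)"
        using FF[OF p(4) i, of j k j' k' k'] p' p(1) by (auto simp: Fa[OF i])
    qed
    then have "card (J i) * d \<le> r i" by (simp add: card_cartesian_product)
    then show ?thesis using d by (simp add: less_eq_div_iff_mult_less_eq)
  qed
  moreover have "c = (\<Sum>i<K. card (J i))"
  proof -
    have "(\<Sum>i\<in>{..<K}. \<Sum>j | j \<in> {..<c} \<and> \<iota> j = i. 1) = (\<Sum>j\<in>{..<c}. 1 :: nat)"
      by (rule sum.group) (use \<iota>(1) in auto)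
    then show ?thesis by (simp add: J_def)
  qed
  ultimately show ?thesis by (metis (no_types, lifting) lessThan_iff sum_mono)
qed

section \<open>Channels\<close>

lemma mat_trace_mult:
  assumes "A \<in> carrier_mat n m" "B \<in> carrier_mat m n"
  shows "mat_trace (A * B) = (\<Sum>i<n. \<Sum>j<m. A $$ (i, j) * B $$ (j, i))"
proof -
  have "mat_trace (A * B) = (\<Sum>i<n. (A * B) $$ (i, i))" using assms by (simp add: mat_trace_def)
  also have "\<dots> = (\<Sum>i<n. \<Sum>j<m. A $$ (i, j) * B $$ (j, i))"
    using assms by (intro sum.cong refl, subst mat_mult_index) auto
  finally show ?thesis .
qed

lemma mat_trace_commute:
  assumes "A \<in> carrier_mat n m" "B \<in> carrier_mat m n"
  shows "mat_trace (A * B) = mat_trace (B * A)"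
  unfolding mat_trace_mult[OF assms] mat_trace_mult[OF assms(2,1)]
  by (subst sum.swap) (simp add: mult.commute)

lemma mat_trace_add:
  "A \<in> carrier_mat n n \<Longrightarrow> B \<in> carrier_mat n n \<Longrightarrow> mat_trace (A + B) = mat_trace A + mat_trace B"
  by (simp add: mat_trace_def sum.distrib)

lemma mat_trace_smult: "A \<in> carrier_mat n n \<Longrightarrow> mat_trace (c \<cdot>\<^sub>m A) = c * mat_trace A"
  by (simp add: mat_trace_def sum_distrib_left)

lemma mat_trace_msum: "mat_trace (msum n n I F) = (\<Sum>x\<in>I. mat_trace (msum n n {x} F))"
  unfolding mat_trace_def by (simp add: sum.swap[of _ I])

lemma msum_singleton [simp]: "F x \<in> carrier_mat n m \<Longrightarrow> msum n m {x} F = F x"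
  by (rule eq_matI) auto

lemma msum_lessThan_Suc_shift:
  "F 0 \<in> carrier_mat n m \<Longrightarrow> msum n m {..<Suc k} F = F 0 + msum n m {..<k} (\<lambda>j. F (Suc j))"
  by (rule eq_matI) (auto simp: sum.lessThan_Suc_shift simp del: sum.lessThan_Suc)

text \<open>Testing with the adjoint of the difference \<open>D\<close> gives the trace of
  \<open>D\<dagger> * D\<close>, the sum of the squared moduli of all entries of
  \<open>D\<close>.\<close>

lemma mat_eq_if_mat_trace_eq:
  assumes Z: "Z \<in> carrier_mat n n" "Z' \<in> carrier_mat n n"
    and eq: "\<And>X. X \<in> carrier_mat n n \<Longrightarrow> mat_trace (Z * X) = mat_trace (Z' * X)"
  shows "Z = Z'"
proof -
  define D where "D = Z - Z'"
  have D: "D \<in> carrier_mat n n" using Z by (simp add: D_def)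
  have "mat_trace (D * D\<dagger>) = mat_trace (Z * D\<dagger>) - mat_trace (Z' * D\<dagger>)"
    unfolding D_def using Z by (simp add: mat_minus_mult mat_trace_def sum_subtractf)
  then have "mat_trace (D\<dagger> * D) = 0" using eq[of "D\<dagger>"] D mat_trace_commute[of D n n "D\<dagger>"] by simp
  moreover have "mat_trace (D\<dagger> * D) = of_real (\<Sum>j<n. \<Sum>i<n. (cmod (D $$ (i, j)))\<^sup>2)"
  proof -
    have "mat_trace (D\<dagger> * D) = (\<Sum>j<n. of_real (\<Sum>i<n. (cmod (D $$ (i, j)))\<^sup>2))"
      unfolding mat_trace_def using D mat_adjoint_mult_self_index[of _ D] by (intro sum.cong) auto
    then show ?thesis by simp
  qed
  ultimately have "(\<Sum>j<n. \<Sum>i<n. (cmod (D $$ (i, j)))\<^sup>2) = 0" by (metis of_real_eq_0_iff)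
  then have "\<forall>j<n. \<forall>i<n. (cmod (D $$ (i, j)))\<^sup>2 = 0"
    by (simp add: sum_nonneg_eq_0_iff sum_nonneg)
  then have "D = 0\<^sub>m n n" using D by (intro eq_matI) auto
  then show ?thesis using mat_diff_eq_0_iff[OF Z] by (simp add: D_def)
qed

lemma module_hom_matrix_algebra_iff:
  "\<Phi> \<in> LinearCombinations.module_hom class_ring (matrix_algebra n) (matrix_algebra m) \<longleftrightarrow>
     (\<forall>X\<in>carrier_mat n n. \<Phi> X \<in> carrier_mat m m) \<and>
     (\<forall>X\<in>carrier_mat n n. \<forall>Y\<in>carrier_mat n n. \<Phi> (X + Y) = \<Phi> X + \<Phi> Y) \<and>
     (\<forall>c. \<forall>X\<in>carrier_mat n n. \<Phi> (c \<cdot>\<^sub>m X) = c \<cdot>\<^sub>m \<Phi> X)"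
  unfolding LinearCombinations.module_hom_def by auto

text \<open>Nondegeneracy of the trace pairing makes the description in \<open>adjoint_map\<close>
  unique.\<close>

lemma adjoint_map_eqI:
  assumes Z: "Z \<in> carrier_mat n n"
    and eq: "\<And>X. X \<in> carrier_mat n n \<Longrightarrow> mat_trace (Y * \<Phi> X) = mat_trace (Z * X)"
  shows "adjoint_map n m \<Phi> Y = Z"
  unfolding adjoint_map_def
proof (rule the_equality)
  fix Z' assume "Z' \<in> carrier_mat n n \<and> (\<forall>X\<in>carrier_mat n n. mat_trace (Y * \<Phi> X) = mat_trace (Z' * X))"
  then show "Z' = Z" using Z eq by (intro mat_eq_if_mat_trace_eq[of Z' n Z]) auto
qed (use Z eq in auto)

text \<open>This is the existence behind the definite description: the linear functional
  \<open>mat_trace (Y * \<Phi> X)\<close> of \<open>X\<close> is represented by the matrix of its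
  values on the matrix units, with indices transposed as the pairing
  \<open>mat_trace (Z * X)\<close> requires.\<close>

lemma adjoint_map_trace:
  assumes \<Phi>: "\<Phi> \<in> LinearCombinations.module_hom class_ring (matrix_algebra n) (matrix_algebra m)"
    and Y: "Y \<in> carrier_mat m m" and X: "X \<in> carrier_mat n n"
  shows "mat_trace (Y * \<Phi> X) = mat_trace (adjoint_map n m \<Phi> Y * X)"
proof -
  note \<Phi>' = \<Phi>[unfolded module_hom_matrix_algebra_iff]
  define g where "g X = mat_trace (Y * \<Phi> X)" for X
  have g_add: "g (X + X') = g X + g X'" if "X \<in> carrier_mat n n" "X' \<in> carrier_mat n n" for X X'
  proof -
    have c: "\<Phi> X \<in> carrier_mat m m" "\<Phi> X' \<in> carrier_mat m m" using \<Phi>' that by auto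
    then have "Y * \<Phi> (X + X') = Y * \<Phi> X + Y * \<Phi> X'" using \<Phi>' that Y carrier_matD[OF c(1)] carrier_matD[OF c(2)] by (simp add: mat_mult_add)
    then show ?thesis unfolding g_def using c Y by (simp add: mat_trace_add[of _ m])
  qed
  have g_smult: "g (c \<cdot>\<^sub>m X) = c * g X" if "X \<in> carrier_mat n n" for c X
  proof -
    have c: "\<Phi> X \<in> carrier_mat m m" using \<Phi>' that by auto
    then have "Y * \<Phi> (c \<cdot>\<^sub>m X) = c \<cdot>\<^sub>m (Y * \<Phi> X)" using \<Phi>' that Y carrier_matD[OF c] by (simp add: mat_mult_smult)
    then show ?thesis unfolding g_def using c Y by (simp add: mat_trace_smult[of _ m])
  qed
  have g_0: "g (0\<^sub>m n n) = 0"
  proof -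
    have "0 \<cdot>\<^sub>m (0\<^sub>m n n :: complex mat) = 0\<^sub>m n n" by (rule eq_matI) auto
    then show ?thesis using g_smult[of "0\<^sub>m n n" 0] by simp
  qed
  have g_msum: "g (msum n n I F) = (\<Sum>x\<in>I. g (F x))" if "finite I" "\<And>x. x \<in> I \<Longrightarrow> F x \<in> carrier_mat n n"
    for I :: "(nat \<times> nat) set" and F
    using that
  proof (induction I)
    case (insert x I)
    then show ?case by (simp add: msum_insert g_add)
  qed (simp add: g_0)
  define e where "e a b = mat n n (\<lambda>(i, j). if i = a \<and> j = b then 1 else 0 :: complex)" for a b
  have ec: "e a b \<in> carrier_mat n n" for a b by (simp add: e_def)
  define Z where "Z = mat n n (\<lambda>(i, j). g (e j i))"
  have "mat_trace (Y * \<Phi> X) = mat_trace (Z * X)" if X: "X \<in> carrier_mat n n" for X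
  proof -
    have "X = msum n n ({..<n} \<times> {..<n}) (\<lambda>(a, b). X $$ (a, b) \<cdot>\<^sub>m e a b)"
    proof (rule eq_matI, goal_cases)
      case (1 i j)
      then have ij: "i < n" "j < n" by auto
      have "(\<Sum>p\<in>{..<n} \<times> {..<n}. (case p of (a, b) \<Rightarrow> X $$ (a, b) \<cdot>\<^sub>m e a b) $$ (i, j)) =
          (\<Sum>p\<in>{..<n} \<times> {..<n}. if p = (i, j) then X $$ (i, j) else 0)"
        using ij by (intro sum.cong refl) (auto simp: e_def split: if_splits)
      also have "\<dots> = X $$ (i, j)" using ij by simp
      finally show ?case using ij by simp
    qed (use X in auto)
    then have "g X = g (msum n n ({..<n} \<times> {..<n}) (\<lambda>(a, b). X $$ (a, b) \<cdot>\<^sub>m e a b))" by simp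
    also have "\<dots> = (\<Sum>(a, b)\<in>{..<n} \<times> {..<n}. X $$ (a, b) * g (e a b))"
      by (subst g_msum) (auto intro!: sum.cong simp: ec g_smult)
    also have "\<dots> = (\<Sum>a<n. \<Sum>b<n. Z $$ (b, a) * X $$ (a, b))"
      unfolding sum.cartesian_product[symmetric] by (intro sum.cong) (auto simp: Z_def)
    also have "\<dots> = mat_trace (Z * X)"
      using X by (subst mat_trace_mult[of _ n n]) (auto simp: Z_def intro: sum.swap)
    finally show ?thesis by (simp add: g_def)
  qed
  moreover have "Z \<in> carrier_mat n n" by (simp add: Z_def)
  ultimately show ?thesis using adjoint_map_eqI[of Z n Y \<Phi> m] X by simp
qed

section \<open>Positivity and Kraus maps\<close>

text \<open>The quadratic form of the new matrix at \<open>v\<close> is that of \<open>B\<close> at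
  \<open>X *\<^sub>v v\<close>.\<close>

lemma positive_semidefinite_congruence:
  assumes B: "positive_semidefinite n B" and X: "X \<in> carrier_mat n m"
  shows "positive_semidefinite m (X\<dagger> * (B * X))"
proof -
  have Bc: "B \<in> carrier_mat n n" and pos: "\<And>v. v \<in> carrier_vec n \<Longrightarrow> 0 \<le> (B *\<^sub>v v) \<bullet>c v"
    using B by (auto simp: positive_semidefinite_def)
  have "(X\<dagger> * (B * X) *\<^sub>v v) \<bullet>c v = (B *\<^sub>v (X *\<^sub>v v)) \<bullet>c (X *\<^sub>v v)" if v: "v \<in> carrier_vec m" for v
  proof -
    define w where "w = B *\<^sub>v (X *\<^sub>v v)"
    have w: "w \<in> carrier_vec n" using Bc X v by (simp add: w_def)
    have "B * X \<in> carrier_mat n m" using X Bc by simp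
    then have "X\<dagger> * (B * X) *\<^sub>v v = X\<dagger> *\<^sub>v (B * X *\<^sub>v v)"
      by (rule assoc_mult_mat_vec[OF mat_adjoint_carrier[OF X] _ v])
    also have "B * X *\<^sub>v v = w" unfolding w_def by (rule assoc_mult_mat_vec[OF Bc X v])
    finally have "X\<dagger> * (B * X) *\<^sub>v v = X\<dagger> *\<^sub>v w" .
    moreover have "(X\<dagger> *\<^sub>v w) \<bullet>c v = w \<bullet>c (X *\<^sub>v v)"
    proof -
      have "(X\<dagger> *\<^sub>v w) \<bullet>c v = (\<Sum>j<m. (\<Sum>i<n. cnj (X $$ (i, j)) * w $ i) * cnj (v $ j))"
        using X w v by (simp add: scalar_prod_def atLeast0LessThan)
      also have "\<dots> = (\<Sum>i<n. \<Sum>j<m. cnj (X $$ (i, j)) * w $ i * cnj (v $ j))"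
        unfolding sum_distrib_right by (rule sum.swap)
      also have "\<dots> = (\<Sum>i<n. w $ i * cnj (\<Sum>j<m. X $$ (i, j) * v $ j))"
        by (simp add: sum_distrib_left algebra_simps)
      also have "\<dots> = w \<bullet>c (X *\<^sub>v v)"
        using X w v by (simp add: scalar_prod_def atLeast0LessThan)
      finally show ?thesis .
    qed
    ultimately show ?thesis by (simp add: w_def)
  qed
  then show ?thesis unfolding positive_semidefinite_def using pos X Bc by simp
qed

lemma positive_semidefinite_msum:
  assumes "finite I" "\<And>x. x \<in> I \<Longrightarrow> positive_semidefinite n (F x)"
  shows "positive_semidefinite n (msum n n I F)"
  using assms
proof (induction I)
  case empty
  show ?case by (auto simp: positive_semidefinite_def scalar_prod_def)
next
  case (insert x I)
  then have psd: "positive_semidefinite n (F x)" "positive_semidefinite n (msum n n I F)" by auto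
  then have Fx: "F x \<in> carrier_mat n n" by (simp add: positive_semidefinite_def)
  have "0 \<le> ((F x + msum n n I F) *\<^sub>v v) \<bullet>c v" if v: "v \<in> carrier_vec n" for v
  proof -
    have "(F x + msum n n I F) *\<^sub>v v = F x *\<^sub>v v + msum n n I F *\<^sub>v v"
      by (rule add_mult_distrib_mat_vec[OF Fx msum_carrier v])
    moreover have "(F x *\<^sub>v v + msum n n I F *\<^sub>v v) \<bullet>c v = (F x *\<^sub>v v) \<bullet>c v + (msum n n I F *\<^sub>v v) \<bullet>c v"
      by (rule add_scalar_prod_distrib[OF mult_mat_vec_carrier[OF Fx v]
            mult_mat_vec_carrier[OF msum_carrier v]]) (use v in simp)
    ultimately show ?thesis using psd v by (simp add: positive_semidefinite_def)
  qed
  then show ?case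
    using insert Fx by (simp add: msum_insert positive_semidefinite_def)
qed

text \<open>Indices below \<open>a * k\<close> follow the convention of \<open>amplify\<close>:
  \<open>R div k\<close> is the block and \<open>R mod k\<close> the place inside it.\<close>

lemma sum_lessThan_mult_block:
  fixes g :: "nat \<Rightarrow> complex"
  assumes "\<alpha> < a"
  shows "(\<Sum>R<a * k. if R div k = \<alpha> then g (R mod k) else 0) = (\<Sum>i<k. g i)"
proof -
  have "(\<Sum>R<a * k. if R div k = \<alpha> then g (R mod k) else 0) =
      (\<Sum>R | R \<in> {..<a * k} \<and> R div k = \<alpha>. g (R mod k))"
    by (rule sum.inter_filter[symmetric]) simp
  also have "\<dots> = (\<Sum>i<k. g i)"
  proof (rule sum.reindex_bij_witness[where i = "\<lambda>i. \<alpha> * k + i" and j = "\<lambda>R. R mod k"])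
    fix R assume R: "R \<in> {R \<in> {..<a * k}. R div k = \<alpha>}"
    then have "0 < k" by (cases k) auto
    then show "R mod k \<in> {..<k}" by simp
    show "\<alpha> * k + R mod k = R" using R by (metis (mono_tags, lifting) div_mult_mod_eq mem_Collect_eq)
  next
    fix i assume i: "i \<in> {..<k}"
    then show "(\<alpha> * k + i) mod k = i" by simp
    have "\<alpha> * k + i < (\<alpha> + 1) * k" using i by simp
    also have "\<dots> \<le> a * k" using assms by (intro mult_right_mono) auto
    finally show "\<alpha> * k + i \<in> {R \<in> {..<a * k}. R div k = \<alpha>}" using i by simp
  qed simp
  finally show ?thesis .
qed

text \<open>\<open>D\<close> is followed by the map with Kraus operators
  \<open>(K j)\<dagger>\<close>. The condition on the sum of \<open>K j * (K j)\<dagger>\<close> is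
  trace preservation, and after amplification each term is a congruence by the block diagonal matrix
  with \<open>K j\<close> on the diagonal, so positivity survives.\<close>

lemma quantum_channel_kraus_comp:
  assumes D: "quantum_channel m k D" and fin: "finite J"
    and K: "\<And>j. j \<in> J \<Longrightarrow> K j \<in> carrier_mat k l"
    and unit: "msum k k J (\<lambda>j. K j * (K j)\<dagger>) = 1\<^sub>m k"
  shows "quantum_channel m l (\<lambda>Y. msum l l J (\<lambda>j. (K j)\<dagger> * (D Y * K j)))"
proof -
  note Kd = carrier_matD[OF K]
  have lin: "\<forall>X\<in>carrier_mat m m. D X \<in> carrier_mat k k"
      "\<forall>X\<in>carrier_mat m m. \<forall>Y\<in>carrier_mat m m. D (X + Y) = D X + D Y"
      "\<forall>c. \<forall>X\<in>carrier_mat m m. D (c \<cdot>\<^sub>m X) = c \<cdot>\<^sub>m D X"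
    and cp: "completely_positive m k D"
    and tr: "\<And>X. X \<in> carrier_mat m m \<Longrightarrow> mat_trace (D X) = mat_trace X"
    using D unfolding quantum_channel_def module_hom_matrix_algebra_iff by auto
  let ?D = "\<lambda>Y. msum l l J (\<lambda>j. (K j)\<dagger> * (D Y * K j))"
  have term_carrier: "(K j)\<dagger> * (D Y * K j) \<in> carrier_mat l l" if "j \<in> J" for j Y
    using Kd[OF that] by simp
  have "?D \<in> LinearCombinations.module_hom class_ring (matrix_algebra m) (matrix_algebra l)"
    unfolding module_hom_matrix_algebra_iff
  proof (intro conjI ballI allI)
    fix X :: "complex mat" assume X: "X \<in> carrier_mat m m"
    then have DX: "D X \<in> carrier_mat k k" using lin by blast
    show "?D X \<in> carrier_mat l l" by simp
    show "?D (c \<cdot>\<^sub>m X) = c \<cdot>\<^sub>m ?D X" for c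
    proof -
      have "?D (c \<cdot>\<^sub>m X) = msum l l J (\<lambda>j. c \<cdot>\<^sub>m ((K j)\<dagger> * (D X * K j)))"
        using lin(3) X carrier_matD[OF DX]
        by (intro msum_cong) (simp add: Kd mat_smult_mult mat_mult_smult)
      also have "\<dots> = c \<cdot>\<^sub>m ?D X" by (rule msum_smult[OF term_carrier])
      finally show ?thesis .
    qed
    fix Y :: "complex mat" assume Y: "Y \<in> carrier_mat m m"
    then have DY: "D Y \<in> carrier_mat k k" using lin by blast
    show "?D (X + Y) = ?D X + ?D Y"
    proof -
      have "?D (X + Y) = msum l l J (\<lambda>j. (K j)\<dagger> * (D X * K j) + (K j)\<dagger> * (D Y * K j))"
        using lin(2) X Y carrier_matD[OF DX] carrier_matD[OF DY]
        by (intro msum_cong) (simp add: Kd mat_add_mult mat_mult_add)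
      also have "\<dots> = ?D X + ?D Y" by (rule msum_add[OF term_carrier term_carrier])
      finally show ?thesis .
    qed
  qed
  moreover have "mat_trace (?D X) = mat_trace X" if X: "X \<in> carrier_mat m m" for X
  proof -
    have DX: "D X \<in> carrier_mat k k" using lin X by blast
    have "mat_trace (?D X) = (\<Sum>j\<in>J. mat_trace ((K j)\<dagger> * (D X * K j)))"
      by (subst mat_trace_msum) (auto intro!: sum.cong simp: term_carrier)
    also have "\<dots> = (\<Sum>j\<in>J. mat_trace (D X * (K j * (K j)\<dagger>)))"
    proof (rule sum.cong[OF refl])
      fix j assume j: "j \<in> J"
      have "mat_trace ((K j)\<dagger> * (D X * K j)) = mat_trace ((D X * K j) * (K j)\<dagger>)"
        using Kd[OF j] DX by (intro mat_trace_commute[of _ l k]) auto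
      then show "mat_trace ((K j)\<dagger> * (D X * K j)) = mat_trace (D X * (K j * (K j)\<dagger>))"
        using Kd[OF j] DX by (simp add: mat_assoc)
    qed
    also have "\<dots> = mat_trace (msum k k J (\<lambda>j. D X * (K j * (K j)\<dagger>)))"
      by (subst mat_trace_msum) (use DX Kd in \<open>auto intro!: sum.cong\<close>)
    also have "msum k k J (\<lambda>j. D X * (K j * (K j)\<dagger>)) = D X * msum k k J (\<lambda>j. K j * (K j)\<dagger>)"
      by (rule mult_msum[OF DX, symmetric]) (use Kd in simp)
    finally show ?thesis unfolding unit using DX tr[OF X] by simp
  qed
  moreover have "completely_positive m l ?D"
    unfolding completely_positive_def
  proof (intro allI impI)
    fix a A assume A: "positive_semidefinite (a * m) A"
    define B where "B = amplify a m k D A"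
    have B: "positive_semidefinite (a * k) B"
      using cp A unfolding completely_positive_def B_def by blast
    then have Bc: "B \<in> carrier_mat (a * k) (a * k)" by (simp add: positive_semidefinite_def)
    \<comment> \<open>The identity of size \<open>a\<close> tensored with \<open>K j\<close>, in the
      index convention of \<open>amplify\<close>.\<close>
    define X where "X j = mat (a * k) (a * l)
      (\<lambda>(R, r). if R div k = r div l then K j $$ (R mod k, r mod l) else 0)" for j
    have Xc: "X j \<in> carrier_mat (a * k) (a * l)" for j by (simp add: X_def)
    have Xi: "X j $$ (R, r) = (if R div k = r div l then K j $$ (R mod k, r mod l) else 0)"
      if "R < a * k" "r < a * l" for j R r
      using that by (simp add: X_def)
    have psd: "positive_semidefinite (a * l) (msum (a * l) (a * l) J (\<lambda>j. (X j)\<dagger> * (B * X j)))"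
      by (intro positive_semidefinite_msum fin positive_semidefinite_congruence[OF B] Xc)
    have "amplify a m l ?D A = msum (a * l) (a * l) J (\<lambda>j. (X j)\<dagger> * (B * X j))"
    proof (rule eq_matI, goal_cases)
      case (1 r s)
      then have rs: "r < a * l" "s < a * l" by auto
      then have l: "0 < l" by (cases l) auto
      let ?\<alpha> = "r div l" and ?\<beta> = "s div l"
      have \<alpha>\<beta>: "?\<alpha> < a" "?\<beta> < a" using rs l by (simp_all add: less_mult_imp_div_less)
      have mods: "r mod l < l" "s mod l < l" using l by simp_all
      define M where "M = D (mat_block m A ?\<alpha> ?\<beta>)"
      have Mc: "M \<in> carrier_mat k k" using lin(1) by (simp add: M_def mat_block_def)
      have "((X j)\<dagger> * (B * X j)) $$ (r, s) = ((K j)\<dagger> * (M * K j)) $$ (r mod l, s mod l)"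
        if j: "j \<in> J" for j
      proof -
        have BX: "(B * X j) $$ (R, s) = (\<Sum>q<k. D (mat_block m A (R div k) ?\<beta>) $$ (R mod k, q) * K j $$ (q, s mod l))"
          if R: "R < a * k" for R
        proof -
          have "(B * X j) $$ (R, s) = (\<Sum>S<a * k. B $$ (R, S) * X j $$ (S, s))"
            using R rs Bc Xc[of j] by (subst mat_mult_index) auto
          also have "\<dots> = (\<Sum>S<a * k. if S div k = ?\<beta> then
              D (mat_block m A (R div k) ?\<beta>) $$ (R mod k, S mod k) * K j $$ (S mod k, s mod l) else 0)"
            using R rs by (intro sum.cong) (auto simp: B_def amplify_def X_def)
          also have "\<dots> = (\<Sum>q<k. D (mat_block m A (R div k) ?\<beta>) $$ (R mod k, q) * K j $$ (q, s mod l))"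
            by (rule sum_lessThan_mult_block[OF \<alpha>\<beta>(2)])
          finally show ?thesis .
        qed
        have "((X j)\<dagger> * (B * X j)) $$ (r, s) = (\<Sum>R<a * k. cnj (X j $$ (R, r)) * (B * X j) $$ (R, s))"
          using rs Bc Xc[of j] by (subst mat_mult_index) auto
        also have "\<dots> = (\<Sum>R<a * k. if R div k = ?\<alpha> then cnj (K j $$ (R mod k, r mod l)) *
            (\<Sum>q<k. M $$ (R mod k, q) * K j $$ (q, s mod l)) else 0)"
          using rs by (intro sum.cong refl) (simp add: BX Xi M_def del: index_mult_mat(1))
        also have "\<dots> = (\<Sum>p<k. cnj (K j $$ (p, r mod l)) * (\<Sum>q<k. M $$ (p, q) * K j $$ (q, s mod l)))"
          by (rule sum_lessThan_mult_block[OF \<alpha>\<beta>(1)])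
        also have "\<dots> = (\<Sum>p<k. cnj (K j $$ (p, r mod l)) * (M * K j) $$ (p, s mod l))"
        proof (rule sum.cong[OF refl])
          fix p assume "p \<in> {..<k}"
          then show "cnj (K j $$ (p, r mod l)) * (\<Sum>q<k. M $$ (p, q) * K j $$ (q, s mod l)) =
              cnj (K j $$ (p, r mod l)) * (M * K j) $$ (p, s mod l)"
            using Mc Kd[OF j] mods by (subst mat_mult_index) auto
        qed
        also have "\<dots> = ((K j)\<dagger> * (M * K j)) $$ (r mod l, s mod l)"
          using Mc Kd[OF j] mods by (subst mat_mult_index[of "r mod l"]) auto
        finally show ?thesis .
      qed
      then show ?case using rs mods by (simp add: amplify_def M_def del: index_mult_mat(1))
    qed (auto simp: amplify_def)
    then show "positive_semidefinite (a * l) (amplify a m l ?D A)" using psd by simp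
  qed
  ultimately show ?thesis unfolding quantum_channel_def by blast
qed

text \<open>Cyclicity of the trace, term by term; the right-hand side contains the dual of the Kraus
  map, acting on observables.\<close>

lemma mat_trace_kraus:
  assumes K: "\<And>j. j \<in> J \<Longrightarrow> K j \<in> carrier_mat k l"
    and T: "T \<in> carrier_mat k k" and X: "X \<in> carrier_mat l l"
  shows "mat_trace (X * msum l l J (\<lambda>j. (K j)\<dagger> * (T * K j))) =
    mat_trace (msum k k J (\<lambda>j. K j * (X * (K j)\<dagger>)) * T)"
proof -
  note Kd = carrier_matD[OF K] carrier_matD[OF T] carrier_matD[OF X]
  have "mat_trace (X * msum l l J (\<lambda>j. (K j)\<dagger> * (T * K j))) =
      (\<Sum>j\<in>J. mat_trace (X * ((K j)\<dagger> * (T * K j))))"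
    by (subst mult_msum[OF X], simp add: Kd, subst mat_trace_msum) (auto intro!: sum.cong simp: Kd)
  also have "\<dots> = (\<Sum>j\<in>J. mat_trace (K j * (X * (K j)\<dagger>) * T))"
  proof (rule sum.cong[OF refl])
    fix j assume j: "j \<in> J"
    have "mat_trace (X * ((K j)\<dagger> * (T * K j))) = mat_trace ((X * ((K j)\<dagger> * T)) * K j)"
      using Kd j by (simp add: mat_assoc)
    also have "\<dots> = mat_trace (K j * (X * ((K j)\<dagger> * T)))"
      using Kd j by (intro mat_trace_commute[of _ l k]) auto
    finally show "mat_trace (X * ((K j)\<dagger> * (T * K j))) = mat_trace (K j * (X * (K j)\<dagger>) * T)"
      using Kd j by (simp add: mat_assoc)
  qed
  also have "\<dots> = mat_trace (msum k k J (\<lambda>j. K j * (X * (K j)\<dagger>)) * T)"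
    by (subst msum_mult[OF T], simp add: Kd, subst mat_trace_msum) (auto intro!: sum.cong simp: Kd)
  finally show ?thesis .
qed

text \<open>The matrices \<open>(F j)\<dagger>\<close> are the Kraus operators of the channel that
  discards its input and prepares the first basis state. Its dual therefore sends an observable
  \<open>X\<close> to the constant \<open>X $$ (0, 0)\<close>.\<close>

lemma msum_replace_by_first:
  fixes k :: nat
  assumes l: "0 < l" and X: "X \<in> carrier_mat l l"
  defines "F \<equiv> \<lambda>j. mat k l (\<lambda>(a, b). if a = j \<and> b = 0 then 1 else 0 :: complex)"
  shows "msum k k {..<k} (\<lambda>j. F j * (X * (F j)\<dagger>)) = X $$ (0, 0) \<cdot>\<^sub>m 1\<^sub>m k"
proof (rule eq_matI, goal_cases)
  case (1 a b)
  then have ab: "a < k" "b < k" by auto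
  have F: "F j \<in> carrier_mat k l" for j by (simp add: F_def)
  have "(F j * (X * (F j)\<dagger>)) $$ (a, b) = (if j = a then (if a = b then X $$ (0, 0) else 0) else 0)" for j
  proof -
    have XF: "(X * (F j)\<dagger>) $$ (0, b) = (if b = j then X $$ (0, 0) else 0)"
    proof -
      have "(X * (F j)\<dagger>) $$ (0, b) = (\<Sum>t<l. X $$ (0, t) * (F j)\<dagger> $$ (t, b))"
        using ab l X F[of j] by (subst mat_mult_index) auto
      also have "\<dots> = (\<Sum>t<l. if t = 0 then (if b = j then X $$ (0, 0) else 0) else 0)"
        using ab l F[of j] by (intro sum.cong) (auto simp: F_def)
      finally show ?thesis using l by simp
    qed
    have "(F j * (X * (F j)\<dagger>)) $$ (a, b) = (\<Sum>s<l. F j $$ (a, s) * (X * (F j)\<dagger>) $$ (s, b))"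
      using ab X F[of j] by (subst mat_mult_index) auto
    also have "\<dots> = (\<Sum>s<l. if s = 0 then (if a = j then (X * (F j)\<dagger>) $$ (0, b) else 0) else 0)"
      using ab by (intro sum.cong) (auto simp: F_def)
    also have "\<dots> = (if a = j then (X * (F j)\<dagger>) $$ (0, b) else 0)" using l by simp
    finally show ?thesis unfolding XF by auto
  qed
  then have "msum k k {..<k} (\<lambda>j. F j * (X * (F j)\<dagger>)) $$ (a, b) =
      (\<Sum>j<k. if j = a then (if a = b then X $$ (0, 0) else 0) else 0)"
    using ab by (simp del: index_mult_mat(1))
  then show ?case using ab by simp
qed auto

section \<open>Transmission of embedded algebras\<close>

lemma unital_star_algebra_one_neq_zero:
  assumes A: "unital_star_algebra A" "carrier A \<noteq> {\<zero>\<^bsub>A\<^esub>}"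
  shows "\<one>\<^bsub>A\<^esub> \<noteq> \<zero>\<^bsub>A\<^esub>"
proof
  assume 0: "\<one>\<^bsub>A\<^esub> = \<zero>\<^bsub>A\<^esub>"
  interpret ring A using unital_star_algebra.is_ring[OF A(1)] .
  have "x = \<zero>\<^bsub>A\<^esub>" if "x \<in> carrier A" for x using that l_one[OF that] 0 by simp
  then show False using A(2) by auto
qed

text \<open>With \<open>W\<close> the inclusion of the code space of the subalgebra into that of the algebra, the new
  decoder compresses by \<open>W\<close>, and to preserve the trace it sends everything orthogonal to the range of
  \<open>W\<close> to a fixed pure state.  This extra term does not matter, since \<open>1 - W W\<^sup>*\<close> belongs to the
  corrected algebra.\<close>

lemma transmittable_if_embeds:
  assumes ch: "quantum_channel n m \<Phi>" and A: "transmittable n m \<Phi> A"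
    and B: "fd_cstar_algebra B" and BA: "embeds B A"
  shows "transmittable n m \<Phi> B"
proof -
  have uA: "unital_star_algebra A" and uB: "unital_star_algebra B" and nzB: "carrier B \<noteq> {\<zero>\<^bsub>B\<^esub>}"
    using A B by (auto simp: transmittable_def fd_cstar_algebra_iff)
  obtain \<pi> where \<pi>: "\<pi> \<in> star_hom A (matrix_algebra n)" "inj_on \<pi> (carrier A)"
    and corr: "correctable n m \<Phi> (\<pi> ` carrier A)"
    using A unfolding transmittable_def by blast
  obtain f where f: "f \<in> star_hom B A" "inj_on f (carrier B)" using BA unfolding embeds_def by blast
  define \<rho> where "\<rho> = \<pi> \<circ> f"
  have \<rho>: "\<rho> \<in> star_hom B (matrix_algebra n)" unfolding \<rho>_def by (rule star_hom_comp[OF f(1) \<pi>(1)])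
  have \<rho>_inj: "inj_on \<rho> (carrier B)"
    unfolding \<rho>_def using \<pi> f star_homD(1)[OF f(1)] by (intro comp_inj_on) (auto intro: inj_on_subset)
  define S where "S = \<pi> ` carrier A"
  define S' where "S' = \<rho> ` carrier B"
  have S'S: "S' \<subseteq> S" unfolding S_def S'_def \<rho>_def using star_homD(1)[OF f(1)] by auto
  have sS: "star_subalgebra n S" unfolding S_def by (rule star_subalgebra_image[OF uA \<pi>(1)])
  have sS': "star_subalgebra n S'" unfolding S'_def by (rule star_subalgebra_image[OF uB \<rho>])
  note SD = star_subalgebraD[OF sS]
  note SD' = star_subalgebraD[OF sS']
  obtain P k V D where P: "is_unit_of P S" and V: "V \<in> carrier_mat n k" "V\<dagger> * V = 1\<^sub>m k" "V * V\<dagger> = P"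
    and D: "quantum_channel m k D"
    and adj: "\<And>X. X \<in> S \<Longrightarrow>
      adjoint_map k k (D \<circ> (\<lambda>Y. \<Phi> (V * Y * V\<dagger>))) (V\<dagger> * X * V) = V\<dagger> * X * V"
    using corr unfolding correctable_def S_def by blast
  define P' where "P' = \<rho> \<one>\<^bsub>B\<^esub>"
  have P'S': "P' \<in> S'" unfolding P'_def S'_def using unital_star_algebraD(2)[OF uB] by blast
  have unit': "P' * X = X" "X * P' = X" if "X \<in> S'" for X
  proof -
    obtain x where x: "x \<in> carrier B" "X = \<rho> x" using \<open>X \<in> S'\<close> unfolding S'_def by blast
    note h = star_homD(3)[OF \<rho>] and D = unital_star_algebraD[OF uB]
    show "P' * X = X" using h[OF D(2) x(1)] D(12)[OF x(1)] by (simp add: P'_def x(2))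
    show "X * P' = X" using h[OF x(1) D(2)] D(13)[OF x(1)] by (simp add: P'_def x(2))
  qed
  have Pc: "P \<in> carrier_mat n n" and P'c: "P' \<in> carrier_mat n n"
    using P P'S' SD(1) SD'(1) by (auto simp: is_unit_of_def)
  have PP': "P * P' = P'" using P P'S' S'S by (auto simp: is_unit_of_def)
  have P'a: "P'\<dagger> = P'"
  proof -
    have "P' * P'\<dagger> = P'\<dagger>" by (rule unit'(1)[OF SD'(6)[OF P'S']])
    from arg_cong[OF this, of mat_adjoint] have "P' * P'\<dagger> = P'" using P'c by (simp add: mat_adjoint_mult)
    with \<open>P' * P'\<dagger> = P'\<dagger>\<close> show ?thesis by simp
  qed
  obtain l V' where V': "V' \<in> carrier_mat n l" "V'\<dagger> * V' = 1\<^sub>m l" "V' * V'\<dagger> = P'"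
    using projection_isometry[OF P'c P'a unit'(1)[OF P'S']] by metis
  note dims = carrier_matD[OF V(1)] carrier_matD[OF V'(1)] carrier_matD[OF Pc] carrier_matD[OF P'c]
  \<comment> \<open>The prepared pure state needs a basis vector; the new code space is nonzero
    because \<open>B\<close> is.\<close>
  have l: "0 < l"
  proof (rule ccontr)
    assume "\<not> 0 < l"
    then have "V' * V'\<dagger> = 0\<^sub>m n n" using dims by (intro eq_matI) (auto simp: scalar_prod_def)
    then have "\<rho> \<one>\<^bsub>B\<^esub> = \<rho> \<zero>\<^bsub>B\<^esub>"
      using V'(3) star_hom_zero[OF uB unital_star_algebra_matrix_algebra \<rho>] by (simp add: P'_def)
    then show False
      using \<rho>_inj unital_star_algebraD(1,2)[OF uB] unital_star_algebra_one_neq_zero[OF uB nzB]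
      by (auto dest: inj_onD)
  qed
  have P'V': "P' * V' = V'"
    using V'(2) dims unfolding V'(3)[symmetric] by (simp add: mat_assoc)
  define W where "W = V\<dagger> * V'"
  have Wc: "W \<in> carrier_mat k l" using dims by (simp add: W_def)
  \<comment> \<open>The new code space lies inside the old one, as
    \<open>P * P' = P'\<close>.\<close>
  have VW: "V * W = V'"
  proof -
    have "V * W = P * (P' * V')" unfolding P'V' using dims by (simp add: W_def V(3)[symmetric] mat_assoc)
    also have "\<dots> = P * P' * V'" using dims by (simp add: mat_assoc)
    finally show ?thesis by (simp add: PP' P'V')
  qed
  have WV: "W\<dagger> * V\<dagger> = V'\<dagger>"
    using arg_cong[OF VW, of mat_adjoint] dims Wc by (simp add: mat_adjoint_mult)
  have WW: "W\<dagger> * W = 1\<^sub>m l"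
  proof -
    have "W\<dagger> * W = W\<dagger> * V\<dagger> * V'" using dims carrier_matD[OF Wc] by (simp add: W_def mat_assoc)
    then show ?thesis by (simp add: WV V'(2))
  qed
  define Q where "Q = W * W\<dagger>"
  define N where "N = 1\<^sub>m k - Q"
  have Qc: "Q \<in> carrier_mat k k" and Nc: "N \<in> carrier_mat k k" using Wc by (simp_all add: Q_def N_def)
  note dims2 = carrier_matD[OF Wc] carrier_matD[OF Qc] carrier_matD[OF Nc]
  have QW: "Q * W = W" using dims2(1,2) by (simp add: Q_def mat_assoc WW)
  have QQ: "Q * Q = Q"
  proof -
    have "Q * Q = Q * W * W\<dagger>" unfolding Q_def[of] using dims2(1,2) by (simp add: mat_assoc)
    then show ?thesis unfolding QW by (simp add: Q_def)
  qed
  have Na: "N\<dagger> = N" using dims2(1,2) by (simp add: N_def Q_def mat_adjoint_minus mat_adjoint_mult)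
  have NN: "N * N = N"
  proof -
    have "N * N = N - (Q - Q * Q)"
      unfolding N_def using dims2(3,4) by (simp add: mat_minus_mult mat_mult_minus)
    then show ?thesis unfolding QQ using dims2 by (intro eq_matI) auto
  qed
  have NW: "N * W = 0\<^sub>m k l" unfolding N_def using dims2(1-4) by (simp add: mat_minus_mult QW)
  \<comment> \<open>The complement of the new code space in the old one is the compression of
    \<open>P - P'\<close>, a difference of two elements of \<open>S\<close>.\<close>
  have N_eq: "N = V\<dagger> * (P - P') * V"
  proof -
    have "V\<dagger> * P * V = V\<dagger> * V * (V\<dagger> * V)" unfolding V(3)[symmetric] using dims by (simp add: mat_assoc)
    then have 1: "V\<dagger> * P * V = 1\<^sub>m k" by (simp add: V(2))
    have 2: "V\<dagger> * P' * V = Q"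
      unfolding V'(3)[symmetric] Q_def W_def using dims by (simp add: mat_assoc mat_adjoint_mult)
    have "V\<dagger> * (P - P') * V = V\<dagger> * P * V - V\<dagger> * P' * V"
      using dims by (simp add: mat_mult_minus mat_minus_mult)
    then show ?thesis unfolding 1 2 by (simp add: N_def)
  qed
  define F where "F j = mat k l (\<lambda>(a, b). if a = j \<and> b = 0 then 1 else 0 :: complex)" for j
  have Fd: "dim_row (F j) = k" "dim_col (F j) = l" for j by (simp_all add: F_def)
  \<comment> \<open>Operator 0 compresses to the new code space; the others, through their adjoints,
    first cut down to the complement with \<open>N\<close> and then send everything to the first
    basis vector.\<close>
  define K where "K j = (case j of 0 \<Rightarrow> W | Suc j \<Rightarrow> N * F j)" for j
  have Kc: "K j \<in> carrier_mat k l" for j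
    using Wc dims2 Fd by (auto simp: K_def split: nat.split)
  \<comment> \<open>The dual of the new post-processing keeps \<open>X\<close> on the range of
    \<open>W\<close> and puts the number \<open>X $$ (0, 0)\<close> on its complement. For
    \<open>X = 1\<close> this is the trace condition.\<close>
  have KXK: "msum k k {..<Suc k} (\<lambda>j. K j * (X * (K j)\<dagger>)) = W * (X * W\<dagger>) + X $$ (0, 0) \<cdot>\<^sub>m N"
    if X: "X \<in> carrier_mat l l" for X
  proof -
    note Xd = carrier_matD[OF X]
    have FXF: "F j * (X * (F j)\<dagger>) \<in> carrier_mat k k" for j using Fd by simp
    have "msum k k {..<Suc k} (\<lambda>j. K j * (X * (K j)\<dagger>)) =
        W * (X * W\<dagger>) + msum k k {..<k} (\<lambda>j. N * (F j * (X * (F j)\<dagger>) * N))"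
    proof (subst msum_lessThan_Suc_shift)
      show "K 0 * (X * (K 0)\<dagger>) \<in> carrier_mat k k" using carrier_matD[OF Kc[of 0]] by simp
      have "K (Suc j) * (X * (K (Suc j))\<dagger>) = N * (F j * (X * (F j)\<dagger>) * N)" for j
        using Xd Fd dims2 by (simp add: K_def mat_adjoint_mult Na mat_assoc)
      then show "K 0 * (X * (K 0)\<dagger>) + msum k k {..<k} (\<lambda>j. K (Suc j) * (X * (K (Suc j))\<dagger>)) =
          W * (X * W\<dagger>) + msum k k {..<k} (\<lambda>j. N * (F j * (X * (F j)\<dagger>) * N))"
        by (simp add: K_def)
    qed
    also have "msum k k {..<k} (\<lambda>j. N * (F j * (X * (F j)\<dagger>) * N)) =
        N * msum k k {..<k} (\<lambda>j. F j * (X * (F j)\<dagger>) * N)"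
      by (rule mult_msum[OF Nc, symmetric]) (use Fd dims2 in simp)
    also have "msum k k {..<k} (\<lambda>j. F j * (X * (F j)\<dagger>) * N) =
        msum k k {..<k} (\<lambda>j. F j * (X * (F j)\<dagger>)) * N"
      by (rule msum_mult[OF Nc FXF, symmetric])
    also have "msum k k {..<k} (\<lambda>j. F j * (X * (F j)\<dagger>)) = X $$ (0, 0) \<cdot>\<^sub>m 1\<^sub>m k"
      unfolding F_def by (rule msum_replace_by_first[OF l X])
    also have "N * (X $$ (0, 0) \<cdot>\<^sub>m 1\<^sub>m k * N) = X $$ (0, 0) \<cdot>\<^sub>m N"
      using dims2 by (simp add: mat_smult_mult mat_mult_smult NN)
    finally show ?thesis .
  qed
  have KK: "msum k k {..<Suc k} (\<lambda>j. K j * (K j)\<dagger>) = 1\<^sub>m k"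
  proof -
    have "msum k k {..<Suc k} (\<lambda>j. K j * (K j)\<dagger>) = msum k k {..<Suc k} (\<lambda>j. K j * (1\<^sub>m l * (K j)\<dagger>))"
      by (rule msum_cong) (use carrier_matD[OF Kc] in simp)
    also have "\<dots> = W * (1\<^sub>m l * W\<dagger>) + 1\<^sub>m l $$ (0, 0) \<cdot>\<^sub>m N" by (rule KXK) simp
    also have "\<dots> = Q + N" using l dims2 by (simp add: Q_def)
    also have "\<dots> = 1\<^sub>m k" using dims2 by (intro eq_matI) (auto simp: N_def)
    finally show ?thesis .
  qed
  define D' where "D' Y = msum l l {..<Suc k} (\<lambda>j. (K j)\<dagger> * (D Y * K j))" for Y
  have chD': "quantum_channel m l D'"
    unfolding D'_def by (rule quantum_channel_kraus_comp[OF D _ Kc KK]) simp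
  define \<Psi> where "\<Psi> = D \<circ> (\<lambda>Y. \<Phi> (V * Y * V\<dagger>))"
  have \<Phi>_lin: "\<forall>X\<in>carrier_mat n n. \<Phi> X \<in> carrier_mat m m"
      "\<forall>X\<in>carrier_mat n n. \<forall>Y\<in>carrier_mat n n. \<Phi> (X + Y) = \<Phi> X + \<Phi> Y"
      "\<forall>c. \<forall>X\<in>carrier_mat n n. \<Phi> (c \<cdot>\<^sub>m X) = c \<cdot>\<^sub>m \<Phi> X"
    using ch unfolding quantum_channel_def module_hom_matrix_algebra_iff by auto
  have D_lin: "\<forall>X\<in>carrier_mat m m. D X \<in> carrier_mat k k"
      "\<forall>X\<in>carrier_mat m m. \<forall>Y\<in>carrier_mat m m. D (X + Y) = D X + D Y"
      "\<forall>c. \<forall>X\<in>carrier_mat m m. D (c \<cdot>\<^sub>m X) = c \<cdot>\<^sub>m D X"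
    using D unfolding quantum_channel_def module_hom_matrix_algebra_iff by auto
  have VYV: "V * Y * V\<dagger> \<in> carrier_mat n n" for Y using dims by simp
  have \<Psi>: "\<Psi> \<in> LinearCombinations.module_hom class_ring (matrix_algebra k) (matrix_algebra k)"
    unfolding module_hom_matrix_algebra_iff
  proof (intro conjI ballI allI)
    fix X :: "complex mat" assume X: "X \<in> carrier_mat k k"
    show "\<Psi> X \<in> carrier_mat k k" using \<Phi>_lin(1) D_lin(1) VYV by (simp add: \<Psi>_def)
    have "V * (c \<cdot>\<^sub>m X) * V\<dagger> = c \<cdot>\<^sub>m (V * X * V\<dagger>)" for c
      using dims X by (simp add: mat_mult_smult mat_smult_mult)
    then show "\<Psi> (c \<cdot>\<^sub>m X) = c \<cdot>\<^sub>m \<Psi> X" for c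
      using \<Phi>_lin(1,3) D_lin(3) VYV by (simp add: \<Psi>_def)
    fix Y :: "complex mat" assume Y: "Y \<in> carrier_mat k k"
    have "V * (X + Y) * V\<dagger> = V * X * V\<dagger> + V * Y * V\<dagger>"
      using dims X Y by (simp add: mat_mult_add mat_add_mult)
    then show "\<Psi> (X + Y) = \<Psi> X + \<Psi> Y" using \<Phi>_lin(1,2) D_lin(2) VYV by (simp add: \<Psi>_def)
  qed
  have \<Psi>_trace: "mat_trace (V\<dagger> * X * V * \<Psi> Y) = mat_trace (V\<dagger> * X * V * Y)"
    if "X \<in> S" "Y \<in> carrier_mat k k" for X Y
    using adjoint_map_trace[OF \<Psi> _ that(2), of "V\<dagger> * X * V"] adj[OF that(1)] dims
    by (simp add: \<Psi>_def)
  have "adjoint_map l l (D' \<circ> (\<lambda>Y. \<Phi> (V' * Y * V'\<dagger>))) (V'\<dagger> * Z * V') = V'\<dagger> * Z * V'"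
    if Z: "Z \<in> S'" for Z
  proof (rule adjoint_map_eqI)
    define X where "X = V'\<dagger> * Z * V'"
    show X: "V'\<dagger> * Z * V' \<in> carrier_mat l l" using dims by simp
    then have Xc: "X \<in> carrier_mat l l" by (simp add: X_def)
    fix Y :: "complex mat" assume Y: "Y \<in> carrier_mat l l"
    have Zc: "Z \<in> carrier_mat n n" by (rule SD'(1)[OF Z])
    note dims3 = carrier_matD[OF Y] carrier_matD[OF Zc] carrier_matD[OF Xc]
    define G where "G = W * Y * W\<dagger>"
    have G: "G \<in> carrier_mat k k" using dims2 by (simp add: G_def)
    have \<Psi>G: "\<Psi> G \<in> carrier_mat k k" using \<Phi>_lin(1) D_lin(1) VYV by (simp add: \<Psi>_def)
    have "V * G * V\<dagger> = V * W * Y * (W\<dagger> * V\<dagger>)"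
      using dims(1,2) dims2(1,2) dims3(1,2) by (simp add: G_def mat_assoc)
    then have \<Psi>_eq: "D (\<Phi> (V' * Y * V'\<dagger>)) = \<Psi> G" by (simp add: \<Psi>_def VW WV)
    \<comment> \<open>\<open>Z\<close> equals \<open>P' * Z * P'\<close>, so moving its new
      compression back to the old code space gives its old compression, whose expectation
      \<open>\<Psi>\<close> preserves.\<close>
    have WXW: "W * (X * W\<dagger>) = V\<dagger> * Z * V"
    proof -
      have "W * (X * W\<dagger>) = V\<dagger> * (V' * V'\<dagger> * (Z * (V' * V'\<dagger>))) * V"
        using dims dims3 by (simp add: W_def X_def mat_adjoint_mult mat_assoc)
      then show ?thesis unfolding V'(3) unit'(2)[OF Z] unit'(1)[OF Z] .
    qed
    have "mat_trace (X * D' (\<Phi> (V' * Y * V'\<dagger>))) =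
        mat_trace ((W * (X * W\<dagger>) + X $$ (0, 0) \<cdot>\<^sub>m N) * \<Psi> G)"
      unfolding D'_def \<Psi>_eq KXK[OF Xc, symmetric] by (rule mat_trace_kraus[OF Kc \<Psi>G Xc])
    also have "\<dots> = mat_trace (V\<dagger> * Z * V * \<Psi> G + X $$ (0, 0) \<cdot>\<^sub>m (N * \<Psi> G))"
      unfolding WXW using dims dims2 dims3 carrier_matD[OF \<Psi>G]
      by (simp add: mat_add_mult mat_smult_mult)
    also have "\<dots> = mat_trace (V\<dagger> * Z * V * \<Psi> G) + X $$ (0, 0) * mat_trace (N * \<Psi> G)"
      using dims dims2 carrier_matD[OF \<Psi>G] by (simp add: mat_trace_add[of _ k] mat_trace_smult[of _ k])
    \<comment> \<open>The extra term vanishes: \<open>\<Psi>\<close> preserves the expectation of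
      \<open>N\<close>, and \<open>G\<close> lives on the range of \<open>W\<close>, which
      \<open>N\<close> annihilates.\<close>
    also have "mat_trace (N * \<Psi> G) = mat_trace (N * G)"
    proof -
      have "P - P' \<in> S" using P P'S' S'S by (intro star_subalgebra_minus[OF sS]) (auto simp: is_unit_of_def)
      from \<Psi>_trace[OF this G] show ?thesis unfolding N_eq[symmetric] .
    qed
    also have "N * G = N * W * (Y * W\<dagger>)" using dims2 dims3 by (simp add: G_def mat_assoc)
    also have "\<dots> = 0\<^sub>m k k" unfolding NW using dims2 dims3 by simp
    also have "mat_trace (V\<dagger> * Z * V * \<Psi> G) = mat_trace (V\<dagger> * Z * V * G)"
      using \<Psi>_trace[of Z, OF _ G] Z S'S by blast
    also have "\<dots> = mat_trace ((V\<dagger> * Z * V * W * Y) * W\<dagger>)"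
      using dims dims2 dims3 by (simp add: G_def mat_assoc)
    also have "\<dots> = mat_trace (W\<dagger> * (V\<dagger> * Z * V * W * Y))"
      using dims dims2 dims3 by (intro mat_trace_commute[of _ k l]) auto
    also have "W\<dagger> * (V\<dagger> * Z * V * W * Y) = (W\<dagger> * V\<dagger>) * Z * (V * W) * Y"
      using dims dims2 dims3 by (simp add: mat_assoc)
    also have "\<dots> = X * Y" unfolding WV VW X_def ..
    finally show "mat_trace (V'\<dagger> * Z * V' * (D' \<circ> (\<lambda>Y. \<Phi> (V' * Y * V'\<dagger>))) Y) = mat_trace (V'\<dagger> * Z * V' * Y)"
      by (simp add: X_def mat_trace_def)
  qed
  then have "correctable n m \<Phi> S'"
    unfolding correctable_def
    by (intro conjI sS' exI[of _ P'] exI[of _ l] exI[of _ V'] exI[of _ D'])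
      (use P'S' unit' V' chD' in \<open>auto simp: is_unit_of_def\<close>)
  then show ?thesis
    unfolding transmittable_def S'_def using B \<rho> \<rho>_inj by blast
qed

section \<open>Dominating algebras\<close>

lemma embeds_carrier_neq_zero:
  assumes A: "unital_star_algebra A" "carrier A \<noteq> {\<zero>\<^bsub>A\<^esub>}" and B: "unital_star_algebra B"
    and AB: "embeds A B"
  shows "carrier B \<noteq> {\<zero>\<^bsub>B\<^esub>}"
proof -
  obtain f where f: "f \<in> star_hom A B" "inj_on f (carrier A)" using AB unfolding embeds_def by blast
  have "f \<one>\<^bsub>A\<^esub> \<noteq> f \<zero>\<^bsub>A\<^esub>"
    using f(2) unital_star_algebraD(1,2)[OF A(1)] unital_star_algebra_one_neq_zero[OF A]
    by (auto dest: inj_onD)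
  then have "f \<one>\<^bsub>A\<^esub> \<noteq> \<zero>\<^bsub>B\<^esub>" using star_hom_zero[OF A(1) B f(1)] by simp
  then show ?thesis using star_homD(1)[OF f(1)] unital_star_algebraD(2)[OF A(1)] by auto
qed

text \<open>The copy is the image of a representation. Its unit is the image of the unit, which can
  be a proper projection rather than the identity matrix.\<close>

lemma transmittable_matrix_copy:
  assumes ch: "quantum_channel n m \<Phi>" and A: "transmittable n m \<Phi> A"
  obtains B :: algebra where "transmittable n m \<Phi> B" "star_isomorphic A B" "star_isomorphic B A"
proof -
  have fA: "fd_cstar_algebra A" using A by (simp add: transmittable_def)
  have uA: "unital_star_algebra A" and nzA: "carrier A \<noteq> {\<zero>\<^bsub>A\<^esub>}"
    using fA by (auto simp: fd_cstar_algebra_iff)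
  obtain \<pi> where \<pi>: "\<pi> \<in> star_hom A (matrix_algebra n)" "inj_on \<pi> (carrier A)"
    using A unfolding transmittable_def by blast
  define B :: algebra where "B = (matrix_algebra n)\<lparr>carrier := \<pi> ` carrier A, one := \<pi> \<one>\<^bsub>A\<^esub>\<rparr>"
  have B_simps [simp]: "carrier B = \<pi> ` carrier A" "x \<otimes>\<^bsub>B\<^esub> y = x * y" "\<one>\<^bsub>B\<^esub> = \<pi> \<one>\<^bsub>A\<^esub>"
    "\<zero>\<^bsub>B\<^esub> = 0\<^sub>m n n" "x \<oplus>\<^bsub>B\<^esub> y = x + y" "c \<odot>\<^bsub>B\<^esub> x = c \<cdot>\<^sub>m x" "star B x = x\<dagger>" for x y c
    by (simp_all add: B_def matrix_algebra_def)
  have hom: "\<pi> \<in> star_hom A B" using \<pi>(1) by (simp add: star_hom_iff)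
  have uB: "unital_star_algebra B"
    by (rule unital_star_algebra_image[OF uA hom])
      (use star_hom_zero[OF uA unital_star_algebra_matrix_algebra \<pi>(1)] in simp_all)
  have "bij_betw \<pi> (carrier A) (carrier B)" using \<pi>(2) by (simp add: bij_betw_def)
  then have iso: "star_isomorphic A B" unfolding star_isomorphic_def using hom by blast
  have iso': "star_isomorphic B A" by (rule star_isomorphic_sym[OF uA iso])
  have emb: "embeds B A" by (rule star_isomorphic_imp_embeds[OF iso'])
  have "carrier B \<noteq> {\<zero>\<^bsub>B\<^esub>}"
    by (rule embeds_carrier_neq_zero[OF uA nzA uB star_isomorphic_imp_embeds[OF iso]])
  then have "fd_cstar_algebra B" by (rule fd_cstar_algebra_if_embeds[OF uB _ emb fA])
  then have "transmittable n m \<Phi> B" by (rule transmittable_if_embeds[OF ch A _ emb])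
  then show ?thesis using that iso iso' by blast
qed

text \<open>Reduces the transmittable matrix algebras, and with them \<open>d_max\<close>, to the
  counting criterion with \<open>c = 1\<close>.\<close>

lemma matrix_algebra_isomorphic_power_one:
  "star_isomorphic (matrix_sum 1 (\<lambda>_. d)) (matrix_algebra d)"
proof -
  have "(\<lambda>x. x 0) \<in> star_hom (matrix_sum 1 (\<lambda>_. d)) (matrix_algebra d)"
    by (auto simp: star_hom_iff)
  moreover have "bij_betw (\<lambda>x. x 0) (\<Pi>\<^sub>E i\<in>{..<1 :: nat}. carrier_mat d d) (carrier_mat d d)"
    by (rule bij_betw_byWitness[where f' = "\<lambda>y. \<lambda>i\<in>{..<1}. y"])
      (auto simp: fun_eq_iff PiE_def extensional_def)
  ultimately show ?thesis unfolding star_isomorphic_def by auto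
qed

lemma unital_star_algebra_power: "unital_star_algebra (direct_sum I (\<lambda>i. matrix_algebra (r i)))"
  by (intro unital_star_algebra_direct_sum unital_star_algebra_matrix_algebra)

text \<open>The empty direct sum is the zero algebra, so \<open>c = 0\<close> never occurs among the
  transmittable powers.\<close>

lemma matrix_power_carrier_neq_zero_iff:
  fixes c d :: nat
  assumes "0 < d"
  shows "carrier (matrix_sum c (\<lambda>_. d)) \<noteq>
    {\<zero>\<^bsub>matrix_sum c (\<lambda>_. d)\<^esub>} \<longleftrightarrow> 0 < c"
proof
  assume "0 < c"
  have "(\<lambda>i\<in>{..<c}. 1\<^sub>m d) \<noteq> (\<lambda>i\<in>{..<c}. 0\<^sub>m d d :: complex mat)"
  proof
    assume "(\<lambda>i\<in>{..<c}. 1\<^sub>m d) = (\<lambda>i\<in>{..<c}. 0\<^sub>m d d :: complex mat)"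
    from fun_cong[OF this, of 0] have "1\<^sub>m d = (0\<^sub>m d d :: complex mat)" using \<open>0 < c\<close> by simp
    then have "1\<^sub>m d $$ (0, 0) = (0\<^sub>m d d $$ (0, 0) :: complex)" by simp
    then show False using assms by simp
  qed
  moreover have "(\<lambda>i\<in>{..<c}. 1\<^sub>m d) \<in> carrier (matrix_sum c (\<lambda>_. d))" by simp
  moreover have "\<zero>\<^bsub>matrix_sum c (\<lambda>_. d)\<^esub> = (\<lambda>i\<in>{..<c}. 0\<^sub>m d d)" by simp
  ultimately show "carrier (matrix_sum c (\<lambda>_. d)) \<noteq>
      {\<zero>\<^bsub>matrix_sum c (\<lambda>_. d)\<^esub>}"
    by (simp only:) blast
next
  assume nz: "carrier (matrix_sum c (\<lambda>_. d)) \<noteq>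
    {\<zero>\<^bsub>matrix_sum c (\<lambda>_. d)\<^esub>}"
  show "0 < c"
  proof (rule ccontr)
    assume "\<not> 0 < c"
    then show False using nz by (auto simp: restrict_def)
  qed
qed

section \<open>Multiplicities and the two directions of the criterion\<close>

text \<open>Summands are grouped by size: sizes below \<open>d\<close> contribute nothing and size
  \<open>d\<close> contributes one each. Solved for the number of the latter, this is the recursion
  for \<open>capacity_mult\<close>.\<close>

lemma sum_div_eq_sum_card:
  fixes r :: "nat \<Rightarrow> nat"
  assumes "\<And>i. i < K \<Longrightarrow> r i \<le> M" "0 < d" "d \<le> M"
  shows "(\<Sum>i<K. r i div d) = card {i. i < K \<and> r i = d} + (\<Sum>e\<in>{d+1..M}. card {i. i < K \<and> r i = e} * (e div d))"
proof -
  have "(\<Sum>i<K. r i div d) = (\<Sum>e\<in>{..M}. \<Sum>i | i \<in> {..<K} \<and> r i = e. r i div d)"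
    by (rule sum.group[symmetric]) (use assms(1) in auto)
  also have "\<dots> = (\<Sum>e\<in>{..M}. card {i. i < K \<and> r i = e} * (e div d))" by simp
  also have "\<dots> = (\<Sum>e\<in>{d..M}. card {i. i < K \<and> r i = e} * (e div d))"
    by (rule sum.mono_neutral_right) auto
  also have "\<dots> = card {i. i < K \<and> r i = d} * (d div d) + (\<Sum>e\<in>{d+1..M}. card {i. i < K \<and> r i = e} * (e div d))"
    using assms(3) by (simp add: sum.atLeast_Suc_atMost)
  finally show ?thesis using assms(2) by simp
qed

lemma dominating_imp:
  assumes ch: "quantum_channel n m \<Phi>" and dom: "dominating n m \<Phi> A"
  shows "\<forall>d\<in>{1..d_max n m \<Phi>}. 0 \<le> capacity_mult n m \<Phi> d"
    and "transmittable n m \<Phi> (capacity_algebra n m \<Phi>)"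
    and "\<forall>B\<in>forbidden (capacity_algebra n m \<Phi>). \<not> transmittable n m \<Phi> B"
    and "star_isomorphic A (capacity_algebra n m \<Phi>)"
proof -
  have trA: "transmittable n m \<Phi> A" and domA: "\<And>B::algebra. transmittable n m \<Phi> B \<Longrightarrow> embeds B A"
    using dom unfolding dominating_def by auto
  have fA: "fd_cstar_algebra A" using trA by (simp add: transmittable_def)
  then have uA: "unital_star_algebra A" and nzA: "carrier A \<noteq> {\<zero>\<^bsub>A\<^esub>}"
    by (auto simp: fd_cstar_algebra_iff)
  obtain \<pi> where "\<pi> \<in> star_hom A (matrix_algebra n)" "inj_on \<pi> (carrier A)"
    using trA unfolding transmittable_def by blast
  from star_isomorphic_direct_sum_of_matrix_algebras[OF uA this] obtain K :: nat and r
    where r: "\<And>i. i < K \<Longrightarrow> 0 < r i"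
    and iso: "star_isomorphic A (matrix_sum K r)"
    by blast
  define DS where "DS = matrix_sum K r"
  have uDS: "unital_star_algebra DS" unfolding DS_def by (rule unital_star_algebra_power)
  have A_DS: "embeds A DS" and DS_A: "embeds DS A"
    using star_isomorphic_imp_embeds[OF iso] star_isomorphic_imp_embeds[OF star_isomorphic_sym[OF uA iso]]
    by (simp_all add: DS_def)
  \<comment> \<open>\<open>A\<close> is compared only with algebras of matrices; a copy makes this
    available for \<open>B\<close> with elements of any type, such as direct sums.\<close>
  have tr_imp: "embeds B DS" if B: "transmittable n m \<Phi> B" for B :: "'x star_algebra"
  proof -
    obtain B' :: algebra where B': "transmittable n m \<Phi> B'" "star_isomorphic B B'"
      using transmittable_matrix_copy[OF ch B] by blast
    show ?thesis
      by (rule embeds_trans[OF embeds_trans[OF star_isomorphic_imp_embeds[OF B'(2)] domA[OF B'(1)]] A_DS])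
  qed
  have imp_tr: "transmittable n m \<Phi> B"
    if "unital_star_algebra B" "carrier B \<noteq> {\<zero>\<^bsub>B\<^esub>}" "embeds B DS" for B :: "'x star_algebra"
  proof -
    have BA: "embeds B A" by (rule embeds_trans[OF that(3) DS_A])
    show ?thesis
      by (rule transmittable_if_embeds[OF ch trA fd_cstar_algebra_if_embeds[OF that(1,2) BA fA] BA])
  qed
  have tr_power: "transmittable n m \<Phi> (matrix_sum c (\<lambda>_. d)) \<longleftrightarrow>
      0 < c \<and> c \<le> (\<Sum>i<K. r i div d)" if d: "0 < d" for c d :: nat
  proof
    assume tr: "transmittable n m \<Phi> (matrix_sum c (\<lambda>_. d))"
    then have "embeds (matrix_sum c (\<lambda>_. d)) DS" by (rule tr_imp)
    then have "c \<le> (\<Sum>i<K. r i div d)" unfolding DS_def by (rule matrix_power_embeds_imp_le[OF d])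
    moreover have "0 < c"
      using tr matrix_power_carrier_neq_zero_iff[OF d, of c]
      unfolding transmittable_def fd_cstar_algebra_iff by blast
    ultimately show "0 < c \<and> c \<le> (\<Sum>i<K. r i div d)" by simp
  next
    assume c: "0 < c \<and> c \<le> (\<Sum>i<K. r i div d)"
    show "transmittable n m \<Phi> (matrix_sum c (\<lambda>_. d))"
    proof (rule imp_tr)
      show "unital_star_algebra (matrix_sum c (\<lambda>_. d))"
        by (rule unital_star_algebra_power)
      show "carrier (matrix_sum c (\<lambda>_. d)) \<noteq>
          {\<zero>\<^bsub>matrix_sum c (\<lambda>_. d)\<^esub>}"
        using c matrix_power_carrier_neq_zero_iff[OF d, of c] by blast
      show "embeds (matrix_sum c (\<lambda>_. d)) DS"
        unfolding DS_def by (rule matrix_power_embeds) (use c in simp)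
    qed
  qed
  have tr_matrix: "transmittable n m \<Phi> (matrix_algebra d) \<longleftrightarrow> 0 < d \<and> (\<exists>i<K. d \<le> r i)" for d
  proof (cases "d = 0")
    case True
    \<comment> \<open>At size 0 the matrix algebra is the zero algebra, which is not
      transmittable.\<close>
    have "carrier_mat 0 0 = {0\<^sub>m 0 0 :: complex mat}" by (auto intro!: eq_matI)
    then show ?thesis using True by (auto simp: transmittable_def fd_cstar_algebra_iff)
  next
    case False
    let ?P = "matrix_sum 1 (\<lambda>_. d)"
    note iso1 = matrix_algebra_isomorphic_power_one[of d]
    note iso2 = star_isomorphic_sym[OF unital_star_algebra_power iso1]
    have u: "unital_star_algebra ?P" "unital_star_algebra (matrix_algebra d)"
      by (rule unital_star_algebra_power, rule unital_star_algebra_matrix_algebra)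
    note e1 = star_isomorphic_imp_embeds[OF iso1] and e2 = star_isomorphic_imp_embeds[OF iso2]
    have nzP: "carrier ?P \<noteq> {\<zero>\<^bsub>?P\<^esub>}" by (rule iffD2[OF matrix_power_carrier_neq_zero_iff]) (use False in auto)
    have "transmittable n m \<Phi> (matrix_algebra d) \<longleftrightarrow> transmittable n m \<Phi> ?P"
    proof
      assume "transmittable n m \<Phi> (matrix_algebra d)"
      then show "transmittable n m \<Phi> ?P"
        by (intro imp_tr[OF u(1) nzP] embeds_trans[OF e1] tr_imp)
    next
      assume "transmittable n m \<Phi> ?P"
      then show "transmittable n m \<Phi> (matrix_algebra d)"
        by (intro imp_tr[OF u(2) embeds_carrier_neq_zero[OF u(1) nzP u(2) e1]] embeds_trans[OF e2] tr_imp)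
    qed
    also have "\<dots> \<longleftrightarrow> 1 \<le> (\<Sum>i<K. r i div d)" using tr_power[of d 1] False by simp
    also have "\<dots> \<longleftrightarrow> (\<Sum>i<K. r i div d) \<noteq> 0" by linarith
    also have "\<dots> \<longleftrightarrow> (\<exists>i<K. d \<le> r i)" using False by (auto simp: div_eq_0_iff not_less)
    finally show ?thesis using False by simp
  qed
  have K: "0 < K"
  proof (rule ccontr)
    assume "\<not> 0 < K"
    then show False
      using embeds_carrier_neq_zero[OF uA nzA uDS A_DS] by (auto simp: DS_def restrict_def)
  qed
  define M where "M = Max (r ` {..<K})"
  have rM: "r i \<le> M" if "i < K" for i unfolding M_def using that by (intro Max_ge) auto
  have "M \<in> r ` {..<K}" unfolding M_def using K by (intro Max_in) auto
  then obtain i0 where i0: "i0 < K" "r i0 = M" by auto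
  have dmax: "d_max n m \<Phi> = M"
    unfolding d_max_def
  proof (rule Max_eqI)
    show "finite {d. transmittable n m \<Phi> (matrix_algebra d)}"
      by (rule finite_subset[of _ "{..M}"]) (use tr_matrix rM le_trans in \<open>auto intro: le_trans\<close>)
    show "M \<in> {d. transmittable n m \<Phi> (matrix_algebra d)}" using tr_matrix r[OF i0(1)] i0 by auto
    fix d assume "d \<in> {d. transmittable n m \<Phi> (matrix_algebra d)}"
    then show "d \<le> M" using tr_matrix rM by (auto intro: le_trans)
  qed
  have hyb: "hybrid_capacity n m \<Phi> d = (\<Sum>i<K. r i div d)" if d: "0 < d" "d \<le> M" for d
    unfolding hybrid_capacity_def
  proof (rule Max_eqI)
    \<comment> \<open>The admissible \<open>c\<close> form the interval from 1 to the sum;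
      \<open>d \<le> M\<close> makes it nonempty, so that the maximum is its upper end.\<close>
    have "0 < r i0 div d" using d i0 by (simp add: div_greater_zero_iff)
    also have "\<dots> \<le> (\<Sum>i<K. r i div d)" using i0 by (intro member_le_sum) auto
    finally show "(\<Sum>i<K. r i div d) \<in> {c. transmittable n m \<Phi> (matrix_sum c (\<lambda>_. d))}"
      using tr_power[OF d(1)] by simp
    show "finite {c :: nat. transmittable n m \<Phi> (matrix_sum c (\<lambda>_. d))}"
      by (rule finite_subset[of _ "{..(\<Sum>i<K. r i div d)}"]) (use tr_power[OF d(1)] in auto)
  qed (use tr_power[OF d(1)] in auto)
  define mu where "mu d = card {i. i < K \<and> r i = d}" for d
  \<comment> \<open>The recursion starts at \<open>M\<close> and descends, whence the induction on
    \<open>M - d\<close>.\<close>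
  have cap: "capacity_mult n m \<Phi> d = int (mu d)" if "0 < d" "d \<le> M" for d
    using that
  proof (induction "M - d" arbitrary: d rule: less_induct)
    case less
    have "(\<Sum>e\<in>{d+1..M}. capacity_mult n m \<Phi> e * int (e div d)) =
        (\<Sum>e\<in>{d+1..M}. int (mu e) * int (e div d))"
      by (rule sum.cong) (use less in auto)
    then have "capacity_mult n m \<Phi> d =
        int (\<Sum>i<K. r i div d) - (\<Sum>e\<in>{d+1..M}. int (mu e) * int (e div d))"
      using hyb[OF less.prems] by (subst capacity_mult.simps) (simp add: dmax)
    also have "\<dots> = int (mu d)"
    proof -
      have "(\<Sum>i<K. r i div d) = mu d + (\<Sum>e\<in>{d+1..M}. mu e * (e div d))"
        unfolding mu_def by (rule sum_div_eq_sum_card) (use rM less.prems in auto)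
      then show ?thesis by simp
    qed
    finally show ?case .
  qed
  then show nonneg: "\<forall>d\<in>{1..d_max n m \<Phi>}. 0 \<le> capacity_mult n m \<Phi> d" by (simp add: dmax)
  \<comment> \<open>For each size \<open>d\<close> the summands of this size are enumerated; the
    pairs \<open>(d, j)\<close> then reindex \<open>{..<K}\<close> in the form used by
    \<open>capacity_algebra\<close>.\<close>
  have "\<exists>h. bij_betw h {..<mu d} {i. i < K \<and> r i = d}" for d
    unfolding mu_def using ex_bij_betw_nat_finite[of "{i. i < K \<and> r i = d}"] by (auto simp: atLeast0LessThan)
  then obtain h where h: "\<And>d. bij_betw (h d) {..<mu d} {i. i < K \<and> r i = d}" by metis
  have hD: "h d j < K" "r (h d j) = d" if "j < mu d" for d j
    using h[of d] that unfolding bij_betw_def by auto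
  define I where "I = (SIGMA d:{1..M}. {..<mu d})"
  have "bij_betw (\<lambda>(d, j). h d j) I {..<K}"
    unfolding bij_betw_def
  proof
    show "inj_on (\<lambda>(d, j). h d j) I"
    proof (rule inj_onI, clarify)
      fix d j d' j' assume "(d, j) \<in> I" "(d', j') \<in> I" and eq: "h d j = h d' j'"
      then have j: "j < mu d" "j' < mu d'" by (auto simp: I_def)
      then have "d = d'" using hD(2)[of j d] hD(2)[of j' d'] eq by simp
      then show "d = d' \<and> j = j'" using h[of d] j eq by (auto simp: bij_betw_def dest: inj_onD)
    qed
    show "(\<lambda>(d, j). h d j) ` I = {..<K}"
    proof
      show "(\<lambda>(d, j). h d j) ` I \<subseteq> {..<K}" using hD by (auto simp: I_def)
      show "{..<K} \<subseteq> (\<lambda>(d, j). h d j) ` I"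
      proof
        fix i assume "i \<in> {..<K}"
        then have i: "i < K" by simp
        then have "i \<in> h (r i) ` {..<mu (r i)}" using h[of "r i"] by (auto simp: bij_betw_def)
        then obtain j where j: "j < mu (r i)" "i = h (r i) j" by auto
        \<comment> \<open>No summand is lost, since all sizes lie between 1 and
          \<open>M\<close>.\<close>
        have "(r i, j) \<in> I" using i j r[OF i] rM[OF i] by (simp add: I_def)
        then show "i \<in> (\<lambda>(d, j). h d j) ` I" using j(2) by (intro image_eqI[of _ _ "(r i, j)"]) auto
      qed
    qed
  qed
  then have "star_isomorphic DS (direct_sum I (\<lambda>(d, _). matrix_algebra d))"
    unfolding DS_def by (rule star_isomorphic_direct_sum_reindex) (use hD in \<open>auto simp: I_def\<close>)
  moreover have cap_eq: "capacity_algebra n m \<Phi> = direct_sum I (\<lambda>(d, _). matrix_algebra d)"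
  proof -
    have "(SIGMA d:{1..M}. {..<nat (capacity_mult n m \<Phi> d)}) = I"
      unfolding I_def by (rule Sigma_cong) (use cap in auto)
    then show ?thesis unfolding capacity_algebra_def dmax by simp
  qed
  ultimately have isoDS: "star_isomorphic DS (capacity_algebra n m \<Phi>)" by simp
  then show isoA: "star_isomorphic A (capacity_algebra n m \<Phi>)"
    using iso unfolding DS_def by (intro star_isomorphic_trans[OF iso])
  have DS_cap: "embeds DS (capacity_algebra n m \<Phi>)" by (rule star_isomorphic_imp_embeds[OF isoDS])
  have ucap: "unital_star_algebra (capacity_algebra n m \<Phi>)"
    unfolding cap_eq by (rule unital_star_algebra_direct_sum) (auto intro: unital_star_algebra_matrix_algebra)
  show "transmittable n m \<Phi> (capacity_algebra n m \<Phi>)"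
  proof (rule imp_tr[OF ucap])
    show "carrier (capacity_algebra n m \<Phi>) \<noteq> {\<zero>\<^bsub>capacity_algebra n m \<Phi>\<^esub>}"
      by (rule embeds_carrier_neq_zero[OF uA nzA ucap star_isomorphic_imp_embeds[OF isoA]])
    show "embeds (capacity_algebra n m \<Phi>) DS"
      by (rule star_isomorphic_imp_embeds[OF star_isomorphic_sym[OF uDS isoDS]])
  qed
  show "\<forall>B\<in>forbidden (capacity_algebra n m \<Phi>). \<not> transmittable n m \<Phi> B"
    using embeds_trans[OF tr_imp DS_cap] unfolding forbidden_def by blast
qed

text \<open>An algebra of least dimension among those that embed in a given one but not in \<open>A\<close> is
  forbidden for \<open>A\<close>.\<close>

lemma forbidden_embeds:
  fixes B :: algebra
  assumes "fd_cstar_algebra B" "\<not> embeds B A"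
  shows "\<exists>C\<in>forbidden A. embeds C B"
  using assms
proof (induction "vectorspace.dim class_ring B" arbitrary: B rule: less_induct)
  case less
  show ?case
  proof (cases "B \<in> forbidden A")
    case True
    have "embeds B B" unfolding embeds_def by (intro bexI[of _ "\<lambda>x. x"]) (auto simp: star_hom_iff)
    then show ?thesis using True by blast
  next
    case False
    \<comment> \<open>Since \<open>B\<close> is not forbidden although it does not embed in
      \<open>A\<close>, some algebra strictly below \<open>B\<close> does not embed in
      \<open>A\<close> either.\<close>
    then obtain C :: algebra where C: "fd_cstar_algebra C" "strictly_embeds C B" "\<not> embeds C A"
      using less.prems unfolding forbidden_def by blast
    obtain C' where "C' \<in> forbidden A" "embeds C' C"
      using less.hyps[OF strictly_embeds_dim_less[OF C(1) less.prems(1) C(2)] C(1,3)] by blast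
    moreover have "embeds C B" using C(2) by (simp add: strictly_embeds_def)
    ultimately show ?thesis using embeds_trans by metis
  qed
qed

text \<open>The dominating algebra is a matrix copy of \<open>A\<close>, since \<open>A\<close> may
  have elements of another type.\<close>

lemma dominating_exists:
  assumes ch: "quantum_channel n m \<Phi>" and A: "transmittable n m \<Phi> A"
    and forb: "\<forall>B\<in>forbidden A. \<not> transmittable n m \<Phi> B"
  shows "\<exists>A'. dominating n m \<Phi> A'"
proof -
  obtain A' :: algebra where A': "transmittable n m \<Phi> A'" "star_isomorphic A A'"
    using transmittable_matrix_copy[OF ch A] by blast
  have "embeds B A'" if B: "transmittable n m \<Phi> B" for B :: algebra
  proof -
    have fB: "fd_cstar_algebra B" using B by (simp add: transmittable_def)
    have "embeds B A"
    proof (rule ccontr)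
      assume "\<not> embeds B A"
      then obtain C where C: "C \<in> forbidden A" "embeds C B" using forbidden_embeds[OF fB] by blast
      then have "fd_cstar_algebra C" by (simp add: forbidden_def)
      then have "transmittable n m \<Phi> C" using transmittable_if_embeds[OF ch B] C(2) by blast
      then show False using forb C(1) by blast
    qed
    then show ?thesis by (rule embeds_trans[OF _ star_isomorphic_imp_embeds[OF A'(2)]])
  qed
  then show ?thesis using A'(1) unfolding dominating_def by blast
qed

theorem corollary4p12:
  fixes n m :: nat and \<Phi> :: "complex mat \<Rightarrow> complex mat"
  assumes "0 < n" and "0 < m" and "quantum_channel n m \<Phi>"
  shows "((\<exists>A. dominating n m \<Phi> A) \<longleftrightarrow>
      (\<forall>d\<in>{1..d_max n m \<Phi>}. 0 \<le> capacity_mult n m \<Phi> d) \<and>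
      transmittable n m \<Phi> (capacity_algebra n m \<Phi>) \<and>
      (\<forall>B\<in>forbidden (capacity_algebra n m \<Phi>). \<not> transmittable n m \<Phi> B)) \<and>
    ((\<forall>d\<in>{1..d_max n m \<Phi>}. 0 \<le> capacity_mult n m \<Phi> d) \<and>
      transmittable n m \<Phi> (capacity_algebra n m \<Phi>) \<and>
      (\<forall>B\<in>forbidden (capacity_algebra n m \<Phi>). \<not> transmittable n m \<Phi> B) \<longrightarrow>
      (\<forall>A. dominating n m \<Phi> A \<longrightarrow> star_isomorphic A (capacity_algebra n m \<Phi>)))"
  using dominating_imp[OF assms(3)] dominating_exists[OF assms(3)] by blast

end
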